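(* Let $r$ be a positive integer and let $\Gamma=\mathrm{SL}_2(\mathbb Z)$ if $r$ is even and $\Gamma=\mathrm{SL}_2(\mathbb Z)^2$ if $r$ is odd. Then there exist two linearly independent solutions $f_1$ and $f_2$ on $\mathbb H$ to $$y''+\pi^2r^2E_4\,y=0$$ such that: (1) $f_1$ and $f_2$ have the expansions $$f_1(\tau)=q^{r/2}\sum_{n\ge0}\alpha_nq^n,\quad \alpha_0\neq0,\qquad\text{and}\qquad f_2(\tau)=\tau f_1(\tau)+q^{-r/2}\sum_{n\ge0}\beta_nq^n,\quad \beta_0\ne0;$$ (2) $f_1$ is a quasi-modular form of weight $0$ and depth $1$ for $\Gamma$, and $f_2(\tau)-\tau f_1(\tau)$ is a modular form of weight $-2$ for $\Gamma$; (3) $h_r=f_2/f_1$ satisfies $h_r(\tau+1)=h_r(\tau)+1$.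
   Context: $\mathbb H=\{\tau\in\mathbb C : \mathrm{Im}\,\tau>0\}$; derivatives are with respect to $\tau\in\mathbb H$; $q=e^{2\pi i\tau}$ and $q^{r/2}=e^{\pi i r\tau}$. $E_4(\tau)=1+240\sum_{n\ge1}\sigma_3(n)q^n$, with $\sigma_3(n)$ the sum of the cubes of the positive divisors of $n$, is the weight 4 Eisenstein series. $\mathrm{SL}_2(\mathbb Z)^2$ denotes the unique subgroup of index 2 of $\mathrm{SL}_2(\mathbb Z)$; it is generated by $P=\begin{pmatrix}0&-1\\1&1\end{pmatrix}$ and $Q=\begin{pmatrix}1&-1\\1&0\end{pmatrix}$, and has a single cusp class, that of $\infty$. Modular forms of weight $k\in\mathbb Z$ for $\Gamma$ are here holomorphic functions $f$ on $\mathbb H$, meromorphic at the cusp $\infty$ (a pole at $\infty$ is allowed), with $f(\gamma\tau)=(c\tau+d)^kf(\tau)$ for all $\gamma=\begin{pmatrix}a&b\\c&d\end{pmatrix}\in\Gamma$. A quasi-modular form of weight $k$ and depth $s$ for $\Gamma$ is a holomorphic function $f$ on $\mathbb H$, meromorphic at $\infty$, for which there are holomorphic functions $\phi_0,\dots,\phi_s$ on $\mathbb H$, meromorphic at $\infty$, with $\phi_s\not\equiv0$, such that $(c\tau+d)^{-k}f(\gamma\tau)=\sum_{i=0}^s\phi_i(\tau)\left(\frac{c}{c\tau+d}\right)^i$ for all $\gamma=\begin{pmatrix}a&b\\c&d\end{pmatrix}\in\Gamma$ and $\tau\in\mathbb H$. *)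

theory Defs
  imports
    "HOL-Complex_Analysis.Complex_Analysis"
    "HOL-Algebra.Coset"
    "HOL-Algebra.Generated_Groups"
begin

definition SL2Z :: "(int^2^2) monoid" where
  "SL2Z = \<lparr>carrier = {A. det A = 1}, mult = (**), one = mat 1\<rparr>"

definition mat22 :: "int \<Rightarrow> int \<Rightarrow> int \<Rightarrow> int \<Rightarrow> int^2^2" where
  "mat22 a b c d = vector [vector [a, b], vector [c, d]]"

text \<open>
  The description by \<^const>\<open>The\<close> is justified by \<open>SL2Z_sq_unique\<close> below, and
  \<open>SL2Z_sq_eq_generate\<close> gives the two generators.
\<close>
definition SL2Z_sq :: "(int^2^2) set" where
  "SL2Z_sq = (THE H. subgroup H SL2Z \<and> card (rcosets\<^bsub>SL2Z\<^esub> H) = 2)"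

abbreviation matP :: "int^2^2" where "matP \<equiv> mat22 0 (-1) 1 1"
abbreviation matQ :: "int^2^2" where "matQ \<equiv> mat22 1 (-1) 1 0"
abbreviation matS :: "int^2^2" where "matS \<equiv> mat22 0 (-1) 1 0"
abbreviation matT :: "int \<Rightarrow> int^2^2" where "matT n \<equiv> mat22 1 n 0 1"

lemma mat22_nth [simp]:
  "mat22 a b c d $ 1 $ 1 = a" "mat22 a b c d $ 1 $ 2 = b"
  "mat22 a b c d $ 2 $ 1 = c" "mat22 a b c d $ 2 $ 2 = d"
  by (simp_all add: mat22_def)

lemma mat22_eta: "mat22 (A$1$1) (A$1$2) (A$2$1) (A$2$2) = A"
  by (simp add: vec_eq_iff forall_2)

lemma mat22_eq_iff [simp]:
  "mat22 a b c d = mat22 a' b' c' d' \<longleftrightarrow> a = a' \<and> b = b' \<and> c = c' \<and> d = d'"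
  by (metis mat22_nth)

lemma mat22_mult [simp]:
  "mat22 a b c d ** mat22 a' b' c' d' =
     mat22 (a*a' + b*c') (a*b' + b*d') (c*a' + d*c') (c*b' + d*d')"
  by (simp add: vec_eq_iff forall_2 matrix_matrix_mult_def sum_2)

lemma det_mat22 [simp]: "det (mat22 a b c d) = a*d - b*c"
  by (simp add: det_2)

lemma mat_1_eq: "mat 1 = mat22 1 0 0 1"
  by (simp add: vec_eq_iff forall_2 mat_def)

lemma SL2Z_simps [simp]:
  "A \<in> carrier SL2Z \<longleftrightarrow> det A = 1" "A \<otimes>\<^bsub>SL2Z\<^esub> B = A ** B" "\<one>\<^bsub>SL2Z\<^esub> = mat22 1 0 0 1"
  by (simp_all add: SL2Z_def mat_1_eq)

lemma group_SL2Z: "group SL2Z"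
proof (rule groupI)
  fix A assume "A \<in> carrier SL2Z"
  then have d: "A$1$1 * A$2$2 - A$1$2 * A$2$1 = 1"
    by (simp add: det_2)
  let ?B = "mat22 (A$2$2) (- A$1$2) (- A$2$1) (A$1$1)"
  have "?B ** mat22 (A$1$1) (A$1$2) (A$2$1) (A$2$2) = mat22 1 0 0 1"
    using d by (simp add: algebra_simps)
  then have "?B ** A = mat22 1 0 0 1" by (simp only: mat22_eta)
  moreover have "det ?B = 1" using d by (simp add: algebra_simps)
  ultimately show "\<exists>B\<in>carrier SL2Z. B \<otimes>\<^bsub>SL2Z\<^esub> A = \<one>\<^bsub>SL2Z\<^esub>" by auto
qed (auto simp: det_mul matrix_mul_assoc simp flip: mat_1_eq)

interpretation SL2Z: group SL2Z by (rule group_SL2Z)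

text \<open>Modulo 2 this is the sign character of SL(2,2), which is a symmetric group on three letters.\<close>

definition sgn2 :: "int^2^2 \<Rightarrow> bool" where
  "sgn2 A = odd (A$1$1 * A$1$2 + A$1$2 * A$2$1 + A$2$1 * A$2$2)"

lemma sgn2_mult:
  assumes "det A = 1" "det B = 1"
  shows "sgn2 (A ** B) \<longleftrightarrow> (sgn2 A \<noteq> sgn2 B)"
proof -
  obtain a b c d where A: "A = mat22 a b c d" by (metis mat22_eta)
  obtain a' b' c' d' where B: "B = mat22 a' b' c' d'" by (metis mat22_eta)
  have "odd (a*d - b*c)" "odd (a'*d' - b'*c')" using assms by (simp_all add: A B)
  then show ?thesis
    by (cases "even a"; cases "even b"; cases "even c"; cases "even d";
        cases "even a'"; cases "even b'"; cases "even c'"; cases "even d'")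
       (simp_all add: A B sgn2_def)
qed

abbreviation gen_PQ :: "(int^2^2) set" where "gen_PQ \<equiv> generate SL2Z {matP, matQ}"

lemma subgroup_gen_PQ: "subgroup gen_PQ SL2Z"
  by (rule SL2Z.generate_is_subgroup) auto

lemma gen_PQ_det: "A \<in> gen_PQ \<Longrightarrow> det A = 1"
  using subgroup.subset[OF subgroup_gen_PQ] by auto

lemma gen_PQ_mult: "A \<in> gen_PQ \<Longrightarrow> B \<in> gen_PQ \<Longrightarrow> A ** B \<in> gen_PQ"
  using generate.eng[of A SL2Z "{matP, matQ}" B] by simp

lemma gen_PQ_basic:
  "mat22 1 0 0 1 \<in> gen_PQ" "matP \<in> gen_PQ" "matQ \<in> gen_PQ"
  "matT 2 \<in> gen_PQ" "matT (-2) \<in> gen_PQ" "mat22 (-1) 0 0 (-1) \<in> gen_PQ"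
proof -
  show 1: "mat22 1 0 0 1 \<in> gen_PQ" using generate.one[of SL2Z "{matP, matQ}"] by simp
  show P: "matP \<in> gen_PQ" and Q: "matQ \<in> gen_PQ" by (auto intro: generate.incl)
  have PP: "matP ** matP \<in> gen_PQ" and QQ: "matQ ** matQ \<in> gen_PQ"
    using P Q by (blast intro: gen_PQ_mult)+
  show m: "mat22 (-1) 0 0 (-1) \<in> gen_PQ" using gen_PQ_mult[OF P PP] by simp
  show "matT 2 \<in> gen_PQ" using gen_PQ_mult[OF gen_PQ_mult[OF m Q] P] by simp
  show "matT (-2) \<in> gen_PQ" using gen_PQ_mult[OF gen_PQ_mult[OF m PP] QQ] by simp
qed

lemma sgn2_gen_PQ: "A \<in> gen_PQ \<Longrightarrow> \<not> sgn2 A"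
proof (induction rule: generate.induct)
  case one
  then show ?case by (simp add: sgn2_def)
next
  case (incl h)
  then show ?case by (auto simp: sgn2_def)
next
  case (inv h)
  then have h: "h \<in> carrier SL2Z" "\<not> sgn2 h" by (auto simp: sgn2_def)
  then have "inv\<^bsub>SL2Z\<^esub> h \<in> carrier SL2Z" "h ** inv\<^bsub>SL2Z\<^esub> h = mat22 1 0 0 1"
    using SL2Z.inv_closed[of h] SL2Z.r_inv[of h] by auto
  then show ?case
    using sgn2_mult[of h "inv\<^bsub>SL2Z\<^esub> h"] h by (simp add: sgn2_def)
next
  case (eng h1 h2)
  then show ?case using sgn2_mult[of h1 h2] gen_PQ_det by simp
qed

definition two_cosets :: "(int^2^2) set" where
  "two_cosets = {A. A \<in> gen_PQ \<or> matT (-1) ** A \<in> gen_PQ}"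

lemma two_cosets_S: "A \<in> two_cosets \<Longrightarrow> matS ** A \<in> two_cosets"
proof -
  assume "A \<in> two_cosets"
  then consider "A \<in> gen_PQ" | "matT (-1) ** A \<in> gen_PQ" by (auto simp: two_cosets_def)
  then show ?thesis
  proof cases
    case 1
    then have "(matT (-2) ** matQ) ** A \<in> gen_PQ"
      using gen_PQ_basic by (blast intro: gen_PQ_mult)
    moreover have "matT (-2) ** matQ = matT (-1) ** matS" by simp
    ultimately show ?thesis unfolding two_cosets_def by (simp add: matrix_mul_assoc)
  next
    case 2
    then have "matP ** (matT (-1) ** A) \<in> gen_PQ"
      using gen_PQ_basic by (blast intro: gen_PQ_mult)
    then show ?thesis unfolding two_cosets_def by (simp add: matrix_mul_assoc)
  qed
qed

lemma two_cosets_T: "A \<in> two_cosets \<Longrightarrow> matT 1 ** A \<in> two_cosets"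
proof -
  assume "A \<in> two_cosets"
  then consider "A \<in> gen_PQ" | "matT (-1) ** A \<in> gen_PQ" by (auto simp: two_cosets_def)
  then show ?thesis
  proof cases
    case 1
    then show ?thesis
      unfolding two_cosets_def by (simp add: matrix_mul_assoc flip: mat_1_eq)
  next
    case 2
    then have "matT 2 ** (matT (-1) ** A) \<in> gen_PQ"
      using gen_PQ_basic by (blast intro: gen_PQ_mult)
    then show ?thesis unfolding two_cosets_def by (simp add: matrix_mul_assoc)
  qed
qed

lemma two_cosets_T': "A \<in> two_cosets \<Longrightarrow> matT (-1) ** A \<in> two_cosets"
proof -
  assume "A \<in> two_cosets"
  then consider "A \<in> gen_PQ" | "matT (-1) ** A \<in> gen_PQ" by (auto simp: two_cosets_def)
  then show ?thesis
  proof cases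
    case 1
    then have "matT (-2) ** A \<in> gen_PQ"
      using gen_PQ_basic by (blast intro: gen_PQ_mult)
    then show ?thesis unfolding two_cosets_def by (simp add: matrix_mul_assoc)
  next
    case 2
    then show ?thesis unfolding two_cosets_def by simp
  qed
qed

lemma two_cosets_Tn:
  assumes "A \<in> two_cosets"
  shows "matT n ** A \<in> two_cosets"
proof (induction n rule: int_induct[where k = 0])
  case base
  show ?case using assms by (simp flip: mat_1_eq)
next
  case (step1 n)
  have "matT (n + 1) ** A = matT 1 ** (matT n ** A)" by (simp add: matrix_mul_assoc add.commute)
  then show ?case using two_cosets_T[OF step1.IH] by simp
next
  case (step2 n)
  have "matT (n - 1) ** A = matT (-1) ** (matT n ** A)" by (simp add: matrix_mul_assoc)
  then show ?case using two_cosets_T'[OF step2.IH] by simp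
qed

lemma SL2Z_two_cosets:
  assumes "det A = 1"
  shows "A \<in> two_cosets"
  using assms
proof (induction "nat \<bar>A$2$1\<bar>" arbitrary: A rule: less_induct)
  case less
  obtain a b c d where A: "A = mat22 a b c d" by (metis mat22_eta)
  have det: "a*d - b*c = 1" using less.prems by (simp add: A)
  show ?case
  proof (cases "c = 0")
    case True
    with det have "a*d = 1" by simp
    then have ad: "a = 1 \<and> d = 1 \<or> a = -1 \<and> d = -1" by (auto simp: zmult_eq_1_iff)
    have "mat22 a 0 0 d \<in> two_cosets"
      using ad gen_PQ_basic by (auto simp: two_cosets_def)
    then have "matT (b*d) ** mat22 a 0 0 d \<in> two_cosets" by (rule two_cosets_Tn)
    moreover have "matT (b*d) ** mat22 a 0 0 d = A" using ad True by (auto simp: A)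
    ultimately show ?thesis by simp
  next
    case False
    define n where "n = - (a div c)"
    define B where "B = matS ** (matT n ** A)"
    have "B $ 2 $ 1 = a mod c"
      by (simp add: B_def A n_def minus_div_mult_eq_mod[symmetric])
    then have "\<bar>B $ 2 $ 1\<bar> < \<bar>c\<bar>" using False abs_mod_less[of c a] by simp
    moreover have "det B = 1" using less.prems by (simp add: B_def det_mul)
    ultimately have "B \<in> two_cosets" using less.hyps[of B] False by (simp add: A)
    then have "matT (-n) ** (matS ** (matS ** (matS ** B))) \<in> two_cosets"
      by (intro two_cosets_Tn two_cosets_S)
    moreover have "matT (-n) ** (matS ** (matS ** (matS ** B))) = A"
      by (simp add: B_def A)
    ultimately show ?thesis by simp
  qed
qed

lemma card_rcosets_gen_PQ: "card (rcosets\<^bsub>SL2Z\<^esub> gen_PQ) = 2"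
proof -
  let ?T = "matT (-1)"
  have sub: "subgroup gen_PQ SL2Z" by (rule subgroup_gen_PQ)
  have "gen_PQ #>\<^bsub>SL2Z\<^esub> A \<in> {gen_PQ, gen_PQ #>\<^bsub>SL2Z\<^esub> ?T}" if A: "A \<in> carrier SL2Z" for A
  proof (cases "A \<in> gen_PQ")
    case True
    then show ?thesis using SL2Z.coset_join2[OF A sub] by simp
  next
    case False
    have iA: "inv\<^bsub>SL2Z\<^esub> A \<in> carrier SL2Z" using A by (rule SL2Z.inv_closed)
    have "inv\<^bsub>SL2Z\<^esub> A \<notin> gen_PQ"
      using False subgroup.m_inv_closed[OF sub, of "inv\<^bsub>SL2Z\<^esub> A"] SL2Z.inv_inv[OF A] by auto
    then have "?T \<otimes>\<^bsub>SL2Z\<^esub> inv\<^bsub>SL2Z\<^esub> A \<in> gen_PQ"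
      using SL2Z_two_cosets[of "inv\<^bsub>SL2Z\<^esub> A"] iA by (auto simp: two_cosets_def)
    then have "gen_PQ #>\<^bsub>SL2Z\<^esub> (?T \<otimes>\<^bsub>SL2Z\<^esub> inv\<^bsub>SL2Z\<^esub> A) = gen_PQ"
      using gen_PQ_det by (intro SL2Z.coset_join2[OF _ sub]) simp_all
    then have "gen_PQ #>\<^bsub>SL2Z\<^esub> ?T = gen_PQ #>\<^bsub>SL2Z\<^esub> A"
      by (rule SL2Z.coset_mult_inv1[OF _ _ A subgroup.subset[OF sub]]) simp
    then show ?thesis by simp
  qed
  moreover have "gen_PQ #>\<^bsub>SL2Z\<^esub> ?T \<in> rcosets\<^bsub>SL2Z\<^esub> gen_PQ"
    by (rule SL2Z.rcosetsI[OF subgroup.subset[OF sub]]) simp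
  moreover have "gen_PQ \<in> rcosets\<^bsub>SL2Z\<^esub> gen_PQ"
    using sub SL2Z.group_axioms by (rule subgroup.subgroup_in_rcosets)
  ultimately have "rcosets\<^bsub>SL2Z\<^esub> gen_PQ = {gen_PQ, gen_PQ #>\<^bsub>SL2Z\<^esub> ?T}"
    unfolding RCOSETS_def by blast
  moreover have "gen_PQ #>\<^bsub>SL2Z\<^esub> ?T \<noteq> gen_PQ"
  proof
    assume "gen_PQ #>\<^bsub>SL2Z\<^esub> ?T = gen_PQ"
    then have "?T \<in> gen_PQ" by (rule SL2Z.coset_join1[OF _ _ sub]) simp
    then show False using sgn2_gen_PQ[of ?T] by (simp add: sgn2_def)
  qed
  ultimately show ?thesis by simp
qed

lemma index_2_square:
  assumes sub: "subgroup H SL2Z" and card: "card (rcosets\<^bsub>SL2Z\<^esub> H) = 2"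
    and A: "A \<in> carrier SL2Z"
  shows "A ** A \<in> H"
proof (cases "A \<in> H")
  case True
  then show ?thesis using subgroup.m_closed[OF sub] by fastforce
next
  case False
  have HG: "H \<subseteq> carrier SL2Z" by (rule subgroup.subset[OF sub])
  have AA: "A \<otimes>\<^bsub>SL2Z\<^esub> A \<in> carrier SL2Z" using A by (rule SL2Z.m_closed[OF _ A])
  have "H \<noteq> H #>\<^bsub>SL2Z\<^esub> A"
    using False SL2Z.coset_join1[OF _ A sub] by metis
  moreover have "{H, H #>\<^bsub>SL2Z\<^esub> A, H #>\<^bsub>SL2Z\<^esub> (A \<otimes>\<^bsub>SL2Z\<^esub> A)} \<subseteq> rcosets\<^bsub>SL2Z\<^esub> H"
    using A AA HG subgroup.subgroup_in_rcosets[OF sub SL2Z.group_axioms] SL2Z.rcosetsI by blast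
  ultimately consider "H #>\<^bsub>SL2Z\<^esub> (A \<otimes>\<^bsub>SL2Z\<^esub> A) = H"
    | "H #>\<^bsub>SL2Z\<^esub> (A \<otimes>\<^bsub>SL2Z\<^esub> A) = H #>\<^bsub>SL2Z\<^esub> A"
    using card unfolding card_2_iff by auto
  then show ?thesis
  proof cases
    case 1
    then show ?thesis using SL2Z.coset_join1[OF 1 AA sub] by simp
  next
    case 2
    then have "H #>\<^bsub>SL2Z\<^esub> ((A \<otimes>\<^bsub>SL2Z\<^esub> A) \<otimes>\<^bsub>SL2Z\<^esub> inv\<^bsub>SL2Z\<^esub> A) = H"
      by (rule SL2Z.coset_mult_inv2[OF _ AA A HG])
    then have "H #>\<^bsub>SL2Z\<^esub> A = H"
      using A by (simp only: SL2Z.m_assoc SL2Z.inv_closed SL2Z.r_inv SL2Z.r_one)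
    then show ?thesis using False SL2Z.coset_join1[OF _ A sub] by metis
  qed
qed

lemma index_2_eq_gen_PQ:
  assumes sub: "subgroup H SL2Z" and card: "card (rcosets\<^bsub>SL2Z\<^esub> H) = 2"
  shows "H = gen_PQ"
proof -
  have sq: "A ** A \<in> H" if "det A = 1" for A
    using index_2_square[OF sub card] that by simp
  have mult: "A ** B \<in> H" if "A \<in> H" "B \<in> H" for A B
    using subgroup.m_closed[OF sub that] by simp
  \<comment> \<open>Both generators are products of squares: they have cube \<open>S\<^sup>2 = -1\<close>.\<close>
  have "(matS ** matS) ** (mat22 1 1 (-1) 0 ** mat22 1 1 (-1) 0) \<in> H"
    by (intro mult sq) simp_all
  then have P: "matP \<in> H" by simp
  have "(matS ** matS) ** (mat22 0 1 (-1) 1 ** mat22 0 1 (-1) 1) \<in> H"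
    by (intro mult sq) simp_all
  then have Q: "matQ \<in> H" by simp
  have incl: "gen_PQ \<subseteq> H" using P Q by (intro SL2Z.generate_subgroup_incl sub) auto
  have T: "matT 1 \<notin> H"
  proof
    assume T: "matT 1 \<in> H"
    have "A \<in> H" if "A \<in> carrier SL2Z" for A
    proof (cases "A \<in> gen_PQ")
      case False
      then have "matT (-1) ** A \<in> H"
        using SL2Z_two_cosets[of A] that incl by (auto simp: two_cosets_def)
      then have "matT 1 ** (matT (-1) ** A) \<in> H" by (rule mult[OF T])
      then show ?thesis by (simp add: matrix_mul_assoc flip: mat_1_eq)
    qed (use incl in blast)
    then have "rcosets\<^bsub>SL2Z\<^esub> H \<subseteq> {H}"
      using SL2Z.coset_join2[OF _ sub] by (auto simp: RCOSETS_def)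
    then have "card (rcosets\<^bsub>SL2Z\<^esub> H) \<le> card {H}" by (intro card_mono) auto
    then show False using card by simp
  qed
  have "A \<in> gen_PQ" if A: "A \<in> H" for A
  proof (rule ccontr)
    assume "A \<notin> gen_PQ"
    moreover have "det A = 1" using subgroup.subset[OF sub] A by auto
    ultimately have "matT (-1) ** A \<in> H"
      using SL2Z_two_cosets[of A] incl by (auto simp: two_cosets_def)
    moreover have iA: "inv\<^bsub>SL2Z\<^esub> A \<in> H" using subgroup.m_inv_closed[OF sub A] .
    ultimately have "(matT (-1) ** A) ** inv\<^bsub>SL2Z\<^esub> A \<in> H" by (rule mult)
    moreover have "A ** inv\<^bsub>SL2Z\<^esub> A = mat 1"
      using SL2Z.r_inv[of A] \<open>det A = 1\<close> by (simp add: mat_1_eq)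
    ultimately have "matT (-1) \<in> H" by (simp flip: matrix_mul_assoc)
    then have "matT (-1) ** matT 2 \<in> H" using gen_PQ_basic incl by (blast intro: mult)
    then show False using T by simp
  qed
  then show ?thesis using incl by blast
qed

theorem SL2Z_sq_unique: "\<exists>!H. subgroup H SL2Z \<and> card (rcosets\<^bsub>SL2Z\<^esub> H) = 2"
  by (rule ex1I[of _ gen_PQ], rule conjI[OF subgroup_gen_PQ card_rcosets_gen_PQ])
     (elim conjE, rule index_2_eq_gen_PQ)

theorem SL2Z_sq_eq_generate: "SL2Z_sq = generate SL2Z {matP, matQ}"
  unfolding SL2Z_sq_def
  by (rule the_equality, rule conjI[OF subgroup_gen_PQ card_rcosets_gen_PQ])
     (elim conjE, rule index_2_eq_gen_PQ)

definition upper_half :: "complex set" where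
  "upper_half = {\<tau>. Im \<tau> > 0}"

definition aut_factor :: "int^2^2 \<Rightarrow> complex \<Rightarrow> complex" where
  "aut_factor A \<tau> = of_int (A$2$1) * \<tau> + of_int (A$2$2)"

definition moebius_act :: "int^2^2 \<Rightarrow> complex \<Rightarrow> complex" where
  "moebius_act A \<tau> = (of_int (A$1$1) * \<tau> + of_int (A$1$2)) / aut_factor A \<tau>"

definition cusp_width :: "(int^2^2) set \<Rightarrow> nat" where
  "cusp_width \<Gamma> = (LEAST h. h > 0 \<and> mat22 1 (int h) 0 1 \<in> \<Gamma>)"

text \<open>
  Meromorphy at the cusp \<open>\<infinity>\<close>: with \<open>h\<close> the width of the cusp, the function is a function of the
  local parameter \<open>e\<^sup>2\<^sup>\<pi>\<^sup>i\<^sup>\<tau>\<^sup>/\<^sup>h\<close> which is meromorphic at \<open>0\<close>. The value of \<open>F\<close> at \<open>0\<close> itself is immaterial.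
\<close>
definition meromorphic_at_cusp :: "(int^2^2) set \<Rightarrow> (complex \<Rightarrow> complex) \<Rightarrow> bool" where
  "meromorphic_at_cusp \<Gamma> f \<longleftrightarrow>
     (\<exists>F. F meromorphic_on {0} \<and>
          (\<forall>\<tau>\<in>upper_half. f \<tau> = F (exp (2 * of_real pi * \<i> * \<tau> / of_nat (cusp_width \<Gamma>)))))"

text \<open>Only the cusp \<open>\<infinity>\<close> is mentioned, so these are meant for groups with a single cusp class.\<close>

definition modular_form :: "(int^2^2) set \<Rightarrow> int \<Rightarrow> (complex \<Rightarrow> complex) \<Rightarrow> bool" where
  "modular_form \<Gamma> k f \<longleftrightarrow>
     f holomorphic_on upper_half \<and> meromorphic_at_cusp \<Gamma> f \<and>
     (\<forall>A\<in>\<Gamma>. \<forall>\<tau>\<in>upper_half. f (moebius_act A \<tau>) = aut_factor A \<tau> powi k * f \<tau>)"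

definition quasi_modular_form :: "(int^2^2) set \<Rightarrow> int \<Rightarrow> nat \<Rightarrow> (complex \<Rightarrow> complex) \<Rightarrow> bool" where
  "quasi_modular_form \<Gamma> k s f \<longleftrightarrow>
     f holomorphic_on upper_half \<and> meromorphic_at_cusp \<Gamma> f \<and>
     (\<exists>\<phi> :: nat \<Rightarrow> complex \<Rightarrow> complex.
        (\<forall>i\<le>s. \<phi> i holomorphic_on upper_half \<and> meromorphic_at_cusp \<Gamma> (\<phi> i)) \<and>
        (\<exists>\<tau>\<in>upper_half. \<phi> s \<tau> \<noteq> 0) \<and>
        (\<forall>A\<in>\<Gamma>. \<forall>\<tau>\<in>upper_half.
           aut_factor A \<tau> powi (- k) * f (moebius_act A \<tau>) =
             (\<Sum>i\<le>s. \<phi> i \<tau> * (of_int (A$2$1) / aut_factor A \<tau>) ^ i)))"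

definition qpar :: "complex \<Rightarrow> complex" where
  "qpar \<tau> = exp (2 * of_real pi * \<i> * \<tau>)"

definition sigma3 :: "nat \<Rightarrow> nat" where
  "sigma3 n = (\<Sum>d | d dvd n. d ^ 3)"

definition E4 :: "complex \<Rightarrow> complex" where
  "E4 \<tau> = 1 + 240 * (\<Sum>n. of_nat (sigma3 (Suc n)) * qpar \<tau> ^ Suc n)"

definition ode_solution :: "nat \<Rightarrow> (complex \<Rightarrow> complex) \<Rightarrow> bool" where
  "ode_solution r y \<longleftrightarrow>
     y holomorphic_on upper_half \<and>
     (\<forall>\<tau>\<in>upper_half. deriv (deriv y) \<tau> + of_real (pi\<^sup>2) * of_nat r ^ 2 * E4 \<tau> * y \<tau> = 0)"

definition lin_indep_on_upper_half :: "(complex \<Rightarrow> complex) \<Rightarrow> (complex \<Rightarrow> complex) \<Rightarrow> bool" where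
  "lin_indep_on_upper_half f g \<longleftrightarrow>
     (\<forall>a b :: complex. (\<forall>\<tau>\<in>upper_half. a * f \<tau> + b * g \<tau> = 0) \<longrightarrow> a = 0 \<and> b = 0)"

text \<open>\<open>q_expansion m a g\<close>: for all \<open>\<tau>\<close> in the upper half plane,
  \<open>g \<tau> = q\<^sup>m\<^sup>/\<^sup>2 \<Sum>n\<ge>0. a n q\<^sup>n\<close> with \<open>q\<^sup>m\<^sup>/\<^sup>2 = e\<^sup>\<pi>\<^sup>i\<^sup>m\<^sup>\<tau>\<close>, the series being convergent.\<close>
definition q_expansion :: "int \<Rightarrow> (nat \<Rightarrow> complex) \<Rightarrow> (complex \<Rightarrow> complex) \<Rightarrow> bool" where
  "q_expansion m a g \<longleftrightarrow>
     (\<forall>\<tau>\<in>upper_half. summable (\<lambda>n. a n * qpar \<tau> ^ n) \<and>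
        g \<tau> = exp (of_real pi * \<i> * of_int m * \<tau>) * (\<Sum>n. a n * qpar \<tau> ^ n))"

text \<open>
  The identity \<open>h(\<tau> + 1) = h(\<tau>) + 1\<close> for the meromorphic function \<open>h = f\<^sub>2/f\<^sub>1\<close>, where \<open>f\<^sub>1\<close>, \<open>f\<^sub>2\<close> have
  no common zero: \<open>h\<close> has a pole exactly where \<open>f\<^sub>1\<close> vanishes, and there division by zero
  would produce the value \<open>0\<close>. So the poles on the two sides are required to match, and the values
  are compared elsewhere.
\<close>
definition quotient_shift_by_1 :: "(complex \<Rightarrow> complex) \<Rightarrow> (complex \<Rightarrow> complex) \<Rightarrow> bool" where
  "quotient_shift_by_1 f2 f1 \<longleftrightarrow>
     (\<forall>\<tau>\<in>upper_half. (f1 (\<tau> + 1) = 0 \<longleftrightarrow> f1 \<tau> = 0) \<and>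
        (f1 \<tau> \<noteq> 0 \<longrightarrow> f2 (\<tau> + 1) / f1 (\<tau> + 1) = f2 \<tau> / f1 \<tau> + 1))"

end

theory Submission
  imports Defs "HOL-Real_Asymp.Real_Asymp"
begin

text \<open>
  The equation has weight four, because \<open>E4 (- 1 / \<tau>) = \<tau> ^ 4 * E4 \<tau>\<close>. Hence its solution space is
  stable under the action \<open>y \<mapsto> (c \<tau> + d) y ((a \<tau> + b) / (c \<tau> + d))\<close> of weight \<open>-1\<close>, and this
  two-dimensional representation of SL(2,Z) can be computed completely from its relations. Write
  \<open>\<epsilon> = (-1)\<^sup>r\<close> and let \<open>S: \<tau> \<mapsto> - 1 / \<tau>\<close> and \<open>T: \<tau> \<mapsto> \<tau> + 1\<close>.

  The method of Frobenius at \<open>q = 0\<close>, with the indicial root \<open>r / 2\<close>, gives a solution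
  \<open>f\<^sub>1 = q\<^sup>r\<^sup>/\<^sup>2 (1 + \<dots>)\<close>, an eigenvector of \<open>T\<close> with eigenvalue \<open>\<epsilon>\<close>. Its image \<open>G \<tau> = \<tau> f\<^sub>1 (- 1 / \<tau>)\<close>
  under \<open>S\<close> is a second solution. If \<open>f\<^sub>1\<close> and \<open>G\<close> were proportional, then \<open>S\<close> would act on \<open>f\<^sub>1\<close> by a
  scalar; its square would be \<open>-1\<close>, as \<open>S\<^sup>2 = -1\<close> acts by \<open>-1\<close>, while \<open>(S T)\<^sup>3 = -1\<close> would make the
  scalar equal to \<open>\<epsilon>\<close>, a contradiction. So they form a basis. In this basis \<open>T\<close> is triangular; that it
  preserves the Wronskian determines its second diagonal entry, and \<open>(S T)\<^sup>3 = -1\<close> determines the entry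
  off the diagonal: \<open>G (\<tau> + 1) = f\<^sub>1 \<tau> + \<epsilon> G \<tau>\<close> (\<open>second_solution_T\<close>). With \<open>f\<^sub>2 = \<epsilon> G\<close>, both \<open>S\<close> and \<open>T\<close>
  act on \<open>(f\<^sub>2, f\<^sub>1)\<close> by \<open>\<epsilon>\<close> times their own matrices. An element that is a product of an even number
  of these two therefore acts by its own matrix; for odd \<open>r\<close> this covers the generators
  \<open>P = S T\<close> and \<open>Q = T S\<close> of the subgroup of index two, and for even \<open>r\<close> there is no sign at all.
  The transformation laws of \<open>f\<^sub>1\<close> and of \<open>g \<tau> = f\<^sub>2 \<tau> - \<tau> f\<^sub>1 \<tau>\<close> are formal consequences
  (\<open>equivariant_pair_imp_quasimodular\<close>), and so is \<open>h (\<tau> + 1) = h \<tau> + 1\<close> for \<open>h = f\<^sub>2 / f\<^sub>1\<close>.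

  What remains is the behaviour of \<open>g\<close> at the cusp. The function \<open>q\<^sup>r\<^sup>/\<^sup>2 g\<close> has period one, so it is a
  function of \<open>q\<close> on the punctured unit disc. It is bounded near \<open>0\<close>, because the derivative of
  \<open>f\<^sub>2 / f\<^sub>1\<close> is the constant Wronskian divided by \<open>f\<^sub>1\<^sup>2\<close>, hence \<open>O(q\<^sup>-\<^sup>r)\<close>, and integration along vertical
  lines preserves this order. The singularity is therefore removable. The constant term \<open>\<beta>\<^sub>0\<close> does not
  vanish: the Wronskian of \<open>f\<^sub>1\<close> and \<open>f\<^sub>2\<close> equals \<open>f\<^sub>1\<^sup>2 + f\<^sub>1 g' - f\<^sub>1' g\<close>, which tends to
  \<open>- 2 \<pi> i r \<alpha>\<^sub>0 \<beta>\<^sub>0\<close> as \<open>q\<close> tends to \<open>0\<close> (\<open>wronskian_leading_coefficients\<close>).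

  The modularity of \<open>E4\<close> comes from the absolutely convergent sum of \<open>(c \<tau> + d)\<^sup>-\<^sup>4\<close> over all pairs
  \<open>(c, d)\<close>: on it \<open>S\<close> merely permutes the pairs. Summing over \<open>d\<close> first turns it into the \<open>q\<close>-series by
  Lipschitz's formula, which is the third derivative of the reflection formula for the digamma
  function.
\<close>

section \<open>Lipschitz's formula in weight 4\<close>

lemma cot_has_field_derivative:
  fixes z :: complex
  assumes "sin (of_real pi * z) \<noteq> 0"
  shows "((\<lambda>z. cot (of_real pi * z)) has_field_derivative - of_real pi * (1 + cot (of_real pi * z) ^ 2)) (at z)"
proof -
  have "1 + cot (of_real pi * z) ^ 2 = inverse (sin (of_real pi * z) ^ 2)"
    using assms sin_cos_squared_add[of "of_real pi * z"]
    by (simp add: cot_def field_simps)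
  then have "- of_real pi * (1 + cot (of_real pi * z) ^ 2) = - inverse (sin (of_real pi * z) ^ 2) * of_real pi"
    by simp
  moreover have "((\<lambda>z. of_real pi * z) has_field_derivative of_real pi) (at z)"
    by (auto intro!: derivative_eq_intros)
  ultimately show ?thesis
    using DERIV_chain2[where f = cot and g = "\<lambda>z. of_real pi * z" and x = z, OF DERIV_cot[OF assms]]
    by metis
qed

lemma sin_pi_times_eq_0_iff: "sin (of_real pi * z) = 0 \<longleftrightarrow> z \<in> \<int>" for z :: complex
  using sin_eq_0[of "of_real pi * z"] by (auto simp: Ints_def mult.commute)

lemma derivatives_eq_on_open:
  fixes f g :: "complex \<Rightarrow> complex"
  assumes "open S" "\<And>z. z \<in> S \<Longrightarrow> f z = g z"
    and "\<And>z. z \<in> S \<Longrightarrow> (f has_field_derivative f' z) (at z)"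
    and "\<And>z. z \<in> S \<Longrightarrow> (g has_field_derivative g' z) (at z)"
    and "z \<in> S"
  shows "f' z = g' z"
  using assms by (metis DERIV_unique has_field_derivative_transform_within_open)

lemma open_non_Ints: "open (- (\<int> :: complex set))"
  by auto

lemma non_Ints_Gamma:
  assumes "z \<in> - (\<int> :: complex set)"
  shows "z \<notin> \<int>\<^sub>\<le>\<^sub>0" "1 - z \<notin> \<int>\<^sub>\<le>\<^sub>0" "sin (of_real pi * z) \<noteq> 0"
proof -
  show "z \<notin> \<int>\<^sub>\<le>\<^sub>0" using assms nonpos_Ints_subset_Ints by auto
  show "1 - z \<notin> \<int>\<^sub>\<le>\<^sub>0"
  proof
    assume "1 - z \<in> \<int>\<^sub>\<le>\<^sub>0"
    then have "1 - (1 - z) \<in> \<int>" using nonpos_Ints_subset_Ints by (intro Ints_diff) auto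
    with assms show False by simp
  qed
  show "sin (of_real pi * z) \<noteq> 0" using assms by (simp add: sin_pi_times_eq_0_iff)
qed

lemma Digamma_reflection:
  fixes z :: complex
  assumes "z \<in> - \<int>"
  shows "Digamma z - Digamma (1 - z) = - of_real pi * cot (of_real pi * z)"
proof -
  let ?f' = "\<lambda>z. Gamma z * Gamma (1 - z) * (Digamma z - Digamma (1 - z))"
  let ?g' = "\<lambda>z::complex. - (of_real pi ^ 2 * cos (of_real pi * z)) / sin (of_real pi * z) ^ 2"
  have "?f' z = ?g' z"
  proof (rule derivatives_eq_on_open[OF open_non_Ints _ _ _ assms])
    fix z :: complex assume "z \<in> - \<int>"
    note z = non_Ints_Gamma[OF this]
    show "Gamma z * Gamma (1 - z) = of_real pi / sin (of_real pi * z)"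
      by (rule Gamma_reflection_complex)
    show "((\<lambda>z. Gamma z * Gamma (1 - z)) has_field_derivative ?f' z) (at z)"
      using z by (auto intro!: derivative_eq_intros simp: algebra_simps)
    show "((\<lambda>z. of_real pi / sin (of_real pi * z)) has_field_derivative ?g' z) (at z)"
      using z by (auto intro!: derivative_eq_intros simp: power2_eq_square)
  qed
  then have "of_real pi / sin (of_real pi * z) * (Digamma z - Digamma (1 - z)) =
      of_real pi / sin (of_real pi * z) * (- of_real pi * cot (of_real pi * z))"
    unfolding Gamma_reflection_complex by (simp add: cot_def power2_eq_square)
  moreover have "of_real pi / sin (of_real pi * z) \<noteq> 0"
    using non_Ints_Gamma[OF assms] by simp
  ultimately show ?thesis by (metis mult_left_cancel)
qed

text \<open>
  Each derivative is a polynomial in the cotangent, since \<open>cot' = - (1 + cot\<^sup>2)\<close>.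
\<close>
lemma Polygamma_3_reflection:
  fixes z :: complex
  assumes z: "z \<in> - \<int>"
  defines "c \<equiv> \<lambda>z. cot (of_real pi * z)"
  shows "Polygamma 3 z + Polygamma 3 (1 - z) = 2 * of_real pi ^ 4 * (1 + c z ^ 2) * (1 + 3 * c z ^ 2)"
proof -
  have cot': "(c has_field_derivative - of_real pi * (1 + c z ^ 2)) (at z)" if "z \<notin> \<int>" for z
    unfolding c_def using cot_has_field_derivative non_Ints_Gamma[of z] that by simp
  note [derivative_intros] = cot'
  have 0: "Digamma z - Digamma (1 - z) = - of_real pi * c z" if "z \<in> - \<int>" for z
    using Digamma_reflection[OF that] by (simp add: c_def)
  have 1: "Polygamma 1 z + Polygamma 1 (1 - z) = of_real pi ^ 2 * (1 + c z ^ 2)"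
    if z: "z \<in> - \<int>" for z
    by (rule derivatives_eq_on_open[OF open_non_Ints _ _ _ z,
          of "\<lambda>z. Digamma z - Digamma (1 - z)" "\<lambda>z. - of_real pi * c z"])
      (use 0 non_Ints_Gamma in \<open>auto intro!: derivative_eq_intros simp: power2_eq_square\<close>)
  have 2: "Polygamma 2 z - Polygamma 2 (1 - z) = - 2 * of_real pi ^ 3 * c z * (1 + c z ^ 2)"
    if z: "z \<in> - \<int>" for z
    by (rule derivatives_eq_on_open[OF open_non_Ints _ _ _ z,
          of "\<lambda>z. Polygamma 1 z + Polygamma 1 (1 - z)" "\<lambda>z. of_real pi ^ 2 * (1 + c z ^ 2)"])
      (use 1 non_Ints_Gamma in \<open>auto intro!: derivative_eq_intros
         simp: numeral_2_eq_2 numeral_3_eq_3 algebra_simps\<close>)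
  show ?thesis
    by (rule derivatives_eq_on_open[OF open_non_Ints _ _ _ z,
          of "\<lambda>z. Polygamma 2 z - Polygamma 2 (1 - z)" "\<lambda>z. - 2 * of_real pi ^ 3 * c z * (1 + c z ^ 2)"])
      (use 2 non_Ints_Gamma in \<open>auto intro!: derivative_eq_intros
         simp: eval_nat_numeral algebra_simps\<close>)
qed

lemma summable_power_times_geometric:
  fixes x :: "'a :: {real_normed_field, banach}"
  assumes "norm x < 1"
  shows "summable (\<lambda>n. norm (of_nat n ^ k * x ^ n))"
proof (cases "x = 0")
  case False
  define y where "y = norm x"
  have y: "0 < y" "y < 1" using assms False by (auto simp: y_def)
  have "(\<lambda>n. real n ^ k * y ^ n) \<in> O(\<lambda>n. inverse (real n ^ 2))"
    using y by real_asymp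
  then have "summable (\<lambda>n. real n ^ k * y ^ n)"
    by (rule summable_comparison_test_bigo[rotated])
       (use inverse_power_summable[of 2] in simp)
  then show ?thesis by (simp add: y_def norm_mult norm_power)
qed (auto intro!: summable_finite[of "{0}"])

text \<open>
  With \<open>S\<^sub>k\<close> the sum of \<open>n\<^sup>k q\<^sup>n\<close>, shifting the index by one and expanding \<open>(n + 1)\<^sup>k\<close> gives
  linear relations that determine \<open>S\<^sub>1\<close>, \<open>S\<^sub>2\<close>, \<open>S\<^sub>3\<close> successively from the geometric series \<open>S\<^sub>0\<close>.
\<close>
lemma sums_cubes_geometric:
  fixes q :: complex
  assumes q: "norm q < 1"
  shows "(\<lambda>n. of_nat n ^ 3 * q ^ n) sums (q * (1 + 4 * q + q ^ 2) / (1 - q) ^ 4)"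
proof -
  define S where "S = (\<lambda>k. \<Sum>n. of_nat n ^ k * q ^ n)"
  have summable: "(\<lambda>n. of_nat n ^ k * q ^ n) sums S k" for k
    unfolding S_def using summable_norm_cancel[OF summable_power_times_geometric[OF q, of k]]
    by (rule summable_sums)
  have q1: "q \<noteq> 1" using q by auto
  have "(\<lambda>n. of_nat (Suc n) ^ k * q ^ Suc n) sums (S k - of_nat 0 ^ k)" for k
    using summable[of k] by (subst sums_Suc_iff) (simp add: algebra_simps)
  note shift = this
  have S0: "S 0 = 1 / (1 - q)" using geometric_sums[OF q] summable[of 0] by (simp add: sums_iff)
  have "(\<lambda>n. q * (of_nat n ^ 1 * q ^ n) + q * (of_nat n ^ 0 * q ^ n)) sums (q * S 1 + q * S 0)"
    by (intro sums_add sums_mult summable)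
  moreover have "(\<lambda>n. q * (of_nat n ^ 1 * q ^ n) + q * (of_nat n ^ 0 * q ^ n)) = (\<lambda>n. of_nat (Suc n) ^ 1 * q ^ Suc n)"
    by (simp add: fun_eq_iff algebra_simps)
  ultimately have S1: "S 1 = q * S 1 + q * S 0"
    using shift[of 1] by (simp add: sums_iff)
  have "(\<lambda>n. q * (of_nat n ^ 2 * q ^ n) + 2 * q * (of_nat n ^ 1 * q ^ n) + q * (of_nat n ^ 0 * q ^ n))
     sums (q * S 2 + 2 * q * S 1 + q * S 0)"
    by (intro sums_add sums_mult summable)
  moreover have "(\<lambda>n. q * (of_nat n ^ 2 * q ^ n) + 2 * q * (of_nat n ^ 1 * q ^ n) + q * (of_nat n ^ 0 * q ^ n))
     = (\<lambda>n. of_nat (Suc n) ^ 2 * q ^ Suc n)"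
    by (simp add: fun_eq_iff algebra_simps power2_eq_square)
  ultimately have S2: "S 2 = q * S 2 + 2 * q * S 1 + q * S 0"
    using shift[of 2] by (simp add: sums_iff)
  have "(\<lambda>n. q * (of_nat n ^ 3 * q ^ n) + 3 * q * (of_nat n ^ 2 * q ^ n) + 3 * q * (of_nat n ^ 1 * q ^ n) + q * (of_nat n ^ 0 * q ^ n))
     sums (q * S 3 + 3 * q * S 2 + 3 * q * S 1 + q * S 0)"
    by (intro sums_add sums_mult summable)
  moreover have "(\<lambda>n. q * (of_nat n ^ 3 * q ^ n) + 3 * q * (of_nat n ^ 2 * q ^ n) + 3 * q * (of_nat n ^ 1 * q ^ n) + q * (of_nat n ^ 0 * q ^ n))
     = (\<lambda>n. of_nat (Suc n) ^ 3 * q ^ Suc n)"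
    by (simp add: fun_eq_iff algebra_simps eval_nat_numeral)
  ultimately have S3: "S 3 = q * S 3 + 3 * q * S 2 + 3 * q * S 1 + q * S 0"
    using shift[of 3] by (simp add: sums_iff)
  have "S 1 = q * S 0 / (1 - q)" using S1 q1 by (simp add: field_simps)
  moreover have "S 2 = (2 * q * S 1 + q * S 0) / (1 - q)" using S2 q1 by (simp add: field_simps)
  moreover have "S 3 = (3 * q * S 2 + 3 * q * S 1 + q * S 0) / (1 - q)"
    using S3 q1 by (simp add: field_simps)
  moreover define u where "u = inverse (1 - q)"
  ultimately have "S 3 = (3 * q * ((2 * q * (q * u * u) + q * u) * u) + 3 * q * (q * u * u) + q * u) * u"
    using S0 by (simp add: divide_inverse)
  also have "\<dots> = q * (6 * q ^ 2 * u ^ 4 + 3 * q * u ^ 3 + 3 * q * u ^ 3 + u ^ 2)"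
    by (simp add: algebra_simps eval_nat_numeral)
  also have "\<dots> = q * (1 + 4 * q + q ^ 2) / (1 - q) ^ 4"
  proof -
    have "(1 - q) * u = 1" using q1 by (simp add: u_def)
    then have 1: "u ^ 3 = u ^ 4 * (1 - q)" "u ^ 2 = u ^ 4 * (1 - q) ^ 2" by algebra+
    have "6 * q ^ 2 * u ^ 4 + 3 * q * u ^ 3 + 3 * q * u ^ 3 + u ^ 2 = u ^ 4 * (1 + 4 * q + q ^ 2)"
      unfolding 1 by algebra
    then show ?thesis by (simp add: u_def divide_inverse power_inverse mult_ac)
  qed
  finally show ?thesis using summable[of 3] by simp
qed

lemma qpar_norm: "norm (qpar \<tau>) = exp (- 2 * pi * Im \<tau>)"
  by (simp add: qpar_def norm_exp_eq_Re)

lemma qpar_norm_less_1: "\<tau> \<in> upper_half \<Longrightarrow> norm (qpar \<tau>) < 1"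
  by (simp add: qpar_norm upper_half_def)

lemma upper_half_non_Ints: "\<tau> \<in> upper_half \<Longrightarrow> \<tau> \<in> - \<int>"
  by (auto simp: upper_half_def Ints_def)

lemma cot_pi_qpar:
  assumes "\<tau> \<in> upper_half"
  shows "cot (of_real pi * \<tau>) = \<i> * (qpar \<tau> + 1) / (qpar \<tau> - 1)"
proof -
  define x where "x = of_real pi * \<tau>"
  define e where "e = exp (\<i> * x)"
  have e0: "e \<noteq> 0" by (simp add: e_def)
  have q: "qpar \<tau> = e * e" by (simp add: qpar_def e_def x_def mult_ac flip: exp_add)
  have q1: "e * e \<noteq> 1" using qpar_norm_less_1[OF assms] by (auto simp: q[symmetric])
  have "cos x = (e + inverse e) / 2" "sin x = (e - inverse e) / (2 * \<i>)"
    by (simp_all add: cos_exp_eq sin_exp_eq e_def exp_minus)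
  then have "cot x = ((e + inverse e) / 2) / ((e - inverse e) / (2 * \<i>))"
    by (simp only: cot_def)
  moreover have "(a / 2) / (b / (2 * \<i>)) = \<i> * a / b" for a b
    by (cases "b = 0") (simp_all add: field_simps)
  ultimately have "cot x = \<i> * (e + inverse e) / (e - inverse e)"
    by (simp only:)
  also have "\<dots> = \<i> * ((e + inverse e) * e) / ((e - inverse e) * e)"
    using e0 by simp
  also have "(e + inverse e) * e = qpar \<tau> + 1"
    using e0 by (simp add: q algebra_simps)
  also have "(e - inverse e) * e = qpar \<tau> - 1"
    using e0 by (simp add: q algebra_simps)
  finally show ?thesis by (simp add: x_def)
qed

lemma has_sum_int_split:
  fixes f :: "int \<Rightarrow> 'a :: {topological_comm_monoid_add, t2_space}"
  assumes "((\<lambda>n. f (int n)) has_sum a) UNIV" "((\<lambda>n. f (- 1 - int n)) has_sum b) UNIV"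
  shows "(f has_sum (a + b)) UNIV"
proof -
  have "(f has_sum a) {0..} \<longleftrightarrow> ((\<lambda>n. f (int n)) has_sum a) UNIV"
    by (rule has_sum_reindex_bij_witness[of _ int nat]) auto
  moreover have "(f has_sum b) {..<0} \<longleftrightarrow> ((\<lambda>n. f (- 1 - int n)) has_sum b) UNIV"
    by (rule has_sum_reindex_bij_witness[of _ "\<lambda>n. - 1 - int n" "\<lambda>m. nat (- 1 - m)"]) auto
  ultimately have "(f has_sum (a + b)) ({0..} \<union> {..<0})"
    using assms by (intro has_sum_Un_disjoint) auto
  moreover have "{0..} \<union> {..<0::int} = UNIV" by auto
  ultimately show ?thesis by simp
qed

text \<open>
  The terms with \<open>n \<ge> 0\<close> form the series of the polygamma function at \<open>z\<close>, and since the exponent is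
  even the terms with \<open>n < 0\<close> form the one at \<open>1 - z\<close>.
\<close>
lemma has_sum_inverse_fourth_powers:
  assumes z: "z \<in> - (\<int> :: complex set)"
  shows "((\<lambda>n. 1 / (z + of_int n) ^ 4) has_sum ((Polygamma 3 z + Polygamma 3 (1 - z)) / 6)) UNIV"
proof -
  have *: "((\<lambda>k. 1 / (w + of_nat k) ^ 4) has_sum (Polygamma 3 w / 6)) UNIV" if "w \<noteq> 0" for w :: complex
  proof (rule norm_summable_imp_has_sum)
    have "(\<lambda>k. 1 / (w + of_nat k) ^ 4) = (\<lambda>k. inverse ((w + of_nat k) ^ Suc 3))"
      by (simp add: inverse_eq_divide eval_nat_numeral)
    moreover have "Polygamma 3 w / 6 = (\<Sum>k. inverse ((w + of_nat k) ^ Suc 3))"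
      by (simp add: Polygamma_def fact_numeral)
    ultimately show "(\<lambda>k. 1 / (w + of_nat k) ^ 4) sums (Polygamma 3 w / 6)"
      using Polygamma_converges'[of w "Suc 3"] that by (simp add: summable_sums)
    have "(\<lambda>k. norm (1 / (w + of_nat k) ^ 4)) \<in> O(\<lambda>k. inverse (real k ^ 2))"
    proof (rule bigoI[of _ 1], rule eventually_mono[OF eventually_ge_at_top[of "nat \<lceil>max (2 * norm w) 4\<rceil>"]])
      fix k assume "nat \<lceil>max (2 * norm w) 4\<rceil> \<le> k"
      then have k: "2 * norm w \<le> real k" "4 \<le> real k" by linarith+
      have "real k \<le> norm (w + of_nat k) + norm w"
        using norm_triangle_ineq4[of "w + of_nat k" w] by simp
      then have "real k / 2 \<le> norm (w + of_nat k)" using k by linarith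
      then have "(real k / 2) ^ 4 \<le> norm (w + of_nat k) ^ 4" by (intro power_mono) auto
      moreover have "real k ^ 2 * 4 ^ 2 \<le> real k ^ 2 * real k ^ 2"
        using k by (intro mult_left_mono power_mono) auto
      then have "real k ^ 2 \<le> (real k / 2) ^ 4" by (simp add: field_simps)
      ultimately have "real k ^ 2 \<le> norm (w + of_nat k) ^ 4" by linarith
      then have "inverse (norm (w + of_nat k) ^ 4) \<le> inverse (real k ^ 2)"
        using k by (intro le_imp_inverse_le) auto
      then show "norm (norm (1 / (w + of_nat k) ^ 4)) \<le> 1 * norm (inverse (real k ^ 2))"
        by (simp add: norm_divide norm_power inverse_eq_divide)
    qed
    then show "summable (\<lambda>k. norm (1 / (w + of_nat k) ^ 4))"
      by (rule summable_comparison_test_bigo[rotated])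
         (use inverse_power_summable[of 2] in simp)
  qed
  have 0: "z \<noteq> 0" "1 - z \<noteq> 0" using z by auto
  have "(z + of_int (- 1 - int n)) ^ 4 = (1 - z + of_nat n) ^ 4" for n
  proof -
    have "z + of_int (- 1 - int n) = - (1 - z + of_nat n)" by simp
    then show ?thesis by (metis power_minus_even even_numeral)
  qed
  then show ?thesis
    using *[OF 0(1)] *[OF 0(2)] unfolding add_divide_distrib
    by (intro has_sum_int_split) simp_all
qed

text \<open>
  By the reflection formula both sides are rational functions of \<open>q\<close>.
\<close>
lemma Lipschitz_4:
  assumes "\<tau> \<in> upper_half"
  shows "((\<lambda>n. 1 / (\<tau> + of_int n) ^ 4) has_sum
           (8 * of_real pi ^ 4 / 3 * (\<Sum>n. of_nat n ^ 3 * qpar \<tau> ^ n))) UNIV"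
proof -
  define q where "q = qpar \<tau>"
  have q: "norm q < 1" "q \<noteq> 1" using qpar_norm_less_1[OF assms] by (auto simp: q_def)
  have c: "cot (of_real pi * \<tau>) ^ 2 = - ((q + 1) ^ 2) / (q - 1) ^ 2"
    using cot_pi_qpar[OF assms] by (simp add: q_def power_divide power_mult_distrib)
  have "(1 + cot (of_real pi * \<tau>) ^ 2) * (1 + 3 * cot (of_real pi * \<tau>) ^ 2) =
     8 * (q * (1 + 4 * q + q ^ 2) / (1 - q) ^ 4)"
  proof -
    have "1 + cot (of_real pi * \<tau>) ^ 2 = - 4 * q / (q - 1) ^ 2"
      unfolding c using q by (simp add: divide_simps) algebra
    moreover have "1 + 3 * cot (of_real pi * \<tau>) ^ 2 = - 2 * (1 + 4 * q + q ^ 2) / (q - 1) ^ 2"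
      unfolding c using q by (simp add: divide_simps) algebra
    moreover have "(1 - q) ^ 4 = (q - 1) ^ 2 * (q - 1) ^ 2" by algebra
    moreover have "- 4 * q / D * (- 2 * B / D) = 8 * (q * B / (D * D))" for B D :: complex
      by (simp add: field_simps)
    ultimately show ?thesis by (simp only:)
  qed
  then have "(Polygamma 3 \<tau> + Polygamma 3 (1 - \<tau>)) / 6 = 8 * of_real pi ^ 4 / 3 * (q * (1 + 4 * q + q ^ 2) / (1 - q) ^ 4)"
    using Polygamma_3_reflection[OF upper_half_non_Ints[OF assms]] by (simp add: mult.assoc)
  also have "q * (1 + 4 * q + q ^ 2) / (1 - q) ^ 4 = (\<Sum>n. of_nat n ^ 3 * q ^ n)"
    using sums_cubes_geometric[OF q(1)] by (simp add: sums_iff)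
  finally have "(Polygamma 3 \<tau> + Polygamma 3 (1 - \<tau>)) / 6 =
      8 * of_real pi ^ 4 / 3 * (\<Sum>n. of_nat n ^ 3 * q ^ n)" .
  then show ?thesis
    using has_sum_inverse_fourth_powers[OF upper_half_non_Ints[OF assms]] by (simp only: q_def)
qed

section \<open>Modularity of the Eisenstein series\<close>

lemma summable_on_inverse_square_plus_1: "(\<lambda>d::int. 1 / (1 + (real_of_int d) ^ 2)) summable_on UNIV"
proof -
  have 1: "summable (\<lambda>n. 1 / (1 + real n ^ 2))"
    by (rule summable_comparison_test'[OF inverse_power_summable[of 2, where 'a = real], of 1])
       (auto simp: inverse_eq_divide intro!: divide_left_mono mult_pos_pos add_pos_nonneg)
  have "summable (\<lambda>n. 1 / (1 + real (Suc n) ^ 2))" using 1 by (subst summable_Suc_iff)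
  then have 2: "summable (\<lambda>n. 1 / (1 + (real_of_int (- 1 - int n)) ^ 2))"
    by (simp add: power2_eq_square algebra_simps)
  have "((\<lambda>d::int. 1 / (1 + (real_of_int d) ^ 2)) has_sum
     ((\<Sum>n. 1 / (1 + real n ^ 2)) + (\<Sum>n. 1 / (1 + (real_of_int (- 1 - int n)) ^ 2)))) UNIV"
    using 1 2 by (intro has_sum_int_split norm_summable_imp_has_sum) (auto intro!: summable_sums)
  then show ?thesis by (rule has_sum_imp_summable)
qed

text \<open>
  A product bound makes the double series a product of two simple ones. It follows from
  \<open>c\<^sup>2 + d\<^sup>2 \<le> K \<bar>c \<tau> + d\<bar>\<^sup>2\<close> and from \<open>(1 + c\<^sup>2) (1 + d\<^sup>2) \<le> 3 (c\<^sup>2 + d\<^sup>2)\<^sup>2\<close>, which holds as soon as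
  \<open>(c, d) \<noteq> (0, 0)\<close>. For \<open>(0, 0)\<close> the left-hand side is \<open>0\<close> by the convention on division.
\<close>
lemma lattice_product_bound:
  assumes "\<tau> \<in> upper_half"
  obtains C where "C \<ge> 0"
    "\<And>c d :: int. norm (1 / (of_int c * \<tau> + of_int d) ^ 4) \<le> C * (1 / (1 + of_int c ^ 2) * (1 / (1 + of_int d ^ 2)))"
proof
  define x y where "x = Re \<tau>" and "y = Im \<tau>"
  define K where "K = 2 + (2 * x\<^sup>2 + 1) / y\<^sup>2"
  have y: "y > 0" using assms by (simp add: upper_half_def y_def)
  show "0 \<le> 3 * K\<^sup>2" by simp
  fix c d :: int
  define c' d' where "c' = real_of_int c" and "d' = real_of_int d"
  define w where "w = of_int c * \<tau> + of_int d"
  define N where "N = c'\<^sup>2 + d'\<^sup>2"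
  show "norm (1 / (of_int c * \<tau> + of_int d) ^ 4) \<le> 3 * K\<^sup>2 * (1 / (1 + of_int c ^ 2) * (1 / (1 + of_int d ^ 2)))"
  proof (cases "c = 0 \<and> d = 0")
    case False
    have w: "(norm w)\<^sup>2 = (c' * x + d')\<^sup>2 + c'\<^sup>2 * y\<^sup>2"
      by (simp add: cmod_power2 w_def c'_def d'_def x_def y_def power_mult_distrib)
    have "0 \<le> (2 * (c' * x) + d')\<^sup>2" by simp
    then have "d'\<^sup>2 \<le> 2 * (c' * x + d')\<^sup>2 + 2 * (c' * x)\<^sup>2"
      by (simp add: power2_eq_square algebra_simps)
    then have "N \<le> 2 * (c' * x + d')\<^sup>2 + (2 * x\<^sup>2 + 1) * c'\<^sup>2"
      by (simp add: N_def power2_eq_square algebra_simps)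
    also have "\<dots> = 2 * (c' * x + d')\<^sup>2 + (2 * x\<^sup>2 + 1) / y\<^sup>2 * (c'\<^sup>2 * y\<^sup>2)"
      using y by simp
    also have "\<dots> \<le> K * (c' * x + d')\<^sup>2 + K * (c'\<^sup>2 * y\<^sup>2)"
      unfolding K_def by (intro add_mono mult_right_mono) auto
    finally have N: "N \<le> K * (norm w)\<^sup>2" by (simp add: w algebra_simps)
    have "1 \<le> c\<^sup>2 + d\<^sup>2"
    proof -
      have "0 < c\<^sup>2 + d\<^sup>2" using False by (simp add: sum_power2_gt_zero_iff)
      then show ?thesis by linarith
    qed
    then have "1 \<le> real_of_int (c\<^sup>2 + d\<^sup>2)" by linarith
    then have N1: "1 \<le> N" by (simp add: N_def c'_def d'_def)
    have "N \<le> N * N" using N1 by (simp add: mult_le_cancel_left1)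
    then have N2: "N \<le> N\<^sup>2" "1 \<le> N\<^sup>2" using N1 by (auto simp: power2_eq_square[symmetric] one_le_power)
    have "c'\<^sup>2 * d'\<^sup>2 \<le> N * N" unfolding N_def by (intro mult_mono) auto
    then have "(1 + c'\<^sup>2) * (1 + d'\<^sup>2) \<le> 3 * N\<^sup>2"
      using N2 by (simp add: N_def algebra_simps power2_eq_square)
    also have "\<dots> \<le> 3 * (K * (norm w)\<^sup>2)\<^sup>2" using N N1 by (intro mult_left_mono power_mono) auto
    also have "\<dots> = 3 * K\<^sup>2 * norm w ^ 4" by (simp add: power_mult_distrib)
    finally have *: "(1 + c'\<^sup>2) * (1 + d'\<^sup>2) \<le> 3 * K\<^sup>2 * norm w ^ 4" .
    have "0 < (1 + c'\<^sup>2) * (1 + d'\<^sup>2)" by (intro mult_pos_pos) (auto intro: add_pos_nonneg)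
    moreover from this * have "w \<noteq> 0" by (auto simp: mult_less_0_iff)
    moreover have "1 / n \<le> k * (1 / p)" if "0 < p" "0 < n" "p \<le> k * n" for k n p :: real
      using that by (simp add: field_simps)
    ultimately have "1 / norm w ^ 4 \<le> 3 * K\<^sup>2 * (1 / ((1 + c'\<^sup>2) * (1 + d'\<^sup>2)))"
      using * by simp
    then show ?thesis
      by (simp add: norm_divide norm_power w_def c'_def d'_def)
  qed auto
qed

text \<open>
  Division by zero yields \<open>0\<close>, so the Eisenstein series, in which \<open>(0, 0)\<close> is left out, is the sum over
  all pairs of integers.
\<close>
definition eisenstein_term :: "complex \<Rightarrow> int \<times> int \<Rightarrow> complex" where
  "eisenstein_term \<tau> = (\<lambda>(c, d). 1 / (of_int c * \<tau> + of_int d) ^ 4)"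

lemma eisenstein_summable:
  assumes "\<tau> \<in> upper_half"
  shows "eisenstein_term \<tau> summable_on UNIV \<times> UNIV"
proof -
  define a where "a = (\<lambda>d::int. 1 / (1 + (real_of_int d) ^ 2))"
  obtain C where C: "\<And>c d. norm (1 / (of_int c * \<tau> + of_int d) ^ 4) \<le> C * (a c * a d)" "C \<ge> 0"
    using lattice_product_bound[OF assms] unfolding a_def by metis
  have a: "a summable_on UNIV" "\<And>d. a d \<ge> 0"
    using summable_on_inverse_square_plus_1 by (auto simp: a_def)
  have "(\<lambda>(c, d). C * (a c * a d)) summable_on UNIV \<times> UNIV"
  proof (rule summable_on_SigmaI)
    fix c
    have "((\<lambda>d. (C * a c) * a d) has_sum (C * a c * infsum a UNIV)) UNIV"
      using a by (intro has_sum_cmult_right has_sum_infsum)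
    then show "((\<lambda>d. case (c, d) of (c, d) \<Rightarrow> C * (a c * a d)) has_sum (C * a c * infsum a UNIV)) UNIV"
      by (simp add: mult.assoc)
  next
    have "(\<lambda>c. (C * infsum a UNIV) * a c) summable_on UNIV" using a by (intro summable_on_cmult_right)
    then show "(\<lambda>c. C * a c * infsum a UNIV) summable_on UNIV" by (simp add: mult_ac)
  qed (use C a in auto)
  then have "(\<lambda>p. norm (eisenstein_term \<tau> p)) summable_on UNIV \<times> UNIV"
    by (rule Infinite_Sum.abs_summable_on_comparison_test') (use C in \<open>auto simp: eisenstein_term_def\<close>)
  then show ?thesis by (rule abs_summable_summable)
qed

lemma sigma3_le: "sigma3 n \<le> n ^ 4"
proof (cases "n = 0")
  case False
  have "sigma3 n \<le> (\<Sum>d | d dvd n. n ^ 3)"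
    unfolding sigma3_def using False by (intro sum_mono power_mono) (auto dest: dvd_imp_le)
  also have "\<dots> \<le> n * n ^ 3"
  proof -
    have "{d. d dvd n} \<subseteq> {1..n}"
      using False by (auto dest: dvd_imp_le intro!: Suc_leI Nat.gr0I)
    then have "card {d. d dvd n} \<le> n" using card_mono[of "{1..n}" "{d. d dvd n}"] by simp
    then show ?thesis by simp
  qed
  finally show ?thesis by (simp add: eval_nat_numeral)
qed (simp add: sigma3_def)

lemma sigma3_summable:
  fixes q :: "'a :: {real_normed_field, banach}"
  assumes "norm q < 1"
  shows "summable (\<lambda>n. norm (of_nat (sigma3 n) * q ^ n))"
proof (rule summable_comparison_test'[OF summable_power_times_geometric[OF assms, of 4], of 0])
  fix n
  have "real (sigma3 n) \<le> real n ^ 4" using sigma3_le[of n] by (metis of_nat_le_iff of_nat_power)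
  then show "norm (norm (of_nat (sigma3 n) * q ^ n)) \<le> norm (of_nat n ^ 4 * q ^ n)"
    by (simp add: norm_mult norm_power mult_right_mono)
qed

lemma sigma3_0: "sigma3 0 = 0" by (simp add: sigma3_def)

text \<open>
  The double series over \<open>(c, n)\<close> is rearranged by the value \<open>N = c n\<close>; the pairs with a given value
  correspond to the divisors \<open>n\<close> of \<open>N\<close>.
\<close>
lemma Lambert_sigma3:
  fixes q :: complex
  assumes q: "norm q < 1"
  shows "((\<lambda>c. \<Sum>n. of_nat n ^ 3 * (q ^ c) ^ n) has_sum (\<Sum>n. of_nat (sigma3 n) * q ^ n)) {1..}"
proof -
  let ?D = "Sigma {1::nat..} (\<lambda>N. {d. d dvd N})"
  let ?f = "\<lambda>(N, d::nat). of_nat d ^ 3 * q ^ N"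
  let ?S = "\<Sum>n. of_nat (sigma3 n) * q ^ n"
  have fin: "finite {d. d dvd N}" if "N \<in> {1..}" for N :: nat using that by simp
  have "(\<lambda>n. norm (of_nat (sigma3 n) * q ^ n)) summable_on UNIV"
    using norm_summable_imp_has_sum[OF _ summable_sums[OF sigma3_summable[OF q]]] sigma3_summable[OF q]
    by (simp add: summable_on_def) blast
  then have N: "(\<lambda>n. norm (of_nat (sigma3 n) * q ^ n)) summable_on {1..}"
    by (rule summable_on_subset_banach) auto
  have "(\<lambda>p. norm (?f p)) summable_on ?D"
  proof (rule summable_on_SigmaI[OF _ N])
    fix N :: nat assume "N \<in> {1..}"
    show "((\<lambda>d. norm (?f (N, d))) has_sum norm (of_nat (sigma3 N) * q ^ N)) {d. d dvd N}"
      by (rule has_sum_finiteI[OF fin[OF \<open>N \<in> {1..}\<close>]])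
         (simp add: norm_mult norm_power, simp add: sigma3_def sum_distrib_right)
  qed auto
  then have "?f summable_on ?D" by (rule abs_summable_summable)
  then have "(?f has_sum ?S) ?D"
  proof (rule has_sum_SigmaI[rotated 2])
    fix N :: nat assume "N \<in> {1..}"
    show "((\<lambda>d. ?f (N, d)) has_sum (of_nat (sigma3 N) * q ^ N)) {d. d dvd N}"
      by (rule has_sum_finiteI[OF fin[OF \<open>N \<in> {1..}\<close>]])
         (simp add: sigma3_def sum_distrib_right)
  next
    have "((\<lambda>n. of_nat (sigma3 n) * q ^ n) has_sum ?S) UNIV"
      by (rule norm_summable_imp_has_sum[OF sigma3_summable[OF q]])
         (intro summable_sums summable_norm_cancel[OF sigma3_summable[OF q]])
    then show "((\<lambda>n. of_nat (sigma3 n) * q ^ n) has_sum ?S) {1..}"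
      by (rule has_sum_cong_neutral[THEN iffD1, rotated -1]) (auto simp: sigma3_0 not_le)
  qed
  also have "(?f has_sum ?S) ?D \<longleftrightarrow> ((\<lambda>(c, n). of_nat n ^ 3 * (q ^ c) ^ n) has_sum ?S) ({1..} \<times> {1..})"
  proof (rule has_sum_reindex_bij_witness[of _ "\<lambda>(c, n). (c * n, n)" "\<lambda>(N, d). (N div d, d)"])
    fix p assume p: "p \<in> ?D"
    then obtain d k where p: "p = (d * k, d)" "d * k \<ge> 1" by (auto elim!: dvdE)
    then have "d \<ge> 1" "k \<ge> 1" by (auto simp: Suc_le_eq)
    with p show "(case case p of (N, d) \<Rightarrow> (N div d, d) of (c, n) \<Rightarrow> (c * n, n)) = p"
      "(case p of (N, d) \<Rightarrow> (N div d, d)) \<in> {1..} \<times> {1..}"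
      "(case case p of (N, d) \<Rightarrow> (N div d, d) of (c, n) \<Rightarrow> of_nat n ^ 3 * (q ^ c) ^ n) = ?f p"
      by (simp_all flip: power_mult add: mult.commute)
  qed (auto simp: Suc_le_eq)
  finally show ?thesis
  proof (rule has_sum_SigmaD)
    fix c :: nat assume "c \<in> {1..}"
    then have "norm q ^ c \<le> norm q" using q power_decreasing[of 1 c "norm q"] by simp
    with q have qc: "norm (q ^ c) < 1" by (simp add: norm_power)
    have "((\<lambda>n. of_nat n ^ 3 * (q ^ c) ^ n) has_sum (\<Sum>n. of_nat n ^ 3 * (q ^ c) ^ n)) UNIV"
      by (rule norm_summable_imp_has_sum[OF summable_power_times_geometric[OF qc]])
         (intro summable_sums summable_norm_cancel[OF summable_power_times_geometric[OF qc]])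
    then show "((\<lambda>n. case (c, n) of (c, n) \<Rightarrow> of_nat n ^ 3 * (q ^ c) ^ n) has_sum (\<Sum>n. of_nat n ^ 3 * (q ^ c) ^ n)) {1..}"
      unfolding prod.case
      by (rule has_sum_cong_neutral[THEN iffD1, rotated -1]) (auto simp: not_le)
  qed
qed

text \<open>
  This is \<open>2 \<zeta>(4) = \<pi>\<^sup>4 / 45\<close>. The cotangent vanishes at \<open>\<pi> / 2\<close>, so the reflection formula at
  \<open>z = 1 / 2\<close> gives the sum over the odd integers, and the even integers contribute one sixteenth of
  the whole sum.
\<close>
lemma has_sum_inverse_fourth_powers_of_ints: "((\<lambda>d. 1 / (of_int d :: complex) ^ 4) has_sum (of_real pi ^ 4 / 45)) UNIV"
proof -
  define f where "f = (\<lambda>d. 1 / (of_int d :: complex) ^ 4)"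
  define a where "a = (\<lambda>d::int. 1 / (1 + (real_of_int d) ^ 2))"
  have "norm (f d) \<le> 2 * a d" for d
  proof (cases "d = 0")
    case False
    then have "1 \<le> \<bar>d\<bar>" by linarith
    then have "1 \<le> \<bar>real_of_int d\<bar>" by linarith
    then have 1: "1 \<le> (real_of_int d)\<^sup>2" by (metis one_le_power power2_abs)
    then have "(real_of_int d)\<^sup>2 * 1 \<le> (real_of_int d)\<^sup>2 * (real_of_int d)\<^sup>2" by (intro mult_left_mono) auto
    then have "1 + (real_of_int d)\<^sup>2 \<le> 2 * (real_of_int d) ^ 4" using 1 by simp
    then show ?thesis using False by (simp add: f_def a_def norm_divide norm_power field_simps add_pos_nonneg)
  qed (simp add: f_def a_def)
  moreover have "(\<lambda>d. 2 * a d) summable_on UNIV"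
    using summable_on_inverse_square_plus_1 unfolding a_def by (rule summable_on_cmult_right)
  ultimately have "(\<lambda>d. norm (f d)) summable_on UNIV"
    using Infinite_Sum.abs_summable_on_comparison_test' by blast
  then have "f summable_on UNIV" by (rule abs_summable_summable)
  then obtain Z where Z: "(f has_sum Z) UNIV" by (auto simp: summable_on_def)
  have "((\<lambda>n. f (2 * n)) has_sum (1 / 16 * Z)) UNIV"
    using has_sum_cmult_right[OF Z, of "1 / 16"] by (simp add: f_def power_mult_distrib)
  moreover have "(f has_sum (1 / 16 * Z)) {d. even d} \<longleftrightarrow> ((\<lambda>n. f (2 * n)) has_sum (1 / 16 * Z)) UNIV"
    by (rule has_sum_reindex_bij_witness[of _ "\<lambda>n. 2 * n" "\<lambda>d. d div 2"]) auto
  ultimately have even: "(f has_sum (1 / 16 * Z)) {d. even d}" by simp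
  have h: "(1 / 2 :: complex) \<in> - \<int>"
  proof -
    have "(1 / 2 :: complex) \<noteq> of_int n" for n
    proof
      assume "(1 / 2 :: complex) = of_int n"
      then have "Re (1 / 2) = Re (of_int n)" by (rule arg_cong)
      then have "2 * real_of_int n = 1" by simp
      then have "2 * n = 1" by linarith
      then show False by presburger
    qed
    then show ?thesis by (auto elim!: Ints_cases)
  qed
  have "cot (of_real pi * (1 / 2) :: complex) = 0"
    using cos_of_real_pi_half[where 'a = complex] by (simp add: cot_def)
  then have "(Polygamma 3 (1 / 2) + Polygamma 3 (1 - 1 / 2)) / 6 = (of_real pi ^ 4 / 3 :: complex)"
    by (subst Polygamma_3_reflection[OF h]) simp
  then have "((\<lambda>n. 1 / (1 / 2 + of_int n) ^ 4 :: complex) has_sum (of_real pi ^ 4 / 3)) UNIV"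
    using has_sum_inverse_fourth_powers[OF h] by simp
  then have "((\<lambda>n. 1 / 16 * (1 / (1 / 2 + of_int n) ^ 4) :: complex) has_sum (1 / 16 * (of_real pi ^ 4 / 3))) UNIV"
    by (rule has_sum_cmult_right)
  moreover have "1 / 16 * (1 / (1 / 2 + of_int n) ^ 4) = f (2 * n + 1)" for n
  proof -
    have "(of_int (2 * n + 1) :: complex) ^ 4 = (2 * (1 / 2 + of_int n)) ^ 4" by (simp add: algebra_simps)
    then show ?thesis unfolding f_def by (simp only: power_mult_distrib) simp
  qed
  moreover have "(f has_sum (1 / 16 * (of_real pi ^ 4 / 3))) {d. odd d} \<longleftrightarrow> ((\<lambda>n. f (2 * n + 1)) has_sum (1 / 16 * (of_real pi ^ 4 / 3))) UNIV"
    by (rule has_sum_reindex_bij_witness[of _ "\<lambda>n. 2 * n + 1" "\<lambda>d. d div 2"]) auto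
  ultimately have "(f has_sum (1 / 16 * (of_real pi ^ 4 / 3))) {d. odd d}" by simp
  from has_sum_Un_disjoint[OF even this]
  have "(f has_sum (1 / 16 * Z + 1 / 16 * (of_real pi ^ 4 / 3))) ({d. even d} \<union> {d. odd d})" by auto
  moreover have "{d::int. even d} \<union> {d. odd d} = UNIV" by auto
  ultimately have "(f has_sum (1 / 16 * Z + 1 / 16 * (of_real pi ^ 4 / 3))) UNIV" by (simp only:)
  from has_sum_unique[OF Z this] have "16 * Z = Z + of_real pi ^ 4 / 3" by (simp add: field_simps)
  then have "15 * Z = of_real pi ^ 4 / 3" by algebra
  then have "Z = of_real pi ^ 4 / 45" by (simp add: field_simps)
  with Z show ?thesis unfolding f_def by (simp only:)
qed

lemma qpar_mult: "qpar (of_nat n * \<tau>) = qpar \<tau> ^ n"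
  unfolding qpar_def exp_of_nat_mult[symmetric] by (rule arg_cong[of _ _ exp]) (simp only: mult_ac)

text \<open>
  The row \<open>c = 0\<close> gives the constant term of \<open>E4\<close>, and the rows \<open>c\<close> and \<open>-c\<close> each give one term of the
  Lambert series of \<open>\<sigma>\<^sub>3\<close>.
\<close>
lemma eisenstein_E4:
  assumes \<tau>: "\<tau> \<in> upper_half"
  shows "(eisenstein_term \<tau> has_sum (of_real pi ^ 4 / 45 * E4 \<tau>)) (UNIV \<times> UNIV)"
proof -
  define \<kappa> where "\<kappa> = (8 * of_real pi ^ 4 / 3 :: complex)"
  define g where "g = (\<lambda>c. \<Sum>n. of_nat n ^ 3 * (qpar \<tau> ^ c) ^ n)"
  define S where "S = (\<Sum>n. of_nat (sigma3 n) * qpar \<tau> ^ n)"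
  define row where "row = (\<lambda>c. if c = 0 then of_real pi ^ 4 / 45 else \<kappa> * g (nat \<bar>c\<bar>))"
  have lip: "((\<lambda>d. 1 / (of_nat c * \<tau> + of_int d) ^ 4) has_sum (\<kappa> * g c)) UNIV" if "c > 0" for c
  proof -
    have "of_nat c * \<tau> \<in> upper_half" using \<tau> that by (simp add: upper_half_def)
    from Lipschitz_4[OF this] show ?thesis by (simp add: g_def \<kappa>_def qpar_mult)
  qed
  have rows: "((\<lambda>d. eisenstein_term \<tau> (c, d)) has_sum row c) UNIV" for c
  proof -
    consider "c = 0" | "c > 0" | "c < 0" by linarith
    then show ?thesis
    proof cases
      case 1
      then show ?thesis using has_sum_inverse_fourth_powers_of_ints by (simp add: eisenstein_term_def row_def)
    next
      case 2
      then have "of_int c = (of_nat (nat c) :: complex)" by simp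
      then show ?thesis using lip[of "nat c"] 2 by (simp add: eisenstein_term_def row_def)
    next
      case 3
      have "((\<lambda>d. eisenstein_term \<tau> (c, d)) has_sum row c) UNIV \<longleftrightarrow>
        ((\<lambda>d. 1 / (of_nat (nat \<bar>c\<bar>) * \<tau> + of_int d) ^ 4) has_sum row c) UNIV"
      proof (rule has_sum_reindex_bij_witness[of _ uminus uminus])
        fix d
        have "of_nat (nat \<bar>c\<bar>) * \<tau> + of_int (- d) = - (of_int c * \<tau> + of_int d)" using 3 by simp
        then show "1 / (of_nat (nat \<bar>c\<bar>) * \<tau> + of_int (- d)) ^ 4 = eisenstein_term \<tau> (c, d)"
          unfolding eisenstein_term_def prod.case by (metis power_minus_even even_numeral)
      qed auto
      then show ?thesis using lip[of "nat \<bar>c\<bar>"] 3 by (simp add: row_def)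
    qed
  qed
  define G where "G = infsum (eisenstein_term \<tau>) (UNIV \<times> UNIV)"
  have G: "(eisenstein_term \<tau> has_sum G) (UNIV \<times> UNIV)"
    unfolding G_def using eisenstein_summable[OF \<tau>] by (rule has_sum_infsum)
  have rowG: "(row has_sum G) UNIV" by (rule has_sum_SigmaD[OF G rows])
  have L: "((\<lambda>c. \<kappa> * g c) has_sum (\<kappa> * S)) {1..}"
    using Lambert_sigma3[OF qpar_norm_less_1[OF \<tau>]] unfolding g_def S_def by (rule has_sum_cmult_right)
  have "(row has_sum (\<kappa> * S)) {1..} \<longleftrightarrow> ((\<lambda>c. \<kappa> * g c) has_sum (\<kappa> * S)) {1..}"
    by (rule has_sum_reindex_bij_witness[of _ int nat]) (auto simp: row_def)
  moreover have "(row has_sum (\<kappa> * S)) {..-1} \<longleftrightarrow> ((\<lambda>c. \<kappa> * g c) has_sum (\<kappa> * S)) {1..}"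
    by (rule has_sum_reindex_bij_witness[of _ "\<lambda>n. - int n" "\<lambda>n. nat (- n)"]) (auto simp: row_def)
  moreover have "(row has_sum row 0) {0}" by (rule has_sum_finiteI) auto
  ultimately have "(row has_sum (row 0 + \<kappa> * S + \<kappa> * S)) ({0} \<union> {1..} \<union> {..-1})"
    using L by (intro has_sum_Un_disjoint) auto
  moreover have "{0::int} \<union> {1..} \<union> {..-1} = UNIV" by auto
  ultimately have "(row has_sum (row 0 + \<kappa> * S + \<kappa> * S)) UNIV" by (simp only:)
  with rowG have "G = row 0 + \<kappa> * S + \<kappa> * S" by (rule has_sum_unique)
  also have "\<dots> = of_real pi ^ 4 / 45 * (1 + 240 * S)" by (simp add: row_def \<kappa>_def algebra_simps)
  also have "1 + 240 * S = E4 \<tau>"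
  proof -
    have "summable (\<lambda>n. of_nat (sigma3 n) * qpar \<tau> ^ n)"
      by (rule summable_norm_cancel[OF sigma3_summable[OF qpar_norm_less_1[OF \<tau>]]])
    from suminf_split_head[OF this] show ?thesis by (simp add: E4_def S_def sigma3_0)
  qed
  finally have "G = of_real pi ^ 4 / 45 * E4 \<tau>" .
  then show ?thesis using G by (simp only:)
qed

lemma upper_half_S: "\<tau> \<in> upper_half \<Longrightarrow> - 1 / \<tau> \<in> upper_half"
proof -
  assume \<tau>: "\<tau> \<in> upper_half"
  have "Im (- 1 / \<tau>) = Im \<tau> / (norm \<tau>)\<^sup>2" by (simp add: Im_divide cmod_power2)
  moreover have "\<tau> \<noteq> 0" using \<tau> by (auto simp: upper_half_def)
  ultimately show "- 1 / \<tau> \<in> upper_half" using \<tau> by (simp add: upper_half_def)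
qed

text \<open>
  Replacing \<open>\<tau>\<close> by \<open>- 1 / \<tau>\<close> permutes the lattice, up to the factor \<open>\<tau>\<^sup>4\<close>.
\<close>
theorem E4_S_transform:
  assumes \<tau>: "\<tau> \<in> upper_half"
  shows "E4 (- 1 / \<tau>) = \<tau> ^ 4 * E4 \<tau>"
proof -
  have \<tau>0: "\<tau> \<noteq> 0" using \<tau> by (auto simp: upper_half_def)
  let ?k = "of_real pi ^ 4 / 45 :: complex"
  have "?k * E4 (- 1 / \<tau>) = infsum (eisenstein_term (- 1 / \<tau>)) (UNIV \<times> UNIV)"
    using infsumI[OF eisenstein_E4[OF upper_half_S[OF \<tau>]]] by simp
  also have "\<dots> = infsum (\<lambda>p. \<tau> ^ 4 * eisenstein_term \<tau> p) (UNIV \<times> UNIV)"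
  proof (rule infsum_reindex_bij_witness[of _ "\<lambda>(d, c). (- c, d)" "\<lambda>(c, d). (d, - c)"])
    fix p :: "int \<times> int"
    obtain c d where p: "p = (c, d)" by (cases p)
    have "of_int c * (- 1 / \<tau>) + of_int d = (of_int d * \<tau> + of_int (- c)) / \<tau>"
      using \<tau>0 by (simp add: field_simps)
    then show "\<tau> ^ 4 * eisenstein_term \<tau> (case p of (c, d) \<Rightarrow> (d, - c)) = eisenstein_term (- 1 / \<tau>) p"
      by (simp add: p eisenstein_term_def power_divide)
  qed auto
  also have "\<dots> = \<tau> ^ 4 * (?k * E4 \<tau>)"
    using infsumI[OF has_sum_cmult_right[OF eisenstein_E4[OF \<tau>], of "\<tau> ^ 4"]] by simp
  finally have "?k * E4 (- 1 / \<tau>) = ?k * (\<tau> ^ 4 * E4 \<tau>)" by (simp only: mult_ac)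
  then show ?thesis by simp
qed

section \<open>The Frobenius solution at the cusp\<close>

text \<open>
  The Euler operator \<open>q d/dq\<close>, which acts on coefficients by \<open>a\<^sub>n \<mapsto> n a\<^sub>n\<close>.
\<close>
definition fps_theta :: "complex fps \<Rightarrow> complex fps" where
  "fps_theta F = fps_X * fps_deriv F"

text \<open>
  The function \<open>q\<^sup>m\<^sup>/\<^sup>2 F(q)\<close>, with the branch of \<open>q\<^sup>1\<^sup>/\<^sup>2\<close> that is fixed by \<open>\<tau>\<close>.
\<close>
definition qexp :: "int \<Rightarrow> complex fps \<Rightarrow> complex \<Rightarrow> complex" where
  "qexp m F \<tau> = exp (of_real pi * \<i> * of_int m * \<tau>) * eval_fps F (qpar \<tau>)"

lemma fps_theta_nth [simp]: "fps_nth (fps_theta F) n = of_nat n * fps_nth F n"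
  by (cases n) (simp_all add: fps_theta_def)

lemma fps_theta_radius: "fps_conv_radius F \<le> fps_conv_radius (fps_theta F)"
proof -
  have "fps_conv_radius F \<le> min (fps_conv_radius (fps_X :: complex fps)) (fps_conv_radius (fps_deriv F))"
    using fps_conv_radius_deriv[of F] by simp
  also have "\<dots> \<le> fps_conv_radius (fps_theta F)"
    unfolding fps_theta_def by (rule fps_conv_radius_mult)
  finally show ?thesis .
qed

lemma qpar_in_radius:
  assumes "fps_conv_radius F \<ge> 1" "\<tau> \<in> upper_half"
  shows "ereal (norm (qpar \<tau>)) < fps_conv_radius F"
  using assms(1) qpar_norm_less_1[OF assms(2)] less_le_trans[of "ereal (norm (qpar \<tau>))" 1] by simp

lemma fps_mult_radius_ge_1:
  fixes F G :: "complex fps"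
  assumes "fps_conv_radius F \<ge> 1" "fps_conv_radius G \<ge> 1"
  shows "fps_conv_radius (F * G) \<ge> 1"
  using assms fps_conv_radius_mult[of F G] by (meson min.boundedI order_trans)

lemma fps_add_radius_ge_1:
  fixes F G :: "complex fps"
  assumes "fps_conv_radius F \<ge> 1" "fps_conv_radius G \<ge> 1"
  shows "fps_conv_radius (F + G) \<ge> 1"
  using assms fps_conv_radius_add[of F G] by (meson min.boundedI order_trans)

lemma fps_theta_radius_ge_1: "fps_conv_radius F \<ge> 1 \<Longrightarrow> fps_conv_radius (fps_theta F) \<ge> 1"
  using fps_theta_radius[of F] by (rule order_trans[rotated])

lemma qpar_has_field_derivative [derivative_intros]:
  "(qpar has_field_derivative (2 * of_real pi * \<i> * qpar \<tau>)) (at \<tau> within A)"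
  unfolding qpar_def by (auto intro!: derivative_eq_intros)

lemma qexp_has_field_derivative:
  assumes F: "fps_conv_radius F \<ge> 1" and \<tau>: "\<tau> \<in> upper_half"
  shows "(qexp m F has_field_derivative of_real pi * \<i> * qexp m (fps_const (of_int m) * F + 2 * fps_theta F) \<tau>) (at \<tau>)"
proof -
  note r = qpar_in_radius[OF F \<tau>]
  have r': "ereal (norm (qpar \<tau>)) < fps_conv_radius (fps_deriv F)"
    using r fps_conv_radius_deriv[of F] by (rule less_le_trans)
  have rt: "ereal (norm (qpar \<tau>)) < fps_conv_radius (fps_theta F)"
    using r fps_theta_radius[of F] by (rule less_le_trans)
  have rm: "ereal (norm (qpar \<tau>)) < fps_conv_radius (fps_const (of_int m) * F)"
    by (rule qpar_in_radius[OF fps_mult_radius_ge_1 \<tau>]) (simp_all add: F)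
  have r2: "ereal (norm (qpar \<tau>)) < fps_conv_radius (2 * fps_theta F)"
    using rt fps_conv_radius_mult[of 2 "fps_theta F"] by auto
  have "eval_fps (fps_const (of_int m) * F + 2 * fps_theta F) (qpar \<tau>) =
     of_int m * eval_fps F (qpar \<tau>) + 2 * (qpar \<tau> * eval_fps (fps_deriv F) (qpar \<tau>))"
    using r r' rt rm r2 by (simp add: eval_fps_add eval_fps_mult fps_theta_def)
  moreover have "((\<lambda>\<tau>. eval_fps F (qpar \<tau>)) has_field_derivative
      eval_fps (fps_deriv F) (qpar \<tau>) * (2 * of_real pi * \<i> * qpar \<tau>)) (at \<tau>)"
    by (rule DERIV_chain2[OF has_field_derivative_eval_fps[OF r] qpar_has_field_derivative])
  moreover have "((\<lambda>\<tau>. exp (of_real pi * \<i> * of_int m * \<tau>)) has_field_derivative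
      exp (of_real pi * \<i> * of_int m * \<tau>) * (of_real pi * \<i> * of_int m)) (at \<tau>)"
    by (auto intro!: derivative_eq_intros)
  ultimately show ?thesis
    unfolding qexp_def by (intro DERIV_cong[OF DERIV_mult]) (assumption | simp add: algebra_simps)+
qed

lemma open_upper_half: "open upper_half"
  unfolding upper_half_def by (rule open_halfspace_Im_gt)

lemma convex_upper_half: "convex upper_half"
  unfolding upper_half_def by (rule convex_halfspace_Im_gt)

lemma qexp_holomorphic: "fps_conv_radius F \<ge> 1 \<Longrightarrow> qexp m F holomorphic_on upper_half"
  by (rule holomorphic_onI) (use qexp_has_field_derivative in \<open>metis field_differentiable_at_within field_differentiable_def\<close>)

lemma second_derivativeI:
  assumes "\<And>\<tau>. \<tau> \<in> upper_half \<Longrightarrow> (y has_field_derivative y' \<tau>) (at \<tau>)"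
    and "\<And>\<tau>. \<tau> \<in> upper_half \<Longrightarrow> (y' has_field_derivative y'' \<tau>) (at \<tau>)"
    and "\<tau> \<in> upper_half"
  shows "deriv (deriv y) \<tau> = y'' \<tau>"
proof -
  have "(deriv y has_field_derivative y'' \<tau>) (at \<tau>)"
    by (rule has_field_derivative_transform_within_open[OF assms(2)[OF assms(3)] open_upper_half assms(3)])
       (use assms(1) in \<open>auto simp: DERIV_imp_deriv[symmetric]\<close>)
  then show ?thesis by (rule DERIV_imp_deriv)
qed

definition E4_fps :: "complex fps" where
  "E4_fps = 1 + 240 * Abs_fps (\<lambda>n. of_nat (sigma3 n))"

lemma sigma3_fps_radius: "fps_conv_radius (Abs_fps (\<lambda>n. of_nat (sigma3 n)) :: complex fps) \<ge> 1"
  unfolding fps_conv_radius_def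
proof (rule conv_radius_geI_ex')
  fix r :: real assume "0 < r" "ereal r < 1"
  then have "norm (of_real r :: complex) < 1" by simp
  from summable_norm_cancel[OF sigma3_summable[OF this]]
  show "summable (\<lambda>n. fps_nth (Abs_fps (\<lambda>n. of_nat (sigma3 n)) :: complex fps) n * of_real r ^ n)"
    by simp
qed

lemma E4_fps_radius: "fps_conv_radius E4_fps \<ge> 1"
  unfolding E4_fps_def
  by (intro fps_add_radius_ge_1 fps_mult_radius_ge_1 sigma3_fps_radius) simp_all

lemma E4_eval: "\<tau> \<in> upper_half \<Longrightarrow> E4 \<tau> = eval_fps E4_fps (qpar \<tau>)"
proof -
  assume \<tau>: "\<tau> \<in> upper_half"
  let ?S = "Abs_fps (\<lambda>n. of_nat (sigma3 n)) :: complex fps"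
  have r: "ereal (norm (qpar \<tau>)) < fps_conv_radius ?S"
    by (rule qpar_in_radius[OF sigma3_fps_radius \<tau>])
  have r2: "ereal (norm (qpar \<tau>)) < fps_conv_radius (240 * ?S)"
    by (rule qpar_in_radius[OF fps_mult_radius_ge_1 \<tau>]) (simp_all add: sigma3_fps_radius)
  have "eval_fps E4_fps (qpar \<tau>) = 1 + 240 * eval_fps ?S (qpar \<tau>)"
    using r r2 by (simp add: E4_fps_def eval_fps_add eval_fps_mult)
  also have "eval_fps ?S (qpar \<tau>) = (\<Sum>n. of_nat (sigma3 (Suc n)) * qpar \<tau> ^ Suc n)"
    using suminf_split_head[OF summable_fps[OF r]] by (simp add: eval_fps_def sigma3_0)
  finally show ?thesis by (simp add: E4_def)
qed

lemma qexp_mult_E4: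
  assumes "fps_conv_radius F \<ge> 1" "\<tau> \<in> upper_half"
  shows "qexp m (E4_fps * F) \<tau> = E4 \<tau> * qexp m F \<tau>"
  using assms E4_fps_radius by (simp add: qexp_def eval_fps_mult qpar_in_radius E4_eval)

lemma qexp_const_mult:
  assumes "fps_conv_radius F \<ge> 1" "\<tau> \<in> upper_half"
  shows "qexp m (fps_const c * F) \<tau> = c * qexp m F \<tau>"
  using assms by (simp add: qexp_def eval_fps_mult qpar_in_radius)

text \<open>
  In terms of \<open>\<theta> = q d/dq\<close> the equation reads \<open>4 \<theta>\<^sup>2 y = r\<^sup>2 E4 y\<close>, with indicial roots \<open>\<plusminus> r / 2\<close>. The
  coefficients of the solution \<open>q\<^sup>r\<^sup>/\<^sup>2 (1 + \<dots>)\<close> obey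
  \<open>(r + 2 n)\<^sup>2 a\<^sub>n = r\<^sup>2 (a\<^sub>n + 240 \<Sum>k<n. \<sigma>\<^sub>3(n - k) a\<^sub>k)\<close>, which is solved here for \<open>a\<^sub>n\<close>. For the larger
  root the divisor \<open>n (n + r)\<close> never vanishes.
\<close>
fun frobenius_coeff :: "nat \<Rightarrow> nat \<Rightarrow> complex" where
  "frobenius_coeff r n = (if n = 0 then 1
     else 60 * of_nat r ^ 2 / (of_nat n * of_nat (n + r)) *
       (\<Sum>k<n. of_nat (sigma3 (n - k)) * frobenius_coeff r k))"

declare frobenius_coeff.simps [simp del]

lemma frobenius_coeff_0: "frobenius_coeff r 0 = 1"
  by (simp add: frobenius_coeff.simps)

lemma frobenius_coeff_rec:
  assumes "n > 0"
  shows "of_nat n * of_nat (n + r) * frobenius_coeff r n =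
    60 * of_nat r ^ 2 * (\<Sum>k<n. of_nat (sigma3 (n - k)) * frobenius_coeff r k)"
proof -
  have "of_nat n * of_nat (n + r) \<noteq> (0 :: complex)"
    using assms by (simp del: of_nat_add add: of_nat_add[symmetric])
  then show ?thesis
    by (subst frobenius_coeff.simps) (use assms in \<open>simp add: field_simps\<close>)
qed

text \<open>
  Let \<open>S\<close> be the sum of \<open>\<sigma>\<^sub>3(n) \<rho>\<^sup>n\<close>. The recursion bounds \<open>n (n + r) \<bar>a\<^sub>n\<bar> \<rho>\<^sup>n\<close> by \<open>60 r\<^sup>2 S\<close> times the
  maximum of the previous \<open>\<bar>a\<^sub>k\<bar> \<rho>\<^sup>k\<close>. Once \<open>n\<close> exceeds \<open>60 r\<^sup>2 S\<close>, the maximum no longer grows.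
\<close>
lemma frobenius_coeff_bound:
  assumes "0 < \<rho>" "\<rho> < 1"
  obtains M where "\<And>n. norm (frobenius_coeff r n) * \<rho> ^ n \<le> M"
proof -
  define a where "a = (\<lambda>n. norm (frobenius_coeff r n) * \<rho> ^ n)"
  define S where "S = (\<Sum>n. real (sigma3 n) * \<rho> ^ n)"
  have summable: "summable (\<lambda>n. real (sigma3 n) * \<rho> ^ n)"
    using sigma3_summable[of \<rho>] assms by (simp add: norm_mult norm_power)
  define N where "N = nat \<lceil>60 * real r ^ 2 * S\<rceil>"
  define M where "M = Max (a ` {..N})"
  have "a n \<le> M" for n
  proof (induction n rule: less_induct)
    case (less n)
    show ?case
    proof (cases "n \<le> N")
      case False
      then have n: "n > 0" "60 * real r ^ 2 * S \<le> real n" unfolding N_def by linarith+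
      have M0: "0 \<le> M" using less.IH[of 0] n assms unfolding a_def by (auto intro: order_trans[rotated])
      have part: "(\<Sum>k<n. real (sigma3 (n - k)) * \<rho> ^ (n - k)) \<le> S"
      proof -
        have "(\<Sum>k<n. real (sigma3 (n - k)) * \<rho> ^ (n - k)) = (\<Sum>j\<in>{1..n}. real (sigma3 j) * \<rho> ^ j)"
          by (rule sum.reindex_bij_witness[of _ "\<lambda>j. n - j" "\<lambda>k. n - k"]) auto
        also have "\<dots> \<le> S" unfolding S_def
          by (rule sum_le_suminf[OF summable]) (use assms in auto)
        finally show ?thesis .
      qed
      have "real n * a n \<le> real n * real (n + r) * a n"
        using n assms by (intro mult_right_mono) (auto simp: a_def mult_le_cancel_left1)
      also have "\<dots> = norm (of_nat n * of_nat (n + r) * frobenius_coeff r n) * \<rho> ^ n"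
        by (simp add: a_def norm_mult del: of_nat_add)
      also have "\<dots> = 60 * real r ^ 2 * norm (\<Sum>k<n. of_nat (sigma3 (n - k)) * frobenius_coeff r k) * \<rho> ^ n"
        by (subst frobenius_coeff_rec[OF n(1)]) (simp add: norm_mult norm_power)
      also have "\<dots> \<le> 60 * real r ^ 2 * (\<Sum>k<n. norm (of_nat (sigma3 (n - k)) * frobenius_coeff r k)) * \<rho> ^ n"
        using assms by (intro mult_right_mono mult_left_mono norm_sum) auto
      also have "\<dots> = 60 * real r ^ 2 * (\<Sum>k<n. (real (sigma3 (n - k)) * \<rho> ^ (n - k)) * a k)"
      proof -
        have "norm (of_nat (sigma3 (n - k)) * frobenius_coeff r k) * \<rho> ^ n = (real (sigma3 (n - k)) * \<rho> ^ (n - k)) * a k"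
          if "k < n" for k
        proof -
          have "\<rho> ^ n = \<rho> ^ (n - k) * \<rho> ^ k" using that by (simp flip: power_add)
          then show ?thesis by (simp add: norm_mult a_def)
        qed
        then show ?thesis unfolding mult.assoc sum_distrib_right by simp
      qed
      also have "\<dots> \<le> 60 * real r ^ 2 * (\<Sum>k<n. (real (sigma3 (n - k)) * \<rho> ^ (n - k)) * M)"
        using less.IH assms by (intro mult_left_mono sum_mono) auto
      also have "\<dots> = (60 * real r ^ 2 * (\<Sum>k<n. real (sigma3 (n - k)) * \<rho> ^ (n - k))) * M"
        by (simp add: sum_distrib_right)
      also have "\<dots> \<le> (60 * real r ^ 2 * S) * M"
        using part M0 by (intro mult_right_mono mult_left_mono) auto
      also have "\<dots> \<le> real n * M" using n M0 by (intro mult_right_mono) auto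
      finally show ?thesis using n by simp
    qed (simp add: M_def)
  qed
  then show ?thesis using that unfolding a_def by blast
qed

definition frobenius_fps :: "nat \<Rightarrow> complex fps" where
  "frobenius_fps r = Abs_fps (frobenius_coeff r)"

lemma frobenius_fps_radius: "fps_conv_radius (frobenius_fps r) \<ge> 1"
  unfolding fps_conv_radius_def
proof (rule conv_radius_geI_ex')
  fix x :: real assume "0 < x" "ereal x < 1"
  then have x: "0 < x" "x < 1" by simp_all
  define \<rho> where "\<rho> = (x + 1) / 2"
  have \<rho>: "0 < \<rho>" "\<rho> < 1" "x < \<rho>" using x by (auto simp: \<rho>_def)
  obtain M where M: "\<And>n. norm (frobenius_coeff r n) * \<rho> ^ n \<le> M"
    using frobenius_coeff_bound[OF \<rho>(1,2)] by blast
  show "summable (\<lambda>n. fps_nth (frobenius_fps r) n * of_real x ^ n)"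
  proof (rule summable_comparison_test'[of "\<lambda>n. M * (x / \<rho>) ^ n" 0])
    show "summable (\<lambda>n. M * (x / \<rho>) ^ n)"
      using x \<rho> by (intro summable_mult summable_geometric) auto
    fix n
    have "norm (fps_nth (frobenius_fps r) n * of_real x ^ n) = (norm (frobenius_coeff r n) * \<rho> ^ n) * (x / \<rho>) ^ n"
      using x \<rho> by (simp add: frobenius_fps_def norm_mult norm_power power_divide)
    also have "\<dots> \<le> M * (x / \<rho>) ^ n" using M x \<rho> by (intro mult_right_mono) auto
    finally show "norm (fps_nth (frobenius_fps r) n * of_real x ^ n) \<le> M * (x / \<rho>) ^ n" .
  qed
qed

lemma frobenius_fps_ode:
  fixes r :: nat
  defines "A \<equiv> frobenius_fps r" and "c \<equiv> fps_const (of_nat r) :: complex fps"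
  defines "A' \<equiv> c * A + 2 * fps_theta A"
  shows "c * A' + 2 * fps_theta A' = fps_const (of_nat r ^ 2) * (E4_fps * A)"
proof (rule fps_ext)
  fix n
  let ?s = "\<lambda>k. of_nat (sigma3 (n - k)) * frobenius_coeff r k"
  have 1: "of_nat n * of_nat (n + r) * frobenius_coeff r n = 60 * of_nat r ^ 2 * (\<Sum>k<n. ?s k)"
    using frobenius_coeff_rec[of n r] by (cases "n = 0") auto
  have "fps_nth (A * Abs_fps (\<lambda>n. of_nat (sigma3 n))) n = (\<Sum>k\<in>{0..n}. ?s k)"
    by (simp add: fps_mult_nth A_def frobenius_fps_def mult.commute)
  also have "\<dots> = (\<Sum>k<n. ?s k)"
    by (rule sum.mono_neutral_right) (auto simp: sigma3_0)
  finally have 2: "fps_nth (A * Abs_fps (\<lambda>n. of_nat (sigma3 n))) n = (\<Sum>k<n. ?s k)" .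
  have "E4_fps * A = A + fps_const 240 * (A * Abs_fps (\<lambda>n. of_nat (sigma3 n)))"
    by (simp add: E4_fps_def algebra_simps numeral_fps_const)
  then have R: "fps_nth (fps_const (of_nat r ^ 2) * (E4_fps * A)) n =
      of_nat r ^ 2 * (frobenius_coeff r n + 240 * (\<Sum>k<n. ?s k))"
    by (simp add: 2) (simp add: A_def frobenius_fps_def)
  have L: "fps_nth (c * A' + 2 * fps_theta A') n = (of_nat r + 2 * of_nat n) ^ 2 * frobenius_coeff r n"
    by (simp add: A'_def c_def numeral_fps_const A_def frobenius_fps_def power2_eq_square algebra_simps)
  show "fps_nth (c * A' + 2 * fps_theta A') n = fps_nth (fps_const (of_nat r ^ 2) * (E4_fps * A)) n"
    unfolding L R using 1 by (simp add: power2_eq_square) algebra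
qed

lemma frobenius_solution: "ode_solution r (qexp (int r) (frobenius_fps r))"
proof -
  let ?A = "frobenius_fps r"
  let ?A' = "fps_const (of_int (int r)) * ?A + 2 * fps_theta ?A"
  let ?A'' = "fps_const (of_int (int r)) * ?A' + 2 * fps_theta ?A'"
  note intros = frobenius_fps_radius fps_add_radius_ge_1 fps_mult_radius_ge_1 fps_theta_radius_ge_1
  have rad: "fps_conv_radius ?A' \<ge> 1" by (intro intros) auto
  have "deriv (deriv (qexp (int r) ?A)) \<tau> = of_real pi * \<i> * (of_real pi * \<i> * qexp (int r) ?A'' \<tau>)"
    if "\<tau> \<in> upper_half" for \<tau>
    by (rule second_derivativeI[OF qexp_has_field_derivative[OF frobenius_fps_radius]
          DERIV_cmult[OF qexp_has_field_derivative[OF rad]] that])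
  moreover have "?A'' = fps_const (of_nat r ^ 2) * (E4_fps * ?A)"
    using frobenius_fps_ode[of r] by simp
  moreover have "fps_conv_radius (E4_fps * ?A) \<ge> 1" by (intro intros E4_fps_radius)
  moreover have "of_real pi * \<i> * (of_real pi * \<i> * x) = - (of_real (pi\<^sup>2) * x)" for x
  proof -
    have "\<i> * \<i> = - 1" by simp
    then show ?thesis unfolding power2_eq_square of_real_mult by algebra
  qed
  ultimately have "deriv (deriv (qexp (int r) ?A)) \<tau> = - (of_real (pi\<^sup>2) * of_nat r ^ 2 * E4 \<tau> * qexp (int r) ?A \<tau>)"
    if "\<tau> \<in> upper_half" for \<tau>
    using that by (simp add: qexp_const_mult qexp_mult_E4 frobenius_fps_radius mult.assoc)
  then show ?thesis
    by (simp add: ode_solution_def qexp_holomorphic frobenius_fps_radius)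
qed

section \<open>The action of SL(2,Z) on the solution space\<close>

lemma ode_derivs:
  assumes "ode_solution r y" "\<tau> \<in> upper_half"
  shows "(y has_field_derivative deriv y \<tau>) (at \<tau>)"
    and "(deriv y has_field_derivative - (of_real (pi\<^sup>2) * of_nat r ^ 2 * E4 \<tau> * y \<tau>)) (at \<tau>)"
proof -
  have y: "y holomorphic_on upper_half" using assms(1) by (simp add: ode_solution_def)
  then show "(y has_field_derivative deriv y \<tau>) (at \<tau>)"
    using open_upper_half assms(2) by (rule holomorphic_derivI)
  have "(deriv y has_field_derivative deriv (deriv y) \<tau>) (at \<tau>)"
    using holomorphic_deriv[OF y open_upper_half] open_upper_half assms(2) by (rule holomorphic_derivI)
  moreover have "deriv (deriv y) \<tau> = - (of_real (pi\<^sup>2) * of_nat r ^ 2 * E4 \<tau> * y \<tau>)"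
    using assms by (simp add: ode_solution_def add_eq_0_iff)
  ultimately show "(deriv y has_field_derivative - (of_real (pi\<^sup>2) * of_nat r ^ 2 * E4 \<tau> * y \<tau>)) (at \<tau>)"
    by simp
qed

lemma ode_solutionI:
  assumes "\<And>\<tau>. \<tau> \<in> upper_half \<Longrightarrow> (y has_field_derivative y' \<tau>) (at \<tau>)"
    and "\<And>\<tau>. \<tau> \<in> upper_half \<Longrightarrow>
      (y' has_field_derivative - (of_real (pi\<^sup>2) * of_nat r ^ 2 * E4 \<tau> * y \<tau>)) (at \<tau>)"
  shows "ode_solution r y"
  unfolding ode_solution_def
proof (intro conjI ballI)
  show "y holomorphic_on upper_half"
    using assms(1) by (intro holomorphic_onI) (metis field_differentiable_at_within field_differentiable_def)
qed (use second_derivativeI[OF assms] in simp)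

lemma ode_solution_cmult:
  assumes "ode_solution r y"
  shows "ode_solution r (\<lambda>\<tau>. c * y \<tau>)"
proof (rule ode_solutionI[of _ "\<lambda>\<tau>. c * deriv y \<tau>"])
  fix \<tau> assume "\<tau> \<in> upper_half"
  note d = ode_derivs[OF assms this]
  show "((\<lambda>\<tau>. c * y \<tau>) has_field_derivative c * deriv y \<tau>) (at \<tau>)"
    by (rule DERIV_cmult[OF d(1)])
  show "((\<lambda>\<tau>. c * deriv y \<tau>) has_field_derivative
      - (of_real (pi\<^sup>2) * of_nat r ^ 2 * E4 \<tau> * (c * y \<tau>))) (at \<tau>)"
    by (rule DERIV_cong[OF DERIV_cmult[OF d(2)]]) simp
qed

lemma upper_half_T: "\<tau> + 1 \<in> upper_half \<longleftrightarrow> \<tau> \<in> upper_half"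
  by (simp add: upper_half_def)

lemma qpar_plus_1: "qpar (\<tau> + 1) = qpar \<tau>"
  by (simp add: qpar_def distrib_left exp_add)

lemma E4_plus_1: "E4 (\<tau> + 1) = E4 \<tau>"
  by (simp add: E4_def qpar_plus_1)

lemma DERIV_shift_1: "(f has_field_derivative D) (at (\<tau> + 1)) \<Longrightarrow> ((\<lambda>\<tau>. f (\<tau> + 1)) has_field_derivative D) (at \<tau>)"
  for f :: "complex \<Rightarrow> complex"
  by (subst DERIV_shift[symmetric]) simp

lemma ode_solution_T:
  assumes "ode_solution r y"
  shows "ode_solution r (\<lambda>\<tau>. y (\<tau> + 1))"
proof (rule ode_solutionI[of _ "\<lambda>\<tau>. deriv y (\<tau> + 1)"])
  fix \<tau> assume "\<tau> \<in> upper_half"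
  then have "\<tau> + 1 \<in> upper_half" by (simp add: upper_half_T)
  note d = ode_derivs[OF assms this]
  show "((\<lambda>\<tau>. y (\<tau> + 1)) has_field_derivative deriv y (\<tau> + 1)) (at \<tau>)"
    by (rule DERIV_shift_1[OF d(1)])
  show "((\<lambda>\<tau>. deriv y (\<tau> + 1)) has_field_derivative
      - (of_real (pi\<^sup>2) * of_nat r ^ 2 * E4 \<tau> * y (\<tau> + 1))) (at \<tau>)"
    using DERIV_shift_1[OF d(2)] by (simp only: E4_plus_1)
qed

text \<open>
  The two terms with \<open>y'\<close> in the second derivative of \<open>\<tau> y (- 1 / \<tau>)\<close> cancel, which is what singles
  out the weight \<open>-1\<close>; the remaining \<open>y'' (- 1 / \<tau>) / \<tau>\<^sup>3\<close> is absorbed by the weight four of \<open>E4\<close>.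
\<close>
lemma ode_solution_S:
  assumes "ode_solution r y"
  shows "ode_solution r (\<lambda>\<tau>. \<tau> * y (- 1 / \<tau>))"
proof (rule ode_solutionI[of _ "\<lambda>\<tau>. y (- 1 / \<tau>) + deriv y (- 1 / \<tau>) / \<tau>"])
  fix \<tau> assume \<tau>: "\<tau> \<in> upper_half"
  then have \<tau>0: "\<tau> \<noteq> 0" by (auto simp: upper_half_def)
  have inv: "((\<lambda>\<tau>. - 1 / \<tau>) has_field_derivative 1 / \<tau> ^ 2) (at \<tau>)"
    using \<tau>0 by (auto intro!: derivative_eq_intros simp: power2_eq_square)
  note y' = DERIV_chain2[OF ode_derivs(1)[OF assms upper_half_S[OF \<tau>]] inv]
  note y'' = DERIV_chain2[OF ode_derivs(2)[OF assms upper_half_S[OF \<tau>]] inv]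
  show "((\<lambda>\<tau>. \<tau> * y (- 1 / \<tau>)) has_field_derivative y (- 1 / \<tau>) + deriv y (- 1 / \<tau>) / \<tau>) (at \<tau>)"
    by (rule DERIV_cong[OF DERIV_mult[OF DERIV_ident y']]) (use \<tau>0 in \<open>simp add: field_simps power2_eq_square\<close>)
  show "((\<lambda>\<tau>. y (- 1 / \<tau>) + deriv y (- 1 / \<tau>) / \<tau>) has_field_derivative
      - (of_real (pi\<^sup>2) * of_nat r ^ 2 * E4 \<tau> * (\<tau> * y (- 1 / \<tau>)))) (at \<tau>)"
    by (rule DERIV_cong[OF DERIV_add[OF y' DERIV_divide[OF y'' DERIV_ident \<tau>0]]])
       (use \<tau>0 in \<open>simp add: E4_S_transform[OF \<tau>, simplified] field_simps eval_nat_numeral\<close>)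
qed

definition wronskian :: "(complex \<Rightarrow> complex) \<Rightarrow> (complex \<Rightarrow> complex) \<Rightarrow> complex \<Rightarrow> complex" where
  "wronskian f g \<tau> = f \<tau> * deriv g \<tau> - deriv f \<tau> * g \<tau>"

lemma wronskian_constant:
  assumes "ode_solution r f" "ode_solution r g"
  obtains w where "\<And>\<tau>. \<tau> \<in> upper_half \<Longrightarrow> wronskian f g \<tau> = w"
proof -
  have "\<exists>w. \<forall>\<tau>\<in>upper_half. wronskian f g \<tau> = w"
  proof (rule has_field_derivative_zero_constant[OF convex_upper_half])
    fix \<tau> assume \<tau>: "\<tau> \<in> upper_half"
    note d = ode_derivs[OF assms(1) \<tau>] ode_derivs[OF assms(2) \<tau>]
    have "(wronskian f g has_field_derivative 0) (at \<tau>)"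
      unfolding wronskian_def
      by (rule DERIV_cong[OF DERIV_diff[OF DERIV_mult[OF d(1) d(4)] DERIV_mult[OF d(2) d(3)]]])
         (simp add: algebra_simps)
    then show "(wronskian f g has_field_derivative 0) (at \<tau> within upper_half)"
      by (rule has_field_derivative_at_within)
  qed
  then show ?thesis using that by blast
qed

text \<open>
  Cramer's rule: the coefficients are quotients of Wronskians, hence constant.
\<close>
lemma ode_solution_combination:
  assumes f: "ode_solution r f" and g: "ode_solution r g" and y: "ode_solution r y"
    and w: "\<And>\<tau>. \<tau> \<in> upper_half \<Longrightarrow> wronskian f g \<tau> = w" "w \<noteq> 0"
  obtains a b where "\<And>\<tau>. \<tau> \<in> upper_half \<Longrightarrow> y \<tau> = a * f \<tau> + b * g \<tau>"
proof -
  obtain u where u: "\<And>\<tau>. \<tau> \<in> upper_half \<Longrightarrow> wronskian y g \<tau> = u"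
    using wronskian_constant[OF y g] by blast
  obtain v where v: "\<And>\<tau>. \<tau> \<in> upper_half \<Longrightarrow> wronskian f y \<tau> = v"
    using wronskian_constant[OF f y] by blast
  have "y \<tau> = u / w * f \<tau> + v / w * g \<tau>" if "\<tau> \<in> upper_half" for \<tau>
  proof -
    have "w * y \<tau> = u * f \<tau> + v * g \<tau>"
      unfolding u[OF that, symmetric] v[OF that, symmetric] w(1)[OF that, symmetric] wronskian_def
      by (simp add: algebra_simps)
    then show ?thesis using w(2) by (simp add: field_simps)
  qed
  then show ?thesis using that by blast
qed

text \<open>
  The quotient \<open>g / f\<close> is constant near a point where \<open>f\<close> does not vanish, and the resulting relation
  extends to the half plane by analytic continuation.
\<close>
lemma wronskian_zero_imp_proportional:
  assumes f: "f holomorphic_on upper_half" and g: "g holomorphic_on upper_half"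
    and w: "\<And>\<tau>. \<tau> \<in> upper_half \<Longrightarrow> wronskian f g \<tau> = 0"
    and nz: "\<tau>0 \<in> upper_half" "f \<tau>0 \<noteq> 0"
  obtains l where "\<And>\<tau>. \<tau> \<in> upper_half \<Longrightarrow> g \<tau> = l * f \<tau>"
proof -
  have "isCont f \<tau>0"
    using holomorphic_on_imp_continuous_on[OF f] nz(1) open_upper_half
    by (simp add: continuous_on_eq_continuous_at)
  then obtain d where d: "d > 0" "\<And>z. dist \<tau>0 z < d \<Longrightarrow> f z \<noteq> 0"
    using continuous_at_avoid[of \<tau>0 f 0] nz(2) by blast
  obtain e where e: "e > 0" "ball \<tau>0 e \<subseteq> upper_half"
    using open_upper_half nz(1) by (meson openE)
  define B where "B = ball \<tau>0 (min d e)"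
  have B: "open B" "\<tau>0 \<in> B" "convex B" "B \<subseteq> upper_half" "\<And>z. z \<in> B \<Longrightarrow> f z \<noteq> 0"
    using d e by (auto simp: B_def)
  have "\<exists>l. \<forall>z\<in>B. g z / f z = l"
  proof (rule has_field_derivative_zero_constant[OF B(3)])
    fix z assume z: "z \<in> B"
    then have zH: "z \<in> upper_half" using B by auto
    note df = holomorphic_derivI[OF f open_upper_half zH]
    note dg = holomorphic_derivI[OF g open_upper_half zH]
    have "((\<lambda>z. g z / f z) has_field_derivative 0) (at z)"
      by (rule DERIV_cong[OF DERIV_divide[OF dg df B(5)[OF z]]])
         (use w[OF zH] in \<open>simp add: wronskian_def algebra_simps\<close>)
    then show "((\<lambda>z. g z / f z) has_field_derivative 0) (at z within B)"
      by (rule has_field_derivative_at_within)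
  qed
  then obtain l where l: "\<And>z. z \<in> B \<Longrightarrow> g z / f z = l" by blast
  have "g z = l * f z" if "z \<in> upper_half" for z
  proof (rule analytic_continuation_open[where s = B and s' = upper_half and f = g and g = "\<lambda>z. l * f z"])
    show "g z = l * f z" if "z \<in> B" for z using l[OF that] B(5)[OF that] by (simp add: field_simps)
  qed (use B open_upper_half convex_connected[OF convex_upper_half] f g that in \<open>auto intro!: holomorphic_intros\<close>)
  then show ?thesis using that by blast
qed

lemma wronskian_nonzero_imp_lin_indep:
  assumes F: "F holomorphic_on upper_half" and G: "G holomorphic_on upper_half"
    and \<tau>0: "\<tau>0 \<in> upper_half" "wronskian F G \<tau>0 \<noteq> 0"
  shows "lin_indep_on_upper_half F G"
  unfolding lin_indep_on_upper_half_def
proof (intro allI impI)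
  fix x y assume rel: "\<forall>\<tau>\<in>upper_half. x * F \<tau> + y * G \<tau> = 0"
  have "x * deriv F \<tau>0 + y * deriv G \<tau>0 = 0"
  proof (rule DERIV_unique)
    show "((\<lambda>\<tau>. x * F \<tau> + y * G \<tau>) has_field_derivative x * deriv F \<tau>0 + y * deriv G \<tau>0) (at \<tau>0)"
      by (intro DERIV_add DERIV_cmult holomorphic_derivI[OF F open_upper_half \<tau>0(1)]
            holomorphic_derivI[OF G open_upper_half \<tau>0(1)])
    show "((\<lambda>\<tau>. x * F \<tau> + y * G \<tau>) has_field_derivative 0) (at \<tau>0)"
      by (rule has_field_derivative_transform_within_open[OF DERIV_const[of 0] open_upper_half \<tau>0(1)])
         (use rel in simp)
  qed
  moreover have "x * (p * q' - p' * q) = 0 \<and> y * (p * q' - p' * q) = 0"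
    if "x * p + y * q = 0" "x * p' + y * q' = 0" for p q p' q' :: complex
    using that by algebra
  ultimately have "x * wronskian F G \<tau>0 = 0 \<and> y * wronskian F G \<tau>0 = 0"
    using rel \<tau>0(1) unfolding wronskian_def by blast
  then show "x = 0 \<and> y = 0" using \<tau>0(2) by simp
qed

text \<open>
  If \<open>G\<close> is the image of \<open>F\<close> under \<open>S\<close>, the two equations express the relations \<open>S\<^sup>2 = -1\<close> and
  \<open>(S T)\<^sup>3 = -1\<close>, the latter in the form \<open>S T = - T\<^sup>-\<^sup>1 S T\<^sup>-\<^sup>1 S\<close>.
\<close>
lemma S_image_relation:
  assumes F: "\<And>\<tau>. \<tau> \<in> upper_half \<Longrightarrow> F (\<tau> + 1) = \<epsilon> * F \<tau>" and \<epsilon>: "\<epsilon> * \<epsilon> = 1"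
    and G: "\<And>\<tau>. \<tau> \<in> upper_half \<Longrightarrow> G \<tau> = \<tau> * F (- 1 / \<tau>)"
    and \<tau>: "\<tau> \<in> upper_half"
  shows "G (- 1 / \<tau>) = - F \<tau> / \<tau>" and "G (\<tau> + 1) = - \<epsilon> * \<tau> * G (- 1 / \<tau> - 1)"
proof -
  have nonzero: "z \<noteq> 0" if "z \<in> upper_half" for z
    using that by (auto simp: upper_half_def)
  have \<tau>0: "\<tau> \<noteq> 0" "\<tau> + 1 \<noteq> 0"
    using nonzero[OF \<tau>] nonzero[of "\<tau> + 1"] \<tau> upper_half_T[of \<tau>] by blast+
  show "G (- 1 / \<tau>) = - F \<tau> / \<tau>"
    using G[OF upper_half_S[OF \<tau>]] \<tau>0 by simp
  define \<sigma> where "\<sigma> = - 1 / (\<tau> + 1)"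
  have \<sigma>: "\<sigma> \<in> upper_half" unfolding \<sigma>_def using upper_half_S[of "\<tau> + 1"] \<tau> upper_half_T by blast
  have F\<sigma>: "F \<sigma> = \<epsilon> * F (\<sigma> + 1)" using F[OF \<sigma>] \<epsilon> by (simp add: mult.assoc[symmetric])
  define \<rho> where "\<rho> = - 1 / \<tau> - 1"
  have \<rho>: "\<rho> \<in> upper_half" using upper_half_S[OF \<tau>] upper_half_T[of \<rho>] by (simp add: \<rho>_def)
  have \<rho>0: "\<rho> \<noteq> 0" using \<rho> by (auto simp: upper_half_def)
  have "- 1 / \<rho> = \<sigma> + 1" using \<tau>0 \<rho>0 unfolding \<rho>_def \<sigma>_def by (simp add: divide_simps) algebra
  then have "G \<rho> = \<rho> * F (\<sigma> + 1)" using G[OF \<rho>] by simp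
  moreover have "G (\<tau> + 1) = (\<tau> + 1) * F \<sigma>"
    using G[of "\<tau> + 1"] \<tau> upper_half_T by (simp add: \<sigma>_def)
  moreover have "\<tau> * \<rho> = - (\<tau> + 1)" using \<tau>0 by (simp add: \<rho>_def field_simps)
  then have "- \<epsilon> * (\<tau> * \<rho>) * F (\<sigma> + 1) = (\<tau> + 1) * (\<epsilon> * F (\<sigma> + 1))"
    by (simp only:) (simp add: algebra_simps)
  ultimately have "G (\<tau> + 1) = - \<epsilon> * \<tau> * G \<rho>" using F\<sigma> by (simp add: mult.assoc)
  then show "G (\<tau> + 1) = - \<epsilon> * \<tau> * G (- 1 / \<tau> - 1)" by (simp add: \<rho>_def)
qed

text \<open>
  The group relations determine the action of \<open>T\<close> on the image \<open>G\<close> of \<open>F\<close> under \<open>S\<close>. Since the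
  coefficient of \<open>F\<close> in \<open>G (\<tau> + 1)\<close> is not \<open>0\<close>, the action of \<open>T\<close> is not diagonalizable; this is why a
  logarithm, that is the term \<open>\<tau> F\<close>, appears at the cusp.
\<close>
lemma second_solution_T:
  assumes F: "ode_solution r F" and FT: "\<And>\<tau>. \<tau> \<in> upper_half \<Longrightarrow> F (\<tau> + 1) = \<epsilon> * F \<tau>"
    and \<epsilon>: "\<epsilon> * \<epsilon> = 1" and nz: "\<tau>0 \<in> upper_half" "F \<tau>0 \<noteq> 0"
  defines "G \<equiv> \<lambda>\<tau>. \<tau> * F (- 1 / \<tau>)"
  obtains w where "w \<noteq> 0" "\<And>\<tau>. \<tau> \<in> upper_half \<Longrightarrow> wronskian F G \<tau> = w"
    "\<And>\<tau>. \<tau> \<in> upper_half \<Longrightarrow> G (\<tau> + 1) = F \<tau> + \<epsilon> * G \<tau>"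
proof -
  have G: "ode_solution r G" unfolding G_def by (rule ode_solution_S[OF F])
  have rel: "G (- 1 / \<tau>) = - F \<tau> / \<tau>" "G (\<tau> + 1) = - \<epsilon> * \<tau> * G (- 1 / \<tau> - 1)"
    and FS: "F (- 1 / \<tau>) = G \<tau> / \<tau>" and \<tau>0: "\<tau> \<noteq> 0"
    if "\<tau> \<in> upper_half" for \<tau>
    using S_image_relation[where F = F and G = G and \<epsilon> = \<epsilon> and \<tau> = \<tau>, OF FT \<epsilon> _ that] that
    by (auto simp: G_def upper_half_def)
  obtain w where w: "\<And>\<tau>. \<tau> \<in> upper_half \<Longrightarrow> wronskian F G \<tau> = w"
    using wronskian_constant[OF F G] by blast
  have H1: "- 1 / \<tau> - 1 \<in> upper_half" if "\<tau> \<in> upper_half" for \<tau>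
    using upper_half_S[OF that] upper_half_T[of "- 1 / \<tau> - 1"] by simp
  have w0: "w \<noteq> 0"
  proof
    assume "w = 0"
    then obtain l where l: "\<And>\<tau>. \<tau> \<in> upper_half \<Longrightarrow> G \<tau> = l * F \<tau>"
      using wronskian_zero_imp_proportional[of F G \<tau>0] F G w nz by (auto simp: ode_solution_def)
    \<comment> \<open>\<open>S\<close> acts on the line of \<open>F\<close> by \<open>l\<close>, and \<open>S\<^sup>2 = -1\<close>.\<close>
    have "l * l * F \<tau>0 = - F \<tau>0"
    proof -
      have "l * F (- 1 / \<tau>0) = - F \<tau>0 / \<tau>0"
        using rel(1)[OF nz(1)] l[OF upper_half_S[OF nz(1)]] by simp
      then have "l * (\<tau>0 * F (- 1 / \<tau>0)) = - F \<tau>0" using \<tau>0[OF nz(1)] by (simp add: field_simps)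
      moreover have "\<tau>0 * F (- 1 / \<tau>0) = l * F \<tau>0" using l[OF nz(1)] by (simp add: G_def)
      ultimately show ?thesis by (simp add: mult.assoc)
    qed
    then have ll: "l * l = - 1" using nz(2) by (metis mult_cancel_right mult_minus_left mult_1)
    \<comment> \<open>\<open>(S T)\<^sup>3 = -1\<close> acts by \<open>(l \<epsilon>)\<^sup>3 = - l \<epsilon>\<close>, so \<open>l \<epsilon> = 1\<close>.\<close>
    have "l * \<epsilon> * F \<tau>0 = F \<tau>0"
    proof -
      have "F (- 1 / \<tau>0) = \<epsilon> * F (- 1 / \<tau>0 - 1)" using FT[OF H1[OF nz(1)]] by simp
      then have "G (- 1 / \<tau>0 - 1) = l * \<epsilon> * F (- 1 / \<tau>0)"
        using l[OF H1[OF nz(1)]] \<epsilon> by (simp add: mult.assoc[symmetric])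
      then have "G (\<tau>0 + 1) = - l * (\<epsilon> * \<epsilon>) * (\<tau>0 * F (- 1 / \<tau>0))"
        using rel(2)[OF nz(1)] by simp
      also have "\<tau>0 * F (- 1 / \<tau>0) = l * F \<tau>0" using l[OF nz(1)] by (simp add: G_def)
      finally have "G (\<tau>0 + 1) = - (l * l) * F \<tau>0" using \<epsilon> by simp
      moreover have "G (\<tau>0 + 1) = l * \<epsilon> * F \<tau>0" using l[of "\<tau>0 + 1"] FT[OF nz(1)] nz(1) upper_half_T by simp
      ultimately show ?thesis using ll by simp
    qed
    then have "l * \<epsilon> = 1" using nz(2) by simp
    then have "l * l = 1" using \<epsilon> by algebra
    with ll show False by simp
  qed
  obtain a b where ab: "\<And>\<tau>. \<tau> \<in> upper_half \<Longrightarrow> G (\<tau> + 1) = a * F \<tau> + b * G \<tau>"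
    using ode_solution_combination[OF F G ode_solution_T[OF G] w w0] by blast
  have indep: "lin_indep_on_upper_half F G"
    using F G w[OF nz(1)] w0 nz(1) unfolding ode_solution_def
    by (intro wronskian_nonzero_imp_lin_indep) auto
  \<comment> \<open>The translation preserves the Wronskian and multiplies it by its determinant \<open>\<epsilon> b\<close>.\<close>
  have b: "b = \<epsilon>"
  proof -
    have T: "\<tau>0 + 1 \<in> upper_half" using nz(1) by (simp add: upper_half_T)
    have dF: "deriv F (\<tau>0 + 1) = \<epsilon> * deriv F \<tau>0"
    proof (rule DERIV_unique[OF DERIV_shift_1[OF ode_derivs(1)[OF F T]]])
      show "((\<lambda>\<tau>. F (\<tau> + 1)) has_field_derivative \<epsilon> * deriv F \<tau>0) (at \<tau>0)"
        by (rule has_field_derivative_transform_within_open[OF DERIV_cmult[OF ode_derivs(1)[OF F nz(1)]] open_upper_half nz(1)])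
           (simp add: FT)
    qed
    have dG: "deriv G (\<tau>0 + 1) = a * deriv F \<tau>0 + b * deriv G \<tau>0"
    proof (rule DERIV_unique[OF DERIV_shift_1[OF ode_derivs(1)[OF G T]]])
      show "((\<lambda>\<tau>. G (\<tau> + 1)) has_field_derivative a * deriv F \<tau>0 + b * deriv G \<tau>0) (at \<tau>0)"
        by (rule has_field_derivative_transform_within_open[OF DERIV_add[OF DERIV_cmult[OF ode_derivs(1)[OF F nz(1)]]
               DERIV_cmult[OF ode_derivs(1)[OF G nz(1)]]] open_upper_half nz(1)])
           (simp add: ab)
    qed
    have "w = \<epsilon> * b * w"
    proof -
      have "w = \<epsilon> * F \<tau>0 * (a * deriv F \<tau>0 + b * deriv G \<tau>0) - \<epsilon> * deriv F \<tau>0 * (a * F \<tau>0 + b * G \<tau>0)"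
        using w[OF T] unfolding wronskian_def dF dG FT[OF nz(1)] ab[OF nz(1)] by simp
      also have "\<dots> = \<epsilon> * b * (F \<tau>0 * deriv G \<tau>0 - deriv F \<tau>0 * G \<tau>0)"
        by (simp add: algebra_simps)
      also have "\<dots> = \<epsilon> * b * w" using w[OF nz(1)] unfolding wronskian_def by simp
      finally show ?thesis .
    qed
    then have "\<epsilon> * b = 1" using w0 by simp
    then show ?thesis using \<epsilon> by algebra
  qed
  \<comment> \<open>The relation \<open>(S T)\<^sup>3 = -1\<close> yields a second expression for \<open>G (\<tau> + 1)\<close>; coefficients are compared.\<close>
  have "(a - 1) * F \<tau> + (b - a * \<epsilon> * \<epsilon> * \<epsilon>) * G \<tau> = 0" if "\<tau> \<in> upper_half" for \<tau>
  proof -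
    define \<rho> where "\<rho> = - 1 / \<tau> - 1"
    have \<rho>: "\<rho> \<in> upper_half" using H1[OF that] by (simp add: \<rho>_def)
    have 1: "G (\<rho> + 1) = - F \<tau> / \<tau>" "F (\<rho> + 1) = G \<tau> / \<tau>"
      using rel(1)[OF that] FS[OF that] by (simp_all add: \<rho>_def)
    have 2: "F (\<rho> + 1) = \<epsilon> * F \<rho>" "G (\<rho> + 1) = a * F \<rho> + b * G \<rho>"
      using FT[OF \<rho>] ab[OF \<rho>] by simp_all
    have 3: "G (\<tau> + 1) = - \<epsilon> * \<tau> * G \<rho>" using rel(2)[OF that] by (simp add: \<rho>_def)
    have 4: "\<tau> * G (\<rho> + 1) = - F \<tau>" "\<tau> * F (\<rho> + 1) = G \<tau>" using 1 \<tau>0[OF that] by simp_all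
    have elim: "(a - 1) * f + (b - a * \<epsilon> * \<epsilon> * \<epsilon>) * g = 0"
      if "f1 = \<epsilon> * f0" "g1 = a * f0 + \<epsilon> * g0" "h = - \<epsilon> * t * g0" "h = a * f + \<epsilon> * g"
        "t * g1 = - f" "t * f1 = g" "b = \<epsilon>" for f g f0 g0 f1 g1 h t
    proof -
      have "\<epsilon> * (t * g1) = a * (t * f1) + \<epsilon> * (\<epsilon> * (t * g0))"
        unfolding that(1,2) by (simp add: algebra_simps)
      then have "- \<epsilon> * f = a * g - \<epsilon> * h" using that(3,5,6) by (simp add: algebra_simps)
      then show ?thesis using that(4,7) \<epsilon> by algebra
    qed
    show ?thesis
      by (rule elim[OF 2(1) _ 3 _ 4 b]) (use 2(2) ab[OF that] b in simp_all)
  qed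
  with indep have "a - 1 = 0" unfolding lin_indep_on_upper_half_def by blast
  then have "a = 1" by simp
  then have "G (\<tau> + 1) = F \<tau> + \<epsilon> * G \<tau>" if "\<tau> \<in> upper_half" for \<tau>
    using ab[OF that] b by simp
  with w w0 show ?thesis using that by blast
qed

section \<open>Expansion of the second solution at the cusp\<close>

lemma qpar_eq_imp:
  assumes "qpar \<tau> = qpar \<tau>'"
  obtains n :: int where "\<tau> = \<tau>' + of_int n"
proof -
  from assms obtain n :: int where
    "2 * of_real pi * \<i> * \<tau> = 2 * of_real pi * \<i> * \<tau>' + of_real (real_of_int (2 * n) * pi) * \<i>"
    unfolding qpar_def exp_eq by blast
  then have "(2 * of_real pi * \<i>) * \<tau> = (2 * of_real pi * \<i>) * (\<tau>' + of_int n)"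
    by (simp add: algebra_simps)
  then have "\<tau> = \<tau>' + of_int n" by simp
  then show ?thesis by (rule that)
qed

lemma periodic_of_int:
  assumes per: "\<And>\<tau>. \<tau> \<in> upper_half \<Longrightarrow> P (\<tau> + 1) = P \<tau>" and \<tau>: "\<tau> \<in> upper_half"
  shows "P (\<tau> + of_int n) = P \<tau>"
proof (induction n rule: int_induct[where k = 0])
  case (step1 n)
  have "P (\<tau> + of_int n + 1) = P (\<tau> + of_int n)"
    using \<tau> by (intro per) (simp add: upper_half_def)
  then show ?case using step1.IH by (simp add: add.assoc)
next
  case (step2 n)
  have "P (\<tau> + of_int (n - 1) + 1) = P (\<tau> + of_int (n - 1))"
    using \<tau> by (intro per) (simp add: upper_half_def)
  then show ?case using step2.IH by (simp add: add.assoc)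
qed simp

lemma log_in_upper_half:
  assumes "norm (exp z) < 1"
  shows "z / (2 * of_real pi * \<i>) \<in> upper_half" and "qpar (z / (2 * of_real pi * \<i>)) = exp z"
proof -
  have "Re z < 0" using assms by (simp add: norm_exp_eq_Re)
  moreover have "z / (2 * of_real pi * \<i>) = - \<i> * z / of_real (2 * pi)" by (simp add: field_simps)
  then have "Im (z / (2 * of_real pi * \<i>)) = - Re z / (2 * pi)"
    by (simp only: Im_divide_of_real) simp
  ultimately show "z / (2 * of_real pi * \<i>) \<in> upper_half"
    by (simp add: upper_half_def divide_neg_pos)
  show "qpar (z / (2 * of_real pi * \<i>)) = exp z" by (simp add: qpar_def)
qed

text \<open>
  Every branch of \<open>log q / (2 \<pi> i)\<close> gives the same value of \<open>P\<close>, so \<open>P\<close> descends to a holomorphic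
  function on the punctured disc, whose singularity at \<open>0\<close> is removable.
\<close>
lemma periodic_bounded_imp_power_series:
  assumes hol: "P holomorphic_on upper_half"
    and per: "\<And>\<tau>. \<tau> \<in> upper_half \<Longrightarrow> P (\<tau> + 1) = P \<tau>"
    and bound: "\<And>\<tau>. \<tau> \<in> upper_half \<Longrightarrow> s \<le> Im \<tau> \<Longrightarrow> norm (P \<tau>) \<le> M"
  obtains B where "fps_conv_radius B \<ge> 1" "\<And>\<tau>. \<tau> \<in> upper_half \<Longrightarrow> P \<tau> = eval_fps B (qpar \<tau>)"
proof -
  define c where "c = 2 * of_real pi * \<i>"
  have c0: "c \<noteq> 0" by (simp add: c_def)
  define G where "G = (\<lambda>q. P (Ln q / c))"
  have GP: "G (qpar \<tau>) = P \<tau>" if \<tau>: "\<tau> \<in> upper_half" for \<tau>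
  proof -
    have q0: "qpar \<tau> \<noteq> 0" by (simp add: qpar_def)
    then have "norm (exp (Ln (qpar \<tau>))) < 1" using qpar_norm_less_1[OF \<tau>] by simp
    note L = log_in_upper_half[OF this, folded c_def]
    from L(2) q0 have "qpar (Ln (qpar \<tau>) / c) = qpar \<tau>" by simp
    then obtain n where "Ln (qpar \<tau>) / c = \<tau> + of_int n" by (rule qpar_eq_imp)
    then show ?thesis using periodic_of_int[of P, OF per \<tau>] by (simp add: G_def)
  qed
  have "G holomorphic_on ball 0 1 - {0}"
  proof (rule holomorphic_onI)
    fix q0 :: complex assume q0: "q0 \<in> ball 0 1 - {0}"
    define U where "U = (ball 0 1 - {0}) \<inter> {q. 0 < Re (q / q0)}"
    have "open {q. 0 < Re (q / q0)}" by (intro open_Collect_less continuous_intros) (use q0 in auto)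
    then have U: "open U" "q0 \<in> U" using q0 by (auto simp: U_def intro!: open_Int open_delete)
    \<comment> \<open>A branch of the logarithm that is holomorphic at \<open>q0\<close>, even if \<open>q0\<close> lies on the negative axis.\<close>
    define \<psi> where "\<psi> = (\<lambda>q. (Ln q0 + Ln (q / q0)) / c)"
    have \<psi>: "\<psi> q \<in> upper_half \<and> qpar (\<psi> q) = q" if "q \<in> U" for q
    proof -
      have e: "exp (Ln q0 + Ln (q / q0)) = q" using that q0 by (auto simp: U_def exp_add)
      then show ?thesis
        using log_in_upper_half[of "Ln q0 + Ln (q / q0)"] that by (simp add: \<psi>_def c_def U_def)
    qed
    have "((\<lambda>q. Ln q0 + Ln (q / q0)) has_field_derivative inverse q0) (at q0)"
      using q0 by (auto intro!: derivative_eq_intros simp: field_simps)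
    then have d\<psi>: "(\<psi> has_field_derivative inverse q0 / c) (at q0)"
      unfolding \<psi>_def by (rule DERIV_cdivide)
    have "(P has_field_derivative deriv P (\<psi> q0)) (at (\<psi> q0))"
      using hol open_upper_half \<psi>[OF U(2)] by (intro holomorphic_derivI) auto
    from DERIV_chain2[OF this d\<psi>]
    have "(G has_field_derivative deriv P (\<psi> q0) * (inverse q0 / c)) (at q0)"
      by (rule has_field_derivative_transform_within_open[OF _ U]) (use \<psi> GP in metis)
    then show "G field_differentiable at q0 within ball 0 1 - {0}"
      using field_differentiable_at_within field_differentiable_def by blast
  qed
  moreover have "\<exists>K. eventually (\<lambda>q. norm (G q) \<le> K) (at 0)"
  proof
    define d where "d = min 1 (exp (- 2 * pi * s))"
    have "d > 0" by (simp add: d_def)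
    then have "eventually (\<lambda>q::complex. q \<noteq> 0 \<and> norm q < d) (at 0)"
      unfolding eventually_at by (intro exI[of _ d]) auto
    then show "eventually (\<lambda>q. norm (G q) \<le> M) (at 0)"
    proof eventually_elim
      case (elim q)
      define \<tau> where "\<tau> = Ln q / c"
      have \<tau>: "\<tau> \<in> upper_half" "qpar \<tau> = q"
        using log_in_upper_half[of "Ln q"] elim by (auto simp: \<tau>_def c_def d_def)
      have "exp (- 2 * pi * Im \<tau>) < exp (- 2 * pi * s)"
        using elim qpar_norm[of \<tau>] \<tau>(2) by (simp add: d_def)
      then have "s \<le> Im \<tau>" by simp
      then show ?case using bound[OF \<tau>(1)] by (simp add: G_def \<tau>_def)
    qed
  qed
  ultimately obtain g where g: "g holomorphic_on ball 0 1" "\<And>z. z \<in> ball 0 1 - {0} \<Longrightarrow> g z = G z"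
    using holomorphic_on_extend_bounded[of G "ball 0 1" 0] by auto
  define B where "B = fps_expansion g 0"
  have g': "g holomorphic_on eball 0 1" using g(1) by (simp add: one_ereal_def)
  have "fps_conv_radius B \<ge> 1" unfolding B_def by (rule conv_radius_fps_expansion[OF g'])
  moreover have "P \<tau> = eval_fps B (qpar \<tau>)" if \<tau>: "\<tau> \<in> upper_half" for \<tau>
  proof -
    have "eval_fps B (qpar \<tau>) = g (0 + qpar \<tau>)"
      unfolding B_def using qpar_norm_less_1[OF \<tau>] by (intro eval_fps_expansion'[OF g']) simp
    also have "\<dots> = G (qpar \<tau>)" using g(2)[of "qpar \<tau>"] qpar_norm_less_1[OF \<tau>] by (simp add: qpar_def)
    finally show ?thesis using GP[OF \<tau>] by simp
  qed
  ultimately show ?thesis using that by blast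
qed

lemma zero_in_radius: "fps_conv_radius F \<ge> 1 \<Longrightarrow> ereal (norm (0 :: complex)) < fps_conv_radius F"
  by (rule less_le_trans[of _ 1]) (simp_all flip: zero_ereal_def)

lemma exp_pi_i_nat: "exp (of_real pi * \<i> * of_nat r) = (- 1) ^ r"
  using exp_of_nat_mult[of r "of_real pi * \<i>"] by (simp add: mult.commute)

text \<open>
  Near the cusp \<open>q\<^sup>r\<^sup>/\<^sup>2 A(q)\<close> is comparable to \<open>q\<^sup>r\<^sup>/\<^sup>2\<close>; the second solution is controlled through these
  two bounds.
\<close>
lemma qexp_bounds:
  assumes A: "fps_conv_radius A \<ge> 1" "fps_nth A 0 = 1"
  obtains s0 where "s0 \<ge> 1"
    "\<And>\<tau>. s0 \<le> Im \<tau> \<Longrightarrow> exp (- pi * real r * Im \<tau>) / 2 \<le> norm (qexp (int r) A \<tau>)"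
    "\<And>\<tau>. s0 \<le> Im \<tau> \<Longrightarrow> norm (qexp (int r) A \<tau>) \<le> 2 * exp (- pi * real r * Im \<tau>)"
proof -
  have "ereal (norm (0 :: complex)) < fps_conv_radius A" by (rule zero_in_radius[OF A(1)])
  then have "isCont (eval_fps A) 0"
    by (rule DERIV_isCont[OF has_field_derivative_eval_fps])
  then obtain \<delta> where \<delta>: "\<delta> > 0" "\<And>q. norm q < \<delta> \<Longrightarrow> norm (eval_fps A q - 1) < 1 / 2"
    unfolding continuous_at_eps_delta by (auto simp: dist_norm eval_fps_at_0 A(2) dest: spec[of _ "1/2"])
  define s0 where "s0 = max 1 (1 - ln \<delta> / (2 * pi))"
  have U: "1 / 2 \<le> norm (eval_fps A (qpar \<tau>))" "norm (eval_fps A (qpar \<tau>)) \<le> 2" if "s0 \<le> Im \<tau>" for \<tau>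
  proof -
    have "- ln \<delta> / (2 * pi) < Im \<tau>" using that by (simp add: s0_def)
    then have "- 2 * pi * Im \<tau> < ln \<delta>" by (simp add: field_simps)
    then have "norm (qpar \<tau>) < exp (ln \<delta>)" unfolding qpar_norm by (simp only: exp_less_cancel_iff)
    then have "norm (eval_fps A (qpar \<tau>) - 1) < 1 / 2" using \<delta> by simp
    then show "1 / 2 \<le> norm (eval_fps A (qpar \<tau>))" "norm (eval_fps A (qpar \<tau>)) \<le> 2"
      using norm_triangle_ineq2[of 1 "eval_fps A (qpar \<tau>)"] norm_triangle_ineq2[of "eval_fps A (qpar \<tau>)" 1]
      by (auto simp: norm_minus_commute)
  qed
  have N: "norm (qexp (int r) A \<tau>) = exp (- pi * real r * Im \<tau>) * norm (eval_fps A (qpar \<tau>))" for \<tau>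
    by (simp add: qexp_def norm_mult norm_exp_eq_Re)
  show ?thesis
  proof (rule that[of s0])
    show "1 \<le> s0" by (simp add: s0_def)
    fix \<tau> assume "s0 \<le> Im \<tau>"
    note U = U[OF this]
    show "exp (- pi * real r * Im \<tau>) / 2 \<le> norm (qexp (int r) A \<tau>)"
      unfolding N using mult_left_mono[OF U(1), of "exp (- pi * real r * Im \<tau>)"] by simp
    show "norm (qexp (int r) A \<tau>) \<le> 2 * exp (- pi * real r * Im \<tau>)"
      unfolding N using mult_left_mono[OF U(2), of "exp (- pi * real r * Im \<tau>)"] by simp
  qed
qed

text \<open>
  Integration along vertical lines upwards from the height \<open>b\<close>. The restriction to a strip of width one
  makes the values at that height bounded.
\<close>
lemma quotient_growth:
  assumes r: "r > 0"
    and der: "\<And>\<tau>. b \<le> Im \<tau> \<Longrightarrow> (h has_field_derivative h' \<tau>) (at \<tau>)"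
    and h': "\<And>\<tau>. b \<le> Im \<tau> \<Longrightarrow> norm (h' \<tau>) \<le> K * exp (2 * pi * real r * Im \<tau>)"
  obtains H where "\<And>\<tau>. b \<le> Im \<tau> \<Longrightarrow> 0 \<le> Re \<tau> \<Longrightarrow> Re \<tau> \<le> 1 \<Longrightarrow>
    norm (h \<tau>) \<le> H + K / (2 * pi * real r) * exp (2 * pi * real r * Im \<tau>)"
proof -
  have K0: "0 \<le> K"
    using order_trans[OF norm_ge_zero h'[of "Complex 0 b"]] by (simp add: zero_le_mult_iff)
  have "continuous_on {0..1} (\<lambda>x. h (Complex x b))"
  proof (rule continuous_on_compose2[where g = h and t = "{\<tau>. b \<le> Im \<tau>}"])
    show "continuous_on {\<tau>. b \<le> Im \<tau>} h"
      using der by (intro continuous_at_imp_continuous_on ballI) (auto intro: DERIV_isCont)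
    show "continuous_on {0..1} (\<lambda>x. Complex x b)"
      unfolding Complex_eq by (intro continuous_intros)
  qed auto
  then have "bounded ((\<lambda>x. h (Complex x b)) ` {0..1})"
    by (intro compact_imp_bounded compact_continuous_image) auto
  then obtain H where "\<forall>x\<in>{0..1}. norm (h (Complex x b)) \<le> H"
    unfolding bounded_iff by auto
  then have H: "norm (h (Complex x b)) \<le> H" if "0 \<le> x" "x \<le> 1" for x
    using that by simp
  define C where "C = K / (2 * pi * real r)"
  have C0: "0 \<le> C" using K0 by (simp add: C_def)
  have "norm (h \<tau>) \<le> H + C * exp (2 * pi * real r * Im \<tau>)"
    if \<tau>: "b \<le> Im \<tau>" "0 \<le> Re \<tau>" "Re \<tau> \<le> 1" for \<tau>
  proof (cases "b = Im \<tau>")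
    case True
    then have "Complex (Re \<tau>) b = \<tau>" by simp
    then have "norm (h \<tau>) \<le> H" using H[of "Re \<tau>"] \<tau> by simp
    then show ?thesis using C0 by (simp add: add_increasing2)
  next
    case False
    define x where "x = Re \<tau>"
    let ?p = "\<lambda>t. h (Complex x t)"
    have p: "(?p has_vector_derivative (\<i> * h' (Complex x t))) (at t)" if "b \<le> t" for t
    proof -
      have "((\<lambda>t. Complex x t) has_vector_derivative \<i>) (at t)"
        unfolding Complex_eq has_vector_derivative_def by (auto intro!: derivative_eq_intros simp: scaleR_conv_of_real)
      then have "(h \<circ> (\<lambda>t. Complex x t) has_vector_derivative \<i> * h' (Complex x t)) (at t)"
        by (rule field_vector_diff_chain_at) (use der that in simp)
      then show ?thesis by (simp add: o_def)
    qed
    have "norm (?p (Im \<tau>) - ?p b) \<le> C * exp (2 * pi * real r * Im \<tau>) - C * exp (2 * pi * real r * b)"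
    proof (rule differentiable_bound_general)
      show "b < Im \<tau>" using False \<tau> by simp
      show "continuous_on {b..Im \<tau>} ?p"
        using p by (intro continuous_at_imp_continuous_on ballI) (auto intro: has_vector_derivative_continuous)
      show "continuous_on {b..Im \<tau>} (\<lambda>t. C * exp (2 * pi * real r * t))"
        by (intro continuous_intros)
      fix t assume t: "b < t" "t < Im \<tau>"
      show "(?p has_vector_derivative (\<i> * h' (Complex x t))) (at t)" using p t by simp
      show "((\<lambda>t. C * exp (2 * pi * real r * t)) has_vector_derivative (K * exp (2 * pi * real r * t))) (at t)"
        unfolding has_real_derivative_iff_has_vector_derivative[symmetric]
        using r by (auto intro!: derivative_eq_intros simp: C_def)
      show "norm (\<i> * h' (Complex x t)) \<le> K * exp (2 * pi * real r * t)"
        using h'[of "Complex x t"] t by (simp add: norm_mult)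
    qed
    moreover have "Complex x (Im \<tau>) = \<tau>" by (simp add: x_def)
    moreover have "norm (?p b) \<le> H" using H \<tau> by (simp add: x_def)
    moreover have "0 \<le> C * exp (2 * pi * real r * b)" using C0 by simp
    moreover have "norm (h \<tau>) \<le> norm (?p b) + norm (h \<tau> - ?p b)"
      using norm_triangle_ineq[of "?p b" "h \<tau> - ?p b"] by simp
    ultimately show ?thesis by simp
  qed
  then show ?thesis using that unfolding C_def by blast
qed

lemma eval_fps_qpar_tendsto:
  assumes F: "fps_conv_radius F \<ge> 1"
  shows "(\<lambda>n. eval_fps F (qpar (\<i> * of_nat (Suc n)))) \<longlonglongrightarrow> fps_nth F 0"
proof -
  have "(\<lambda>n. exp (- 2 * pi * real (Suc n))) \<longlonglongrightarrow> 0" by real_asymp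
  then have "(\<lambda>n. norm (qpar (\<i> * of_nat (Suc n)))) \<longlonglongrightarrow> 0" by (simp add: qpar_norm)
  then have "(\<lambda>n. qpar (\<i> * of_nat (Suc n))) \<longlonglongrightarrow> 0" by (simp only: tendsto_norm_zero_iff)
  moreover have "ereal (norm (0 :: complex)) < fps_conv_radius F" by (rule zero_in_radius[OF F])
  then have "isCont (eval_fps F) 0" by (rule DERIV_isCont[OF has_field_derivative_eval_fps])
  ultimately show ?thesis
    using isCont_tendsto_compose by (fastforce simp: eval_fps_at_0)
qed

text \<open>
  With \<open>h = G / F\<close> one has \<open>G - \<tau> F = F (h - \<tau>)\<close> and \<open>h' = w / F\<^sup>2\<close>. Here \<open>F\<close> is of order \<open>q\<^sup>r\<^sup>/\<^sup>2\<close> and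
  \<open>h'\<close> of order \<open>q\<^sup>-\<^sup>r\<close>, so \<open>h - \<tau>\<close> is of order \<open>q\<^sup>-\<^sup>r\<close> and \<open>G - \<tau> F\<close> of order \<open>q\<^sup>-\<^sup>r\<^sup>/\<^sup>2\<close>.
\<close>
lemma second_solution_bounded:
  fixes r :: nat and A :: "complex fps"
  defines "F \<equiv> qexp (int r) A"
  assumes r: "r > 0" and A: "fps_conv_radius A \<ge> 1" "fps_nth A 0 = 1"
    and G: "G holomorphic_on upper_half"
    and w: "\<And>\<tau>. \<tau> \<in> upper_half \<Longrightarrow> wronskian F G \<tau> = w"
  obtains s0 M where "\<And>\<tau>. s0 \<le> Im \<tau> \<Longrightarrow> 0 \<le> Re \<tau> \<Longrightarrow> Re \<tau> \<le> 1 \<Longrightarrow>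
    norm (exp (of_real pi * \<i> * of_nat r * \<tau>) * (G \<tau> - \<tau> * F \<tau>)) \<le> M"
proof -
  define P where "P = (\<lambda>\<tau>. exp (of_real pi * \<i> * of_nat r * \<tau>) * (G \<tau> - \<tau> * F \<tau>))"
  have F: "F holomorphic_on upper_half" unfolding F_def by (rule qexp_holomorphic[OF A(1)])
  obtain s0 where s0: "s0 \<ge> 1"
    and F_lower: "\<And>\<tau>. s0 \<le> Im \<tau> \<Longrightarrow> exp (- pi * real r * Im \<tau>) / 2 \<le> norm (F \<tau>)"
    and F_upper: "\<And>\<tau>. s0 \<le> Im \<tau> \<Longrightarrow> norm (F \<tau>) \<le> 2 * exp (- pi * real r * Im \<tau>)"
    unfolding F_def using qexp_bounds[OF A] by metis
  have H: "\<tau> \<in> upper_half" if "s0 \<le> Im \<tau>" for \<tau> using that s0 by (simp add: upper_half_def)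
  have F0: "F \<tau> \<noteq> 0" if "s0 \<le> Im \<tau>" for \<tau>
    using F_lower[OF that] exp_gt_zero[of "- pi * real r * Im \<tau>"] by auto
  define h where "h = (\<lambda>\<tau>. G \<tau> / F \<tau>)"
  have dh: "(h has_field_derivative w / (F \<tau> * F \<tau>)) (at \<tau>)" if "s0 \<le> Im \<tau>" for \<tau>
    unfolding h_def
    by (rule DERIV_cong[OF DERIV_divide[OF holomorphic_derivI[OF G open_upper_half H[OF that]]
          holomorphic_derivI[OF F open_upper_half H[OF that]] F0[OF that]]])
       (use w[OF H[OF that]] in \<open>simp add: wronskian_def mult.commute\<close>)
  have dh_bound: "norm (w / (F \<tau> * F \<tau>)) \<le> 4 * norm w * exp (2 * pi * real r * Im \<tau>)" if "s0 \<le> Im \<tau>" for \<tau>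
  proof -
    define e where "e = exp (- pi * real r * Im \<tau>)"
    have e0: "e > 0" by (simp add: e_def)
    have e: "exp (2 * pi * real r * Im \<tau>) = 1 / (e * e)"
      by (simp add: e_def exp_minus field_simps flip: exp_add)
    have "(e / 2) * (e / 2) \<le> norm (F \<tau>) * norm (F \<tau>)"
      using F_lower[OF that] e0 unfolding e_def[symmetric] by (intro mult_mono) auto
    then have "norm w / (norm (F \<tau>) * norm (F \<tau>)) \<le> norm w / ((e / 2) * (e / 2))"
      using e0 F0[OF that] by (intro divide_left_mono mult_pos_pos) auto
    then show ?thesis unfolding e by (simp add: norm_divide norm_mult mult.commute)
  qed
  obtain H0 where H0: "\<And>\<tau>. s0 \<le> Im \<tau> \<Longrightarrow> 0 \<le> Re \<tau> \<Longrightarrow> Re \<tau> \<le> 1 \<Longrightarrow>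
      norm (h \<tau>) \<le> H0 + 4 * norm w / (2 * pi * real r) * exp (2 * pi * real r * Im \<tau>)"
    using quotient_growth[where h = h and h' = "\<lambda>\<tau>. w / (F \<tau> * F \<tau>)" and b = s0, OF r dh dh_bound]
    by metis
  define C where "C = 4 * norm w / (2 * pi * real r)"
  define M where "M = 2 * (\<bar>H0\<bar> + 1 + (C + 1))"
  have strip: "norm (P \<tau>) \<le> M" if \<tau>: "s0 \<le> Im \<tau>" "0 \<le> Re \<tau>" "Re \<tau> \<le> 1" for \<tau>
  proof -
    define e where "e = exp (- pi * real r * Im \<tau>)"
    have e0: "e > 0" by (simp add: e_def)
    have ee: "exp (2 * pi * real r * Im \<tau>) = 1 / (e * e)"
      by (simp add: e_def exp_minus field_simps flip: exp_add)
    have "0 \<le> pi * real r * Im \<tau>" using \<tau>(1) s0 by simp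
    then have e1: "e \<le> 1" by (simp add: e_def)
    have "e * e \<le> 1 * 1" using e0 e1 by (intro mult_mono) auto
    have pir: "1 \<le> 2 * pi * real r"
    proof -
      have "1 \<le> real r" using r by simp
      moreover have "1 \<le> 2 * pi" using pi_gt3 by linarith
      ultimately show ?thesis using mult_mono[of 1 "2 * pi" 1 "real r"] by simp
    qed
    have "Im \<tau> \<le> 1 / (e * e)"
    proof -
      have "Im \<tau> \<le> 2 * pi * real r * Im \<tau>" using pir \<tau>(1) s0 by (simp add: mult_le_cancel_right1)
      also have "\<dots> \<le> exp (2 * pi * real r * Im \<tau>)" by (rule order_trans[OF _ exp_ge_add_one_self]) simp
      finally show ?thesis by (simp only: ee)
    qed
    moreover have "norm \<tau> \<le> \<bar>Re \<tau>\<bar> + \<bar>Im \<tau>\<bar>" by (rule cmod_le)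
    ultimately have "norm \<tau> \<le> 1 + 1 / (e * e)" using \<tau> s0 by linarith
    moreover have "norm (h \<tau>) \<le> \<bar>H0\<bar> + C * (1 / (e * e))"
      using H0[OF \<tau>] unfolding ee C_def by linarith
    moreover have "norm (h \<tau> - \<tau>) \<le> norm (h \<tau>) + norm \<tau>" by (rule norm_triangle_ineq4)
    ultimately have ht: "norm (h \<tau> - \<tau>) \<le> (\<bar>H0\<bar> + 1) + (C + 1) * (1 / (e * e))"
      by (simp add: algebra_simps add_divide_distrib)
    have "G \<tau> - \<tau> * F \<tau> = F \<tau> * (h \<tau> - \<tau>)" using F0[OF \<tau>(1)] by (simp add: h_def algebra_simps)
    then have "norm (P \<tau>) = e * (norm (F \<tau>) * norm (h \<tau> - \<tau>))"
      by (simp add: P_def norm_mult norm_exp_eq_Re e_def)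
    also have "\<dots> \<le> e * ((2 * e) * ((\<bar>H0\<bar> + 1) + (C + 1) * (1 / (e * e))))"
      using F_upper[OF \<tau>(1)] ht e0 unfolding e_def[symmetric] by (intro mult_left_mono mult_mono) auto
    also have "\<dots> = 2 * ((\<bar>H0\<bar> + 1) * (e * e) + (C + 1))" using e0 by (simp add: field_simps)
    also have "\<dots> \<le> M"
      unfolding M_def using mult_left_mono[OF \<open>e * e \<le> 1 * 1\<close>, of "\<bar>H0\<bar> + 1"] by simp
    finally show ?thesis .
  qed
  then show ?thesis using that unfolding P_def by blast
qed

text \<open>
  After \<open>G = \<tau> F + g\<close> is inserted, the explicit \<open>\<tau>\<close> cancels and the Wronskian becomes a power series in
  \<open>q\<close>. Being constant, it equals its constant term.
\<close>
lemma wronskian_leading_coefficients: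
  fixes r :: nat and A B :: "complex fps"
  defines "F \<equiv> qexp (int r) A"
  assumes r: "r > 0" and A: "fps_conv_radius A \<ge> 1" and B: "fps_conv_radius B \<ge> 1"
    and g: "\<And>\<tau>. \<tau> \<in> upper_half \<Longrightarrow> G \<tau> - \<tau> * F \<tau> = qexp (- int r) B \<tau>"
    and w: "\<And>\<tau>. \<tau> \<in> upper_half \<Longrightarrow> wronskian F G \<tau> = w"
  shows "w = - 2 * of_real pi * \<i> * of_nat r * fps_nth A 0 * fps_nth B 0"
proof -
  define A1 where "A1 = fps_const (of_int (int r)) * A + 2 * fps_theta A"
  define B1 where "B1 = fps_const (of_int (- int r)) * B + 2 * fps_theta B"
  have rad: "fps_conv_radius A1 \<ge> 1" "fps_conv_radius B1 \<ge> 1"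
    unfolding A1_def B1_def
    by (intro fps_add_radius_ge_1 fps_mult_radius_ge_1 fps_theta_radius_ge_1 A B; simp)+
  have W: "w = qpar \<tau> ^ r * eval_fps A (qpar \<tau>) ^ 2 + of_real pi * \<i> *
      (eval_fps A (qpar \<tau>) * eval_fps B1 (qpar \<tau>) - eval_fps A1 (qpar \<tau>) * eval_fps B (qpar \<tau>))"
    if \<tau>: "\<tau> \<in> upper_half" for \<tau>
  proof -
    define e where "e = exp (of_real pi * \<i> * of_nat r * \<tau>)"
    have e0: "e \<noteq> 0" by (simp add: e_def)
    have e2: "e * e = qpar \<tau> ^ r"
      by (simp add: e_def qpar_def flip: exp_add exp_of_nat_mult) (simp add: mult_ac)
    have em: "exp (of_real pi * \<i> * of_int (- int r) * \<tau>) = inverse e"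
      by (simp add: e_def exp_minus)
    have ep: "exp (of_real pi * \<i> * of_int (int r) * \<tau>) = e"
      by (simp add: e_def)
    have dF: "(F has_field_derivative of_real pi * \<i> * qexp (int r) A1 \<tau>) (at \<tau>)"
      unfolding F_def A1_def by (rule qexp_has_field_derivative[OF A \<tau>])
    have "((\<lambda>\<tau>. \<tau> * F \<tau> + qexp (- int r) B \<tau>) has_field_derivative
        (1 * F \<tau> + of_real pi * \<i> * qexp (int r) A1 \<tau> * \<tau>) + of_real pi * \<i> * qexp (- int r) B1 \<tau>) (at \<tau>)"
      unfolding B1_def
      by (intro DERIV_add DERIV_mult DERIV_ident dF qexp_has_field_derivative B \<tau>)
    then have dG: "(G has_field_derivative
        (1 * F \<tau> + of_real pi * \<i> * qexp (int r) A1 \<tau> * \<tau>) + of_real pi * \<i> * qexp (- int r) B1 \<tau>) (at \<tau>)"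
      by (rule has_field_derivative_transform_within_open[OF _ open_upper_half \<tau>])
         (use g in \<open>simp add: algebra_simps\<close>)
    have "w = F \<tau> * deriv G \<tau> - deriv F \<tau> * (\<tau> * F \<tau> + qexp (- int r) B \<tau>)"
      using w[OF \<tau>] g[OF \<tau>] by (simp add: wronskian_def algebra_simps)
    also have "\<dots> = F \<tau> * F \<tau> + of_real pi * \<i> * (F \<tau> * qexp (- int r) B1 \<tau> - qexp (int r) A1 \<tau> * qexp (- int r) B \<tau>)"
      unfolding DERIV_imp_deriv[OF dF] DERIV_imp_deriv[OF dG] by (simp add: algebra_simps)
    also have "F \<tau> * F \<tau> = qpar \<tau> ^ r * eval_fps A (qpar \<tau>) ^ 2"
      unfolding F_def qexp_def ep e2[symmetric] by (simp add: power2_eq_square mult_ac)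
    also have "F \<tau> * qexp (- int r) B1 \<tau> = eval_fps A (qpar \<tau>) * eval_fps B1 (qpar \<tau>)"
      unfolding F_def qexp_def ep em using e0 by simp
    also have "qexp (int r) A1 \<tau> * qexp (- int r) B \<tau> = eval_fps A1 (qpar \<tau>) * eval_fps B (qpar \<tau>)"
      unfolding F_def qexp_def ep em using e0 by simp
    finally show ?thesis .
  qed
  have "(\<lambda>n. eval_fps fps_X (qpar (\<i> * of_nat (Suc n)))) \<longlonglongrightarrow> fps_nth (fps_X :: complex fps) 0"
    by (rule eval_fps_qpar_tendsto) simp
  then have X: "(\<lambda>n. qpar (\<i> * of_nat (Suc n))) \<longlonglongrightarrow> 0" by simp
  have "(\<lambda>n::nat. w) \<longlonglongrightarrow> 0 ^ r * fps_nth A 0 ^ 2 + of_real pi * \<i> *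
      (fps_nth A 0 * fps_nth B1 0 - fps_nth A1 0 * fps_nth B 0)"
  proof (rule Lim_transform_eventually)
    show "(\<lambda>n. qpar (\<i> * of_nat (Suc n)) ^ r * eval_fps A (qpar (\<i> * of_nat (Suc n))) ^ 2 + of_real pi * \<i> *
      (eval_fps A (qpar (\<i> * of_nat (Suc n))) * eval_fps B1 (qpar (\<i> * of_nat (Suc n))) -
       eval_fps A1 (qpar (\<i> * of_nat (Suc n))) * eval_fps B (qpar (\<i> * of_nat (Suc n))))) \<longlonglongrightarrow>
      0 ^ r * fps_nth A 0 ^ 2 + of_real pi * \<i> * (fps_nth A 0 * fps_nth B1 0 - fps_nth A1 0 * fps_nth B 0)"
      by (intro tendsto_intros X eval_fps_qpar_tendsto A B rad)
    show "\<forall>\<^sub>F n in sequentially. qpar (\<i> * of_nat (Suc n)) ^ r * eval_fps A (qpar (\<i> * of_nat (Suc n))) ^ 2 + of_real pi * \<i> *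
      (eval_fps A (qpar (\<i> * of_nat (Suc n))) * eval_fps B1 (qpar (\<i> * of_nat (Suc n))) -
       eval_fps A1 (qpar (\<i> * of_nat (Suc n))) * eval_fps B (qpar (\<i> * of_nat (Suc n)))) = w"
      by (intro always_eventually allI W[symmetric]) (simp add: upper_half_def)
  qed
  then have "w = 0 ^ r * fps_nth A 0 ^ 2 + of_real pi * \<i> *
      (fps_nth A 0 * fps_nth B1 0 - fps_nth A1 0 * fps_nth B 0)"
    by (simp only: LIMSEQ_const_iff)
  also have "\<dots> = - 2 * of_real pi * \<i> * of_nat r * fps_nth A 0 * fps_nth B 0"
    using r by (simp add: A1_def B1_def numeral_fps_const)
  finally show ?thesis .
qed

lemma second_solution_expansion:
  fixes r :: nat and A :: "complex fps"
  defines "F \<equiv> qexp (int r) A"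
  assumes r: "r > 0" and A: "fps_conv_radius A \<ge> 1" "fps_nth A 0 = 1"
    and G: "G holomorphic_on upper_half"
    and w: "\<And>\<tau>. \<tau> \<in> upper_half \<Longrightarrow> wronskian F G \<tau> = w" "w \<noteq> 0"
    and FT: "\<And>\<tau>. \<tau> \<in> upper_half \<Longrightarrow> F (\<tau> + 1) = (- 1) ^ r * F \<tau>"
    and GT: "\<And>\<tau>. \<tau> \<in> upper_half \<Longrightarrow> G (\<tau> + 1) = (- 1) ^ r * (F \<tau> + G \<tau>)"
  obtains B where "fps_conv_radius B \<ge> 1" "fps_nth B 0 \<noteq> 0"
    "\<And>\<tau>. \<tau> \<in> upper_half \<Longrightarrow> G \<tau> - \<tau> * F \<tau> = qexp (- int r) B \<tau>"
proof -
  define P where "P = (\<lambda>\<tau>. exp (of_real pi * \<i> * of_nat r * \<tau>) * (G \<tau> - \<tau> * F \<tau>))"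
  have F: "F holomorphic_on upper_half" unfolding F_def by (rule qexp_holomorphic[OF A(1)])
  have per: "P (\<tau> + 1) = P \<tau>" if \<tau>: "\<tau> \<in> upper_half" for \<tau>
  proof -
    have "exp (of_real pi * \<i> * of_nat r * (\<tau> + 1)) = exp (of_real pi * \<i> * of_nat r * \<tau>) * (- 1) ^ r"
      unfolding distrib_left exp_add by (simp add: exp_pi_i_nat)
    moreover have "G (\<tau> + 1) - (\<tau> + 1) * F (\<tau> + 1) = (- 1) ^ r * (G \<tau> - \<tau> * F \<tau>)"
      using FT[OF \<tau>] GT[OF \<tau>] by (simp add: algebra_simps)
    moreover have "(- 1) ^ r * (- 1) ^ r = (1 :: complex)" by (simp flip: power_add)
    ultimately show ?thesis unfolding P_def by (simp add: mult.assoc)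
  qed
  obtain s0 M where strip: "\<And>\<tau>. s0 \<le> Im \<tau> \<Longrightarrow> 0 \<le> Re \<tau> \<Longrightarrow> Re \<tau> \<le> 1 \<Longrightarrow> norm (P \<tau>) \<le> M"
    unfolding P_def F_def using second_solution_bounded[OF r A G w(1)[unfolded F_def]] by metis
  have P_bound: "norm (P \<tau>) \<le> M" if \<tau>: "\<tau> \<in> upper_half" "s0 \<le> Im \<tau>" for \<tau>
  proof -
    have "P (\<tau> + of_int (- \<lfloor>Re \<tau>\<rfloor>)) = P \<tau>" by (rule periodic_of_int[of P, OF per \<tau>(1)])
    moreover have "norm (P (\<tau> + of_int (- \<lfloor>Re \<tau>\<rfloor>))) \<le> M"
      by (rule strip) (use \<tau> in \<open>simp, simp, simp, linarith\<close>)
    ultimately show ?thesis by simp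
  qed
  have "P holomorphic_on upper_half"
    unfolding P_def by (intro holomorphic_intros F G)
  then obtain B where B: "fps_conv_radius B \<ge> 1" "\<And>\<tau>. \<tau> \<in> upper_half \<Longrightarrow> P \<tau> = eval_fps B (qpar \<tau>)"
    using periodic_bounded_imp_power_series[where P = P and s = s0 and M = M, OF _ per P_bound] by blast
  have g: "G \<tau> - \<tau> * F \<tau> = qexp (- int r) B \<tau>" if "\<tau> \<in> upper_half" for \<tau>
    using B(2)[OF that] by (simp add: qexp_def P_def exp_minus field_simps flip: exp_add)
  have "w = - 2 * of_real pi * \<i> * of_nat r * fps_nth A 0 * fps_nth B 0"
    using wronskian_leading_coefficients[OF r A(1) B(1), of G w] g w(1) by (simp add: F_def)
  then have "fps_nth B 0 \<noteq> 0" using w(2) by auto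
  with B(1) g show ?thesis using that by blast
qed

section \<open>Equivariance and quasi-modularity\<close>

lemma aut_factor_mat22: "aut_factor (mat22 a b c d) \<tau> = of_int c * \<tau> + of_int d"
  by (simp add: aut_factor_def)

lemma moebius_act_mat22: "moebius_act (mat22 a b c d) \<tau> = (of_int a * \<tau> + of_int b) / (of_int c * \<tau> + of_int d)"
  by (simp add: moebius_act_def aut_factor_mat22)

lemma aut_factor_nonzero:
  assumes "det A = 1" "\<tau> \<in> upper_half"
  shows "aut_factor A \<tau> \<noteq> 0"
proof
  obtain a b c d where A: "A = mat22 a b c d" by (metis mat22_eta)
  assume "aut_factor A \<tau> = 0"
  then have j: "of_int c * \<tau> + of_int d = 0" by (simp add: A aut_factor_mat22)
  then have "Im (of_int c * \<tau> + of_int d) = 0" by (simp only:) simp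
  then have "c = 0" using assms(2) by (simp add: upper_half_def)
  with j have "d = 0" by simp
  with \<open>c = 0\<close> assms(1) show False by (simp add: A)
qed

lemma moebius_act_upper_half:
  assumes "det A = 1" "\<tau> \<in> upper_half"
  shows "moebius_act A \<tau> \<in> upper_half"
proof -
  obtain a b c d where A: "A = mat22 a b c d" by (metis mat22_eta)
  define j where "j = of_int c * \<tau> + of_int d"
  have j: "j \<noteq> 0" using aut_factor_nonzero[OF assms] by (simp add: A aut_factor_mat22 j_def)
  have det: "real_of_int a * real_of_int d - real_of_int b * real_of_int c = 1"
    using assms(1) unfolding A det_mat22 by (metis of_int_1 of_int_diff of_int_mult)
  have "Im (moebius_act A \<tau>) = (Im (of_int a * \<tau> + of_int b) * Re j - Re (of_int a * \<tau> + of_int b) * Im j) / (norm j)\<^sup>2"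
    by (simp only: A moebius_act_mat22 j_def[symmetric] Im_divide cmod_power2)
  also have "Im (of_int a * \<tau> + of_int b) * Re j - Re (of_int a * \<tau> + of_int b) * Im j =
      (real_of_int a * real_of_int d - real_of_int b * real_of_int c) * Im \<tau>"
    by (simp add: j_def algebra_simps)
  finally show ?thesis using assms(2) j unfolding det by (simp add: upper_half_def)
qed

lemma aut_factor_moebius_act_mult:
  assumes "det A = 1" "det B = 1" "\<tau> \<in> upper_half"
  shows "aut_factor (A ** B) \<tau> = aut_factor A (moebius_act B \<tau>) * aut_factor B \<tau>"
    and "moebius_act (A ** B) \<tau> = moebius_act A (moebius_act B \<tau>)"
proof -
  obtain a b c d where A: "A = mat22 a b c d" by (metis mat22_eta)
  obtain a' b' c' d' where B: "B = mat22 a' b' c' d'" by (metis mat22_eta)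
  define j where "j = of_int c' * \<tau> + of_int d'"
  define n where "n = of_int a' * \<tau> + of_int b'"
  have j: "j \<noteq> 0" using aut_factor_nonzero[OF assms(2,3)] by (simp add: B aut_factor_mat22 j_def)
  have num: "of_int (x * a' + y * c') * \<tau> + of_int (x * b' + y * d') = (of_int x * (n / j) + of_int y) * j" for x y
    using j by (simp add: distrib_right) (simp add: n_def j_def algebra_simps)
  show 1: "aut_factor (A ** B) \<tau> = aut_factor A (moebius_act B \<tau>) * aut_factor B \<tau>"
    unfolding A B mat22_mult aut_factor_mat22 moebius_act_mat22 num by (simp add: n_def j_def)
  show "moebius_act (A ** B) \<tau> = moebius_act A (moebius_act B \<tau>)"
    unfolding A B mat22_mult moebius_act_mat22 num using j by (simp add: n_def j_def)
qed

text \<open>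
  Under the action of weight \<open>-1\<close> the matrix \<open>A\<close> sends the column \<open>(f2, f1)\<close> to \<open>u A (f2, f1)\<close>. For
  \<open>f1 \<noteq> 0\<close> this makes \<open>h = f2 / f1\<close> equivariant, \<open>h (A \<tau>) = A (h \<tau>)\<close>; the factor \<open>u\<close> plays the part of
  the value at \<open>A\<close> of a character.
\<close>
definition equivariant_pair :: "complex \<Rightarrow> (complex \<Rightarrow> complex) \<Rightarrow> (complex \<Rightarrow> complex) \<Rightarrow> int^2^2 \<Rightarrow> bool" where
  "equivariant_pair u f1 f2 A \<longleftrightarrow> det A = 1 \<and> (\<forall>\<tau>\<in>upper_half.
     aut_factor A \<tau> * f1 (moebius_act A \<tau>) = u * (of_int (A$2$1) * f2 \<tau> + of_int (A$2$2) * f1 \<tau>) \<and>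
     aut_factor A \<tau> * f2 (moebius_act A \<tau>) = u * (of_int (A$1$1) * f2 \<tau> + of_int (A$1$2) * f1 \<tau>))"

lemma equivariant_pair_one: "equivariant_pair 1 f1 f2 (mat22 1 0 0 1)"
  by (simp add: equivariant_pair_def aut_factor_mat22 moebius_act_mat22)

lemma equivariant_pair_mult:
  assumes "equivariant_pair u f1 f2 A" "equivariant_pair v f1 f2 B"
  shows "equivariant_pair (u * v) f1 f2 (A ** B)"
proof -
  obtain a b c d where A: "A = mat22 a b c d" by (metis mat22_eta)
  obtain a' b' c' d' where B: "B = mat22 a' b' c' d'" by (metis mat22_eta)
  have det: "det A = 1" "det B = 1" using assms by (auto simp: equivariant_pair_def)
  show ?thesis
    unfolding equivariant_pair_def
  proof (intro conjI ballI)
    show "det (A ** B) = 1" using det by (simp add: det_mul)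
    fix \<tau> assume \<tau>: "\<tau> \<in> upper_half"
    define \<sigma> where "\<sigma> = moebius_act B \<tau>"
    have \<sigma>: "\<sigma> \<in> upper_half" unfolding \<sigma>_def by (rule moebius_act_upper_half[OF det(2) \<tau>])
    have 1: "aut_factor A \<sigma> * f1 (moebius_act A \<sigma>) = u * (of_int c * f2 \<sigma> + of_int d * f1 \<sigma>)"
      "aut_factor A \<sigma> * f2 (moebius_act A \<sigma>) = u * (of_int a * f2 \<sigma> + of_int b * f1 \<sigma>)"
      using assms(1) \<sigma> by (auto simp: equivariant_pair_def A)
    have 2: "aut_factor B \<tau> * f1 \<sigma> = v * (of_int c' * f2 \<tau> + of_int d' * f1 \<tau>)"
      "aut_factor B \<tau> * f2 \<sigma> = v * (of_int a' * f2 \<tau> + of_int b' * f1 \<tau>)"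
      using assms(2) \<tau> by (auto simp: equivariant_pair_def B \<sigma>_def)
    note co = aut_factor_moebius_act_mult[OF det \<tau>, folded \<sigma>_def]
    have "aut_factor (A ** B) \<tau> * f1 (moebius_act (A ** B) \<tau>) = aut_factor B \<tau> * (aut_factor A \<sigma> * f1 (moebius_act A \<sigma>))"
      by (simp only: co mult_ac)
    also have "\<dots> = u * (of_int c * (aut_factor B \<tau> * f2 \<sigma>) + of_int d * (aut_factor B \<tau> * f1 \<sigma>))"
      unfolding 1 by (simp add: algebra_simps)
    also have "\<dots> = u * v * (of_int (c * a' + d * c') * f2 \<tau> + of_int (c * b' + d * d') * f1 \<tau>)"
      unfolding 2 by (simp add: algebra_simps)
    finally show "aut_factor (A ** B) \<tau> * f1 (moebius_act (A ** B) \<tau>) =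
        u * v * (of_int ((A ** B)$2$1) * f2 \<tau> + of_int ((A ** B)$2$2) * f1 \<tau>)"
      unfolding A B mat22_mult mat22_nth .
    have "aut_factor (A ** B) \<tau> * f2 (moebius_act (A ** B) \<tau>) = aut_factor B \<tau> * (aut_factor A \<sigma> * f2 (moebius_act A \<sigma>))"
      by (simp only: co mult_ac)
    also have "\<dots> = u * (of_int a * (aut_factor B \<tau> * f2 \<sigma>) + of_int b * (aut_factor B \<tau> * f1 \<sigma>))"
      unfolding 1 by (simp add: algebra_simps)
    also have "\<dots> = u * v * (of_int (a * a' + b * c') * f2 \<tau> + of_int (a * b' + b * d') * f1 \<tau>)"
      unfolding 2 by (simp add: algebra_simps)
    finally show "aut_factor (A ** B) \<tau> * f2 (moebius_act (A ** B) \<tau>) =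
        u * v * (of_int ((A ** B)$1$1) * f2 \<tau> + of_int ((A ** B)$1$2) * f1 \<tau>)"
      unfolding A B mat22_mult mat22_nth .
  qed
qed

lemma equivariant_pair_adjugate:
  assumes "equivariant_pair 1 f1 f2 (mat22 a b c d)"
  shows "equivariant_pair 1 f1 f2 (mat22 d (-b) (-c) a)"
  unfolding equivariant_pair_def
proof (intro conjI ballI)
  let ?A = "mat22 a b c d" and ?A' = "mat22 d (-b) (-c) a"
  have det: "a * d - b * c = 1" and detA: "det ?A = 1" using assms by (auto simp: equivariant_pair_def)
  then show detA': "det ?A' = 1" by (simp add: algebra_simps)
  have det': "of_int a * of_int d - of_int b * of_int c = (1 :: complex)"
    using det by (metis of_int_1 of_int_diff of_int_mult)
  have one: "?A ** ?A' = mat22 1 0 0 1" using det by (simp add: algebra_simps)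
  fix \<tau> assume \<tau>: "\<tau> \<in> upper_half"
  define \<sigma> where "\<sigma> = moebius_act ?A' \<tau>"
  have \<sigma>: "\<sigma> \<in> upper_half" unfolding \<sigma>_def by (rule moebius_act_upper_half[OF detA' \<tau>])
  note co = aut_factor_moebius_act_mult[OF detA detA' \<tau>, folded \<sigma>_def, unfolded one]
  have co1: "aut_factor ?A \<sigma> * aut_factor ?A' \<tau> = 1" and co2: "moebius_act ?A \<sigma> = \<tau>"
    using co by (simp_all add: aut_factor_mat22[of 1 0 0 1] moebius_act_mat22[of 1 0 0 1])
  have 1: "aut_factor ?A \<sigma> * f1 \<tau> = of_int c * f2 \<sigma> + of_int d * f1 \<sigma>"
    and 2: "aut_factor ?A \<sigma> * f2 \<tau> = of_int a * f2 \<sigma> + of_int b * f1 \<sigma>"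
    using assms \<sigma> co2 by (auto simp: equivariant_pair_def)
  have "aut_factor ?A' \<tau> * f1 \<sigma> = - of_int c * f2 \<tau> + of_int a * f1 \<tau>"
    "aut_factor ?A' \<tau> * f2 \<sigma> = of_int d * f2 \<tau> - of_int b * f1 \<tau>"
    if "x * y = 1" "x * f1 \<tau> = of_int c * f2 \<sigma> + of_int d * f1 \<sigma>"
      "x * f2 \<tau> = of_int a * f2 \<sigma> + of_int b * f1 \<sigma>" "y = aut_factor ?A' \<tau>" for x y
    using that det' by algebra+
  from this[OF co1 1 2 refl]
  show "aut_factor ?A' \<tau> * f1 (moebius_act ?A' \<tau>) = 1 * (of_int (?A'$2$1) * f2 \<tau> + of_int (?A'$2$2) * f1 \<tau>)"
    "aut_factor ?A' \<tau> * f2 (moebius_act ?A' \<tau>) = 1 * (of_int (?A'$1$1) * f2 \<tau> + of_int (?A'$1$2) * f1 \<tau>)"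
    by (simp_all add: \<sigma>_def)
qed

text \<open>
  The generators are \<open>P = S T\<close> and \<open>Q = T S\<close>, on which the two signs cancel.
\<close>
lemma equivariant_pair_gen_PQ:
  assumes S: "equivariant_pair \<epsilon> f1 f2 matS" and T: "equivariant_pair \<epsilon> f1 f2 (matT 1)"
    and \<epsilon>: "\<epsilon> * \<epsilon> = 1"
  shows "A \<in> gen_PQ \<Longrightarrow> equivariant_pair 1 f1 f2 A"
proof (induction rule: generate.induct)
  case one
  then show ?case using equivariant_pair_one by simp
next
  case (incl h)
  then show ?case
    using equivariant_pair_mult[OF S T] equivariant_pair_mult[OF T S] \<epsilon> by auto
next
  case (inv h)
  then have h: "equivariant_pair 1 f1 f2 h"
    using equivariant_pair_mult[OF S T] equivariant_pair_mult[OF T S] \<epsilon> by auto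
  obtain a b c d where hm: "h = mat22 a b c d" by (metis mat22_eta)
  have det: "a * d - b * c = 1" using h by (simp add: hm equivariant_pair_def)
  have "inv\<^bsub>SL2Z\<^esub> h = mat22 d (-b) (-c) a"
    unfolding hm by (rule SL2Z.inv_equality) (use det in \<open>auto simp: algebra_simps\<close>)
  then show ?case using equivariant_pair_adjugate h by (simp add: hm)
next
  case (eng h1 h2)
  then show ?case using equivariant_pair_mult[of 1 f1 f2 h1 1 h2] by simp
qed

text \<open>
  The whole group consists of the two cosets of the subgroup generated by \<open>P\<close> and \<open>Q\<close> with
  representatives \<open>1\<close> and \<open>T\<close>.
\<close>
lemma equivariant_pair_SL2Z:
  assumes S: "equivariant_pair 1 f1 f2 matS" and T: "equivariant_pair 1 f1 f2 (matT 1)"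
    and A: "det A = 1"
  shows "equivariant_pair 1 f1 f2 A"
proof -
  have gen: "equivariant_pair 1 f1 f2 B" if "B \<in> gen_PQ" for B
    using equivariant_pair_gen_PQ[OF S T _ that] by simp
  have "A \<in> gen_PQ \<or> matT (-1) ** A \<in> gen_PQ"
    using SL2Z_two_cosets[OF A] by (simp add: two_cosets_def)
  then show ?thesis
  proof
    assume "matT (-1) ** A \<in> gen_PQ"
    from equivariant_pair_mult[OF T gen[OF this]]
    show ?thesis by (simp add: matrix_mul_assoc flip: mat_1_eq)
  qed (rule gen)
qed

lemma equivariant_pair_S_T:
  assumes "\<And>\<tau>. \<tau> \<in> upper_half \<Longrightarrow> f2 \<tau> = \<epsilon> * (\<tau> * f1 (- 1 / \<tau>))" and \<epsilon>: "\<epsilon> * \<epsilon> = 1"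
    and "\<And>\<tau>. \<tau> \<in> upper_half \<Longrightarrow> f1 (\<tau> + 1) = \<epsilon> * f1 \<tau>"
    and "\<And>\<tau>. \<tau> \<in> upper_half \<Longrightarrow> f2 (\<tau> + 1) = \<epsilon> * (f1 \<tau> + f2 \<tau>)"
  shows "equivariant_pair \<epsilon> f1 f2 matS" and "equivariant_pair \<epsilon> f1 f2 (matT 1)"
proof -
  have "\<tau> * f1 (- 1 / \<tau>) = \<epsilon> * f2 \<tau> \<and> \<tau> * f2 (- 1 / \<tau>) = - \<epsilon> * f1 \<tau>" if "\<tau> \<in> upper_half" for \<tau>
  proof -
    have "\<tau> \<noteq> 0" using that by (auto simp: upper_half_def)
    then show ?thesis
      using assms(1)[OF that] assms(1)[OF upper_half_S[OF that]] \<epsilon> by (simp flip: mult.assoc)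
  qed
  then show "equivariant_pair \<epsilon> f1 f2 matS"
    by (simp add: equivariant_pair_def aut_factor_mat22 moebius_act_mat22)
  show "equivariant_pair \<epsilon> f1 f2 (matT 1)"
    using assms(3,4) by (simp add: equivariant_pair_def aut_factor_mat22 moebius_act_mat22 add.commute)
qed

text \<open>
  Substitute \<open>f2 = \<tau> f1 + g\<close> in the two transformation laws. In the second one the factors of \<open>f1\<close>
  cancel, and \<open>g\<close> is multiplied by the determinant.
\<close>
lemma equivariant_pair_imp_quasimodular:
  assumes "equivariant_pair 1 f1 f2 A" "\<tau> \<in> upper_half"
  defines "g \<equiv> \<lambda>\<tau>. f2 \<tau> - \<tau> * f1 \<tau>"
  shows "f1 (moebius_act A \<tau>) = f1 \<tau> + g \<tau> * (of_int (A$2$1) / aut_factor A \<tau>)"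
    and "g (moebius_act A \<tau>) = aut_factor A \<tau> powi (- 2) * g \<tau>"
proof -
  obtain a b c d where A: "A = mat22 a b c d" by (metis mat22_eta)
  define j where "j = aut_factor A \<tau>"
  define \<sigma> where "\<sigma> = moebius_act A \<tau>"
  have det: "det A = 1" using assms by (simp add: equivariant_pair_def)
  have j: "j \<noteq> 0" unfolding j_def by (rule aut_factor_nonzero[OF det assms(2)])
  have j': "j = of_int c * \<tau> + of_int d" by (simp add: j_def A aut_factor_mat22)
  have \<sigma>: "j * \<sigma> = of_int a * \<tau> + of_int b"
    using j by (simp add: \<sigma>_def A moebius_act_mat22 j' aut_factor_mat22)
  have det': "of_int a * of_int d - of_int b * of_int c = (1 :: complex)"
    using det unfolding A det_mat22 by (metis of_int_1 of_int_diff of_int_mult)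
  have 1: "j * f1 \<sigma> = of_int c * f2 \<tau> + of_int d * f1 \<tau>"
    and 2: "j * f2 \<sigma> = of_int a * f2 \<tau> + of_int b * f1 \<tau>"
    using assms by (auto simp: equivariant_pair_def A j_def \<sigma>_def)
  have "j * f1 \<sigma> = j * f1 \<tau> + g \<tau> * of_int c"
    unfolding 1 by (simp add: j' g_def algebra_simps)
  then have "f1 \<sigma> = f1 \<tau> + g \<tau> * (of_int c / j)" using j by (simp add: field_simps)
  then show "f1 (moebius_act A \<tau>) = f1 \<tau> + g \<tau> * (of_int (A$2$1) / aut_factor A \<tau>)"
    by (simp add: A \<sigma>_def j_def)
  have "j * j * g \<sigma> = j * (j * f2 \<sigma>) - (j * \<sigma>) * (j * f1 \<sigma>)"
    by (simp add: g_def algebra_simps)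
  also have "\<dots> = (of_int a * of_int d - of_int b * of_int c) * g \<tau>"
    unfolding 1 2 \<sigma> by (simp add: j' g_def algebra_simps)
  finally have "j * j * g \<sigma> = g \<tau>" unfolding det' by simp
  then have "g \<sigma> = j powi (- 2) * g \<tau>"
    using j by (simp add: power_int_minus power2_eq_square field_simps)
  then show "g (moebius_act A \<tau>) = aut_factor A \<tau> powi (- 2) * g \<tau>"
    by (simp add: j_def \<sigma>_def)
qed

lemma cusp_width_SL2Z: "cusp_width (carrier SL2Z) = 1"
  unfolding cusp_width_def by (rule Least_equality) auto

lemma cusp_width_SL2Z_sq: "cusp_width SL2Z_sq = 2"
  unfolding cusp_width_def SL2Z_sq_eq_generate
proof (rule Least_equality)
  show "0 < (2 :: nat) \<and> mat22 1 (int 2) 0 1 \<in> gen_PQ" using gen_PQ_basic by simp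
  fix h :: nat assume h: "0 < h \<and> mat22 1 (int h) 0 1 \<in> gen_PQ"
  have "h \<noteq> 1"
  proof
    assume "h = 1"
    with h have "matT 1 \<in> gen_PQ" by simp
    from sgn2_gen_PQ[OF this] show False by (simp add: sgn2_def)
  qed
  with h show "2 \<le> h" by linarith
qed

text \<open>
  The parity condition says that \<open>q\<^sup>m\<^sup>/\<^sup>2\<close> is an integral power of the local parameter. For odd \<open>m\<close> it
  requires a cusp of even width, as that of the subgroup of index two.
\<close>
lemma qexp_meromorphic_at_cusp:
  assumes F: "fps_conv_radius F \<ge> 1" and h: "cusp_width \<Gamma> > 0" "even (m * int (cusp_width \<Gamma>))"
    and f: "\<And>\<tau>. \<tau> \<in> upper_half \<Longrightarrow> f \<tau> = qexp m F \<tau>"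
  shows "meromorphic_at_cusp \<Gamma> f"
  unfolding meromorphic_at_cusp_def
proof (intro exI conjI ballI)
  let ?h = "cusp_width \<Gamma>"
  define k where "k = m * int ?h div 2"
  let ?F = "\<lambda>z. z powi k * eval_fps F (z ^ ?h)"
  have k: "2 * k = m * int ?h" using h(2) by (simp add: k_def)
  have "eval_fps F holomorphic_on ball 0 1"
  proof (rule holomorphic_on_eval_fps)
    show "ball 0 1 \<subseteq> eball 0 (fps_conv_radius F)"
      using F eball_mono[of 1 "fps_conv_radius F" 0] by (simp add: one_ereal_def)
  qed
  moreover have "(\<lambda>z::complex. z ^ ?h) holomorphic_on ball 0 1" by (intro holomorphic_intros)
  moreover have "(\<lambda>z::complex. z ^ ?h) ` ball 0 1 \<subseteq> ball 0 1"
    using h(1) by (auto simp: norm_power power_less_one_iff)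
  ultimately have "(eval_fps F \<circ> (\<lambda>z. z ^ ?h)) holomorphic_on ball 0 1"
    by (metis holomorphic_on_compose_gen)
  then have "(eval_fps F \<circ> (\<lambda>z. z ^ ?h)) analytic_on ball 0 1"
    by (simp add: analytic_on_open)
  then have "(eval_fps F \<circ> (\<lambda>z. z ^ ?h)) analytic_on {0}"
    by (rule analytic_on_subset) simp
  then have "(\<lambda>z. eval_fps F (z ^ ?h)) meromorphic_on {0}"
    unfolding o_def by (rule analytic_on_imp_meromorphic_on)
  moreover have "(\<lambda>z::complex. z powi k) meromorphic_on {0}" by (intro meromorphic_intros)
  ultimately show "?F meromorphic_on {0}" by (intro meromorphic_on_mult)
  fix \<tau> assume \<tau>: "\<tau> \<in> upper_half"
  define z where "z = exp (2 * of_real pi * \<i> * \<tau> / of_nat ?h)"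
  have "z ^ ?h = qpar \<tau>" using h(1) by (simp add: z_def qpar_def flip: exp_of_nat_mult)
  moreover have "z powi k = exp (of_int k * (2 * of_real pi * \<i> * \<tau> / of_nat ?h))"
    by (simp add: z_def exp_power_int)
  moreover have "of_int k * (2 * of_real pi * \<i> * \<tau> / of_nat ?h) = of_real pi * \<i> * of_int m * \<tau>"
  proof -
    have "2 * of_int k = of_int m * (of_nat ?h :: complex)"
      using arg_cong[OF k, of "of_int :: int \<Rightarrow> complex"] by simp
    then show ?thesis using h(1) by (simp add: field_simps)
  qed
  ultimately show "f \<tau> = z powi k * eval_fps F (z ^ ?h)" using f[OF \<tau>] by (simp add: qexp_def)
qed

lemma qexp_imp_q_expansion:
  assumes "fps_conv_radius F \<ge> 1" "\<And>\<tau>. \<tau> \<in> upper_half \<Longrightarrow> f \<tau> = qexp m F \<tau>"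
  shows "q_expansion m (fps_nth F) f"
  unfolding q_expansion_def
  using assms by (auto simp: qexp_def eval_fps_def intro!: summable_fps qpar_in_radius)

text \<open>
  Otherwise \<open>F\<close> would vanish along a sequence tending to \<open>0\<close>, and so would its constant term.
\<close>
lemma qexp_nonzero:
  assumes F: "fps_conv_radius F \<ge> 1" "fps_nth F 0 \<noteq> 0"
  obtains \<tau> where "\<tau> \<in> upper_half" "qexp m F \<tau> \<noteq> 0"
proof -
  have "\<exists>n. eval_fps F (qpar (\<i> * of_nat (Suc n))) \<noteq> 0"
  proof (rule ccontr)
    assume "\<nexists>n. eval_fps F (qpar (\<i> * of_nat (Suc n))) \<noteq> 0"
    then have "(\<lambda>n::nat. 0) \<longlonglongrightarrow> fps_nth F 0" using eval_fps_qpar_tendsto[OF F(1)] by simp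
    then show False using F(2) by (simp add: LIMSEQ_const_iff)
  qed
  then obtain n where "eval_fps F (qpar (\<i> * of_nat (Suc n))) \<noteq> 0" by blast
  then show ?thesis using that[of "\<i> * of_nat (Suc n)"] by (simp add: qexp_def upper_half_def)
qed

lemma wronskian_cmult:
  assumes "G holomorphic_on upper_half" "\<tau> \<in> upper_half"
  shows "wronskian F (\<lambda>\<tau>. c * G \<tau>) \<tau> = c * wronskian F G \<tau>"
proof -
  have "deriv (\<lambda>\<tau>. c * G \<tau>) \<tau> = c * deriv G \<tau>"
    by (rule DERIV_imp_deriv[OF DERIV_cmult[OF holomorphic_derivI[OF assms(1) open_upper_half assms(2)]]])
  then show ?thesis by (simp add: wronskian_def algebra_simps)
qed

section \<open>The pair of solutions\<close>

theorem theorem4p2: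
  fixes r :: nat and \<Gamma> :: "(int^2^2) set"
  assumes "r > 0"
    and "\<Gamma> = (if even r then carrier SL2Z else SL2Z_sq)"
  shows "\<exists>f1 f2 :: complex \<Rightarrow> complex.
           ode_solution r f1 \<and> ode_solution r f2 \<and> lin_indep_on_upper_half f1 f2 \<and>
           (\<exists>\<alpha> \<beta> :: nat \<Rightarrow> complex.
              \<alpha> 0 \<noteq> 0 \<and> q_expansion (int r) \<alpha> f1 \<and>
              \<beta> 0 \<noteq> 0 \<and> q_expansion (- int r) \<beta> (\<lambda>\<tau>. f2 \<tau> - \<tau> * f1 \<tau>)) \<and>
           quasi_modular_form \<Gamma> 0 1 f1 \<and>
           modular_form \<Gamma> (-2) (\<lambda>\<tau>. f2 \<tau> - \<tau> * f1 \<tau>) \<and>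
           quotient_shift_by_1 f2 f1"
proof -
  define \<epsilon> :: complex where "\<epsilon> = (- 1) ^ r"
  define A where "A = frobenius_fps r"
  define f1 where "f1 = qexp (int r) A"
  define G where "G = (\<lambda>\<tau>. \<tau> * f1 (- 1 / \<tau>))"
  define f2 where "f2 = (\<lambda>\<tau>. \<epsilon> * G \<tau>)"
  define g where "g = (\<lambda>\<tau>. f2 \<tau> - \<tau> * f1 \<tau>)"
  have \<epsilon>: "\<epsilon> * \<epsilon> = 1" unfolding \<epsilon>_def by (simp flip: power_add)
  have A: "fps_conv_radius A \<ge> 1" "fps_nth A 0 = 1"
    using frobenius_fps_radius by (auto simp: A_def frobenius_fps_def frobenius_coeff_0)
  have f1: "ode_solution r f1" unfolding f1_def A_def by (rule frobenius_solution)
  have f1T: "f1 (\<tau> + 1) = \<epsilon> * f1 \<tau>" for \<tau>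
    by (simp add: f1_def qexp_def \<epsilon>_def qpar_plus_1 distrib_left exp_add exp_pi_i_nat)
  obtain \<tau>0 where \<tau>0: "\<tau>0 \<in> upper_half" "f1 \<tau>0 \<noteq> 0"
    unfolding f1_def by (rule qexp_nonzero[of A "int r"]) (simp_all add: A)
  obtain w where w: "w \<noteq> 0" "\<And>\<tau>. \<tau> \<in> upper_half \<Longrightarrow> wronskian f1 G \<tau> = w"
    and GT: "\<And>\<tau>. \<tau> \<in> upper_half \<Longrightarrow> G (\<tau> + 1) = f1 \<tau> + \<epsilon> * G \<tau>"
    using second_solution_T[OF f1 f1T \<epsilon> \<tau>0] unfolding G_def by metis
  have G: "ode_solution r G" unfolding G_def by (rule ode_solution_S[OF f1])
  have f2: "ode_solution r f2" unfolding f2_def by (rule ode_solution_cmult[OF G])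
  have hol: "f1 holomorphic_on upper_half" "G holomorphic_on upper_half" "f2 holomorphic_on upper_half"
    using f1 G f2 by (simp_all add: ode_solution_def)
  have w2: "wronskian f1 f2 \<tau> = \<epsilon> * w" if "\<tau> \<in> upper_half" for \<tau>
    unfolding f2_def using wronskian_cmult[OF hol(2) that] w(2)[OF that] by simp
  have w0: "\<epsilon> * w \<noteq> 0" using w(1) \<epsilon> by auto
  have f2T: "f2 (\<tau> + 1) = \<epsilon> * (f1 \<tau> + f2 \<tau>)" if "\<tau> \<in> upper_half" for \<tau>
    using GT[OF that] \<epsilon> by (simp add: f2_def distrib_left flip: mult.assoc)
  obtain B where B: "fps_conv_radius B \<ge> 1" "fps_nth B 0 \<noteq> 0"
    and gB: "\<And>\<tau>. \<tau> \<in> upper_half \<Longrightarrow> g \<tau> = qexp (- int r) B \<tau>"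
    using second_solution_expansion[OF assms(1) A hol(3) w2[unfolded f1_def] w0 f1T[unfolded f1_def \<epsilon>_def]
        f2T[unfolded f1_def \<epsilon>_def]]
    unfolding g_def f1_def by metis
  have ST: "equivariant_pair \<epsilon> f1 f2 matS" "equivariant_pair \<epsilon> f1 f2 (matT 1)"
    using equivariant_pair_S_T[of f2 \<epsilon> f1] \<epsilon> f1T f2T by (simp_all add: f2_def G_def)
  have \<Gamma>: "equivariant_pair 1 f1 f2 X" if X: "X \<in> \<Gamma>" for X
  proof (cases "even r")
    case True
    then have "\<epsilon> = 1" by (simp add: \<epsilon>_def)
    note ST[unfolded this]
    moreover have "det X = 1" using X True unfolding assms(2) by simp
    ultimately show ?thesis by (rule equivariant_pair_SL2Z)
  next
    case False
    then have "X \<in> gen_PQ" using X unfolding assms(2) by (simp add: SL2Z_sq_eq_generate)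
    then show ?thesis by (rule equivariant_pair_gen_PQ[OF ST \<epsilon>])
  qed
  have width: "cusp_width \<Gamma> > 0" "even (int r * int (cusp_width \<Gamma>))" "even (- int r * int (cusp_width \<Gamma>))"
    unfolding assms(2) by (auto simp: cusp_width_SL2Z cusp_width_SL2Z_sq)
  have cusp: "meromorphic_at_cusp \<Gamma> f1" "meromorphic_at_cusp \<Gamma> g"
    by (rule qexp_meromorphic_at_cusp[OF A(1) width(1,2)], simp add: f1_def)
       (rule qexp_meromorphic_at_cusp[OF B(1) width(1,3)], rule gB)
  have g_hol: "g holomorphic_on upper_half"
    unfolding g_def by (intro holomorphic_intros hol)
  have "lin_indep_on_upper_half f1 f2"
    using wronskian_nonzero_imp_lin_indep[OF hol(1,3) \<tau>0(1)] w2[OF \<tau>0(1)] w0 by simp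
  moreover have "q_expansion (int r) (fps_nth A) f1" "q_expansion (- int r) (fps_nth B) g"
    by (rule qexp_imp_q_expansion[OF A(1)], simp add: f1_def)
       (rule qexp_imp_q_expansion[OF B(1)], rule gB)
  moreover have "quasi_modular_form \<Gamma> 0 1 f1"
    unfolding quasi_modular_form_def
  proof (intro conjI exI[of _ "\<lambda>i. if i = 0 then f1 else g"] ballI)
    obtain \<tau> where "\<tau> \<in> upper_half" "qexp (- int r) B \<tau> \<noteq> 0" by (rule qexp_nonzero[OF B])
    then show "\<exists>\<tau>\<in>upper_half. (if 1 = (0 :: nat) then f1 else g) \<tau> \<noteq> 0" using gB by auto
  next
    fix X \<tau> assume "X \<in> \<Gamma>" "\<tau> \<in> upper_half"
    then show "aut_factor X \<tau> powi - 0 * f1 (moebius_act X \<tau>) =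
        (\<Sum>i\<le>1. (if i = 0 then f1 else g) \<tau> * (of_int (X$2$1) / aut_factor X \<tau>) ^ i)"
      using equivariant_pair_imp_quasimodular(1)[OF \<Gamma>, of X \<tau>] by (simp add: g_def)
  qed (use hol cusp g_hol in auto)
  moreover have "modular_form \<Gamma> (-2) g"
    unfolding modular_form_def
  proof (intro conjI ballI)
    fix X \<tau> assume "X \<in> \<Gamma>" "\<tau> \<in> upper_half"
    then show "g (moebius_act X \<tau>) = aut_factor X \<tau> powi - 2 * g \<tau>"
      unfolding g_def by (intro equivariant_pair_imp_quasimodular(2)[OF \<Gamma>])
  qed (fact g_hol cusp(2))+
  moreover have "quotient_shift_by_1 f2 f1"
    unfolding quotient_shift_by_1_def
  proof (intro ballI conjI impI)
    fix \<tau> assume \<tau>: "\<tau> \<in> upper_half"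
    have \<epsilon>0: "\<epsilon> \<noteq> 0" using \<epsilon> by auto
    show "f1 (\<tau> + 1) = 0 \<longleftrightarrow> f1 \<tau> = 0" using \<epsilon>0 by (simp add: f1T)
    assume "f1 \<tau> \<noteq> 0"
    then show "f2 (\<tau> + 1) / f1 (\<tau> + 1) = f2 \<tau> / f1 \<tau> + 1"
      using \<epsilon>0 unfolding f1T f2T[OF \<tau>] by (simp add: add_divide_distrib)
  qed
  ultimately show ?thesis
    using f1 f2 A(2) B(2) unfolding g_def
    by (intro exI[of _ f1] exI[of _ f2] conjI exI[of _ "fps_nth A"] exI[of _ "fps_nth B"]) simp_all
qed

end
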